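(* Let $h:[0,1]\to(0,\infty)$ and $f:[0,\infty)\to[0,\infty)$ be continuously differentiable, suppose there is $t_0\ge0$ with $f>0$ on $[t_0,\infty)$ and $f\in C^2([t_0,\infty))$, put $g=\log f$ on $[t_0,\infty)$, and assume condition (H1) of the context with $q\in[1,2)$. Let $(\lambda_n,\mu_n,u_n)\in(0,\infty)\times(0,\infty)\times C^2([0,1])$ satisfy $-u_n''-\frac1r u_n'=\lambda_n h(r)f(u_n)$, $u_n>0$ in $(0,1)$, $u_n(0)=\mu_n$, $u_n'(0)=0=u_n(1)$, with $\mu_n\to\infty$. Then there is a subsequence (not relabeled) and, for each $k\in\mathbb{N}$, a sequence $(r_{k,n})\subset(0,1)$ with $u_n(r_{k,n})/\mu_n\to\delta_k$, $\lambda_n r_{k,n}^2h(r_{k,n})f'(u_n(r_{k,n}))\to a_k^2/2$ and, if $q=1$, $u_n(r_{k,n})=\mu_n-(\log\frac1{\eta_k}+o(1))\frac{g(\mu_n)}{g'(\mu_n)}$, such that along this subsequence the following hold. (1) For any sequence $(r_n)\subset(0,1)$ with $u_n(r_n)/\mu_n\to0$ if $q>1$, respectively $(\mu_n-u_n(r_n))\frac{g'(\mu_n)}{g(\mu_n)}\to\infty$ if $q=1$, we have $\lim_{n\to\infty}\int_0^{r_n}\lambda_n h f'(u_n)\,r\,dr=\infty$. (2) $g'(\mu_n)u_n(r)\to\infty$ for every $r\in[0,1)$. (3) If in addition, in the case $q=1$, $\inf_{t>0} f(t)/t>0$, then for all $q\in[1,2)$, $$\lim_{n\to\infty}\frac{\log\frac1{\lambda_n}}{g(\mu_n)}=0\quad\text{and}\quad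 \lim_{n\to\infty}\frac{\log\frac1{r_{k,n}}}{g(\mu_n)}=\frac{\eta_k}{2}\ \text{ for all }k\in\mathbb{N}.$$
   Context: Condition (H1): (i) $g'(t)>0$ and $g''(t)>0$ for all $t\ge t_0$, and there is a pair $(q,p)$ with either $q=1$ and $p\in(0,\infty]$, or $q\in(1,\infty)$ and $p\in(0,\infty)$, such that $\lim_{t\to\infty}\frac{g'(t)^2}{g(t)g''(t)}=q$ and $\lim_{t\to\infty}\frac{tg'(t)}{g(t)}=p$; (ii) if $q=1$, then $tg'(t)/g(t)$ is nondecreasing on $[t_0,\infty)$ and there exist $k\in\mathbb{N}$ and $\hat g\in C^2([t_0,\infty))$ with $f=\exp_k\circ\hat g$ and $\hat g'/\hat g$ nonincreasing on $[t_0,\infty)$ ($\exp_1=\exp$, $\exp_k=\exp_{k-1}\circ\exp$). Under (H1), $1/p+1/q=1$ ($1/\infty=0$). Sequences: $a_1=2$, $\delta_1=1$, $\eta_1=1$. If $q\in(1,2)$: $\delta_{k+1}\in(0,\delta_k)$ solves $\frac{2p}{2+a_k}\big(1-\frac{\delta_{k+1}}{\delta_k}\big)-1+\big(\frac{\delta_{k+1}}{\delta_k}\big)^p=0$, $a_{k+1}=2-\big(\frac{\delta_{k+1}}{\delta_k}\big)^{p-1}(2+a_k)$, $\eta_k=\delta_k^p$. If $q=1$: $\eta_{k+1}\in(0,\eta_k)$ solves $\frac{2}{2+a_k}\log\frac{\eta_k}{\eta_{k+1}}-1+\frac{\eta_{k+1}}{\eta_k}=0$, $a_{k+1}=2-\frac{\eta_{k+1}}{\eta_k}(2+a_k)$,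 and $\delta_k=1$. These are well-defined. In integrals $h=h(r)$, $f'(u_n)=f'(u_n(r))$. *)

theory Defs
  imports "HOL-Analysis.Analysis"
begin

text \<open>Recursive sequences of the context. Index k = 0 here corresponds to
  the paper's index k = 1.\<close>

fun seqH :: "real \<Rightarrow> nat \<Rightarrow> real \<times> real" where
  "seqH p 0 = (2, 1)"
| "seqH p (Suc k) =
     (let a = fst (seqH p k); d = snd (seqH p k);
          d' = (SOME d'. 0 < d' \<and> d' < d \<and>
                  2 * p / (2 + a) * (1 - d' / d) - 1 + (d' / d) powr p = 0)
      in (2 - (d' / d) powr (p - 1) * (2 + a), d'))"

fun seqL :: "nat \<Rightarrow> real \<times> real" where
  "seqL 0 = (2, 1)"
| "seqL (Suc k) =
     (let a = fst (seqL k); e = snd (seqL k);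
          e' = (SOME e'. 0 < e' \<and> e' < e \<and>
                  2 / (2 + a) * ln (e / e') - 1 + e' / e = 0)
      in (2 - e' / e * (2 + a), e'))"

text \<open>Paper-indexed sequences (k \<ge> 1).\<close>
definition a_seq :: "real \<Rightarrow> real \<Rightarrow> nat \<Rightarrow> real" where
  "a_seq q p k = (if q = 1 then fst (seqL (k - 1)) else fst (seqH p (k - 1)))"

definition delta_seq :: "real \<Rightarrow> real \<Rightarrow> nat \<Rightarrow> real" where
  "delta_seq q p k = (if q = 1 then 1 else snd (seqH p (k - 1)))"

definition eta_seq :: "real \<Rightarrow> real \<Rightarrow> nat \<Rightarrow> real" where
  "eta_seq q p k = (if q = 1 then snd (seqL (k - 1)) else (snd (seqH p (k - 1))) powr p)"

end

theory Submission
  imports Defs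
begin

text \<open>
  In the variable \<open>t = - ln r\<close> the function \<open>w(t) = u(exp (- t))\<close> is concave and solves
  \<open>w'' = - lam * exp (- 2 * t) * h * f(w)\<close>. The quantities \<open>P = g'(w) * w'\<close> and
  \<open>Y = lam * r\<^sup>2 * h * f'(u)\<close> satisfy a perturbed Liouville system \<open>P' = eps * P\<^sup>2 - Y\<close>,
  \<open>Y' = Y * (P - 2 + eps * P + H)\<close> with \<open>eps = g''(w) / g'(w)\<^sup>2\<close> and \<open>H\<close> the logarithmic derivative of \<open>h\<close>.
  Its energy \<open>Q = (P - 2)\<^sup>2 / 2 + Y\<close> changes at most by a multiple of the increment of \<open>ln g'(w)\<close>, up to a
  vanishing error. Hence, going down from the maximum, every peak of \<open>Y\<close> (where \<open>P = 2\<close>)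
  reflects \<open>P\<close> from \<open>2 - a\<close> to \<open>2 + a\<close>; then \<open>Y\<close> is exponentially small and \<open>w\<close> is
  nearly linear, until \<open>ln Y\<close> has climbed back. Where this happens, and the slope found there, is
  exactly the recursion for the sequences.

  A Pohozaev type inequality gives \<open>P\<^sup>2 / 2 + Y \<le> c * P\<close> with \<open>c\<close> close to 2. A very small value of \<open>P\<close>
  would force \<open>w\<close> to be linear so long that \<open>P\<close> exceeds 4, because \<open>1 - 1 / q < 1 / 2\<close>; so \<open>P\<close> is
  bounded below at all heights above a fixed one. This controls \<open>lam\<close> and \<open>w'\<close> at that height, and since the
  levels of the peaks exhaust the range, the three claims follow along the full sequence.
\<close>

section \<open>The nonlinearity\<close>

text \<open>Both cases are treated at once through \<open>kap = 1 - 1 / q\<close>, which is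
  \<open>1 / p\<close>. Depth below the maximum is measured in units of \<open>y = g / g'\<close>.
  Since \<open>y'\<close> tends to \<open>kap\<close>, the ratios of \<open>g\<close> and of
  \<open>g'\<close> between the maximum and scaled depth \<open>z\<close> have limits as long as
  \<open>kap * z < 1\<close>. For \<open>q = 1\<close> every \<open>z\<close> is allowed; for
  \<open>q > 1\<close> the end \<open>1 / kap = p\<close> of the range corresponds to
  \<open>u / mu\<close> tending to 0. The obstacle is that this scaling never reaches a fixed
  height, whereas the size of \<open>lam\<close> is controlled only there. The lower bound for
  \<open>P\<close> bridges that gap. No compactness enters: each peak is produced by an intermediate
  value argument with prescribed tolerance, and its depth and size have limits fixed by the
  recursion. That the levels pass every admissible depth cannot be read off the recursion directly;
  it rests on the inequality \<open>a_k >= 2 * eta_k\<close>, which prevents the depths from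
  accumulating inside the range.\<close>

lemma first_hit:
  fixes F :: "real \<Rightarrow> real"
  assumes "a \<le> b" "continuous_on {a..b} F" "F a < c" "c \<le> F b"
  obtains s where "a < s" "s \<le> b" "F s = c" "\<And>x. a \<le> x \<Longrightarrow> x < s \<Longrightarrow> F x < c"
proof -
  define A where "A = {x\<in>{a..b}. c \<le> F x}"
  define s where "s = Inf A"
  have "closed A"
  proof -
    have "A = {a..b} \<inter> F -` {c..}" by (auto simp: A_def)
    then show ?thesis by (simp add: continuous_closed_preimage[OF assms(2)])
  qed
  have "b \<in> A" using assms by (auto simp: A_def)
  have bdd: "bdd_below A" by (auto simp: A_def)
  have "s \<in> A" unfolding s_def by (rule closed_contains_Inf) (use \<open>closed A\<close> bdd \<open>b \<in> A\<close> in auto)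
  have lt: "F x < c" if "a \<le> x" "x < s" for x
  proof (rule ccontr)
    assume "\<not> F x < c"
    with that \<open>s \<in> A\<close> have "x \<in> A" by (auto simp: A_def)
    then have "s \<le> x" unfolding s_def using bdd by (rule cInf_lower)
    with that show False by simp
  qed
  have "a \<noteq> s" using \<open>s \<in> A\<close> assms(3) by (auto simp: A_def)
  then have "a < s" using \<open>s \<in> A\<close> by (auto simp: A_def)
  have "\<exists>x\<ge>a. x \<le> s \<and> F x = c"
    using \<open>s \<in> A\<close> assms(3) \<open>a < s\<close>
    by (intro IVT') (auto simp: A_def intro: continuous_on_subset[OF assms(2)])
  then obtain x where x: "a \<le> x" "x \<le> s" "F x = c" by blast
  then have "x = s" using lt[of x] by (cases "x = s") auto
  show ?thesis by (rule that[of s]) (use \<open>a < s\<close> \<open>s \<in> A\<close> x \<open>x = s\<close> lt in \<open>auto simp: A_def\<close>)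
qed

text \<open>Used together with \<open>first_hit\<close>: when a value is reached for the first time,
  the derivative is nonnegative. This sign is all that is taken from upward crossings.\<close>

lemma DERIV_left_max_nonneg:
  fixes F :: "real \<Rightarrow> real"
  assumes "(F has_real_derivative D) (at s)" "a < s" "\<And>x. a \<le> x \<Longrightarrow> x < s \<Longrightarrow> F x < F s"
  shows "D \<ge> 0"
proof (rule ccontr)
  assume "\<not> D \<ge> 0"
  then obtain d where d: "d > 0" "\<And>h. h > 0 \<Longrightarrow> h < d \<Longrightarrow> F s < F (s - h)"
    using DERIV_neg_dec_left[OF assms(1)] by auto
  define h where "h = min (d/2) ((s-a)/2)"
  have "h > 0" "h < d" "h \<le> (s-a)/2" using d(1) assms(2) by (auto simp: h_def min_def)
  then show False using d(2)[of h] assms(3)[of "s-h"] assms(2) by auto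
qed

text \<open>Integration backwards from infinity. The values of \<open>P\<close> and \<open>Y\<close>
  are known in the limit \<open>t = \<infinity>\<close>, that is at \<open>r = 0\<close>, so
  comparisons start there rather than at a finite time.\<close>

lemma DERIV_nonneg_le_lim:
  fixes F :: "real \<Rightarrow> real"
  assumes "\<And>x. a \<le> x \<Longrightarrow> \<exists>y. (F has_real_derivative y) (at x) \<and> y \<ge> 0" "(F \<longlongrightarrow> L) at_top"
  shows "F a \<le> L"
proof (rule tendsto_lowerbound[OF assms(2)])
  show "\<forall>\<^sub>F x in at_top. F a \<le> F x"
    using eventually_ge_at_top[of a]
  proof eventually_elim
    case (elim x)
    show ?case by (rule DERIV_nonneg_imp_nondecreasing[OF elim assms(1)])
  qed
qed simp

lemma eventually_at_top_ge:
  fixes P :: "real \<Rightarrow> bool"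
  assumes "\<forall>\<^sub>F x in at_top. P x" "filterlim f at_top F"
  shows "\<forall>\<^sub>F n in F. \<forall>x\<ge>f n. P x"
proof -
  obtain N where N: "\<And>x. x \<ge> N \<Longrightarrow> P x" using assms(1) by (auto simp: eventually_at_top_linorder)
  have "\<forall>\<^sub>F n in F. f n \<ge> N" using assms(2) by (auto simp: filterlim_at_top)
  then show ?thesis by eventually_elim (use N in auto)
qed

section \<open>Asymptotic growth of \<open>g\<close>, of its derivative and of their
  quotient\<close>

locale nonlinearity =
  fixes g g1 g2 :: "real \<Rightarrow> real" and t0 q :: real
  assumes t0_nonneg: "0 \<le> t0"
    and g_deriv: "t0 < t \<Longrightarrow> (g has_real_derivative g1 t) (at t)"
    and g1_deriv: "t0 < t \<Longrightarrow> (g1 has_real_derivative g2 t) (at t)"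
    and g1_pos: "t0 < t \<Longrightarrow> 0 < g1 t"
    and g2_pos: "t0 < t \<Longrightarrow> 0 < g2 t"
    and q_ge_1: "1 \<le> q" and q_less_2: "q < 2"
    and q_lim: "((\<lambda>t. (g1 t)\<^sup>2 / (g t * g2 t)) \<longlongrightarrow> q) at_top"
begin

text \<open>\<open>kap\<close> is the reciprocal of \<open>p\<close>, with value 0 for
  \<open>p = \<infinity>\<close>. \<open>y\<close> is the natural unit of height at a given level,
  and \<open>eps\<close> is minus the derivative of \<open>1 / g1\<close>; they are tied together by
  \<open>y' = 1 - g * eps\<close>.\<close>

definition kap :: real where "kap = 1 - 1 / q"
definition y :: "real \<Rightarrow> real" where "y t = g t / g1 t"
definition eps :: "real \<Rightarrow> real" where "eps t = g2 t / (g1 t)\<^sup>2"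

lemma kap_nonneg: "0 \<le> kap" and kap_less_half: "kap < 1/2"
  using q_ge_1 q_less_2 by (auto simp: kap_def field_simps)

lemma eps_pos: "t0 < t \<Longrightarrow> 0 < eps t"
  using g1_pos[of t] g2_pos[of t] by (auto simp: eps_def)

lemma g1_strict_mono: "t0 < a \<Longrightarrow> a < b \<Longrightarrow> g1 a < g1 b"
  by (rule DERIV_pos_imp_increasing[of a b g1]) (meson g1_deriv g2_pos order_less_le_trans)+

lemma g1_mono: "t0 < a \<Longrightarrow> a \<le> b \<Longrightarrow> g1 a \<le> g1 b"
  using g1_strict_mono[of a b] by (cases "a = b") auto

lemma g_tangent:
  assumes "t0 < a" "a \<le> b"
  shows "g1 a * (b - a) \<le> g b - g a" "g b - g a \<le> g1 b * (b - a)"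
proof -
  have "g1 a * (b - a) \<le> g b - g a \<and> g b - g a \<le> g1 b * (b - a)"
  proof (cases "a = b")
    case False
    then have "a < b" using assms by simp
    then obtain x where x: "a < x" "x < b" "g b - g a = (b - a) * g1 x"
      using MVT2[of a b g g1] g_deriv assms by (meson order_less_le_trans)
    have "g1 a \<le> g1 x" "g1 x \<le> g1 b" using g1_mono assms x by auto
    then show ?thesis unfolding x(3) using \<open>a < b\<close> by (simp add: mult.commute mult_left_mono)
  qed auto
  then show "g1 a * (b - a) \<le> g b - g a" "g b - g a \<le> g1 b * (b - a)" by auto
qed

lemma g_mono: "t0 < a \<Longrightarrow> a \<le> b \<Longrightarrow> g a \<le> g b"
  using g_tangent(1)[of a b] g1_pos[of a] by (smt (verit) mult_nonneg_nonneg)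

lemma filterlim_g: "filterlim g at_top at_top"
proof -
  define a where "a = t0 + 1"
  have a: "t0 < a" by (simp add: a_def)
  have "filterlim (\<lambda>t. (g a - g1 a * a) + g1 a * t) at_top at_top"
    using g1_pos[OF a]
    by (intro filterlim_tendsto_add_at_top[OF tendsto_const]
         filterlim_tendsto_pos_mult_at_top[OF tendsto_const] filterlim_ident)
  then show ?thesis
    by (rule filterlim_at_top_mono)
       (use g_tangent(1)[OF a] in \<open>auto intro!: eventually_mono[OF eventually_ge_at_top[of a]] simp: algebra_simps\<close>)
qed

lemma ev_g_gt: "\<forall>\<^sub>F t in at_top. g t > c"
  using filterlim_g by (simp add: filterlim_at_top_dense)

lemma g_eps_lim: "((\<lambda>t. g t * eps t) \<longlongrightarrow> 1 / q) at_top"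
proof -
  have "((\<lambda>t. inverse ((g1 t)\<^sup>2 / (g t * g2 t))) \<longlongrightarrow> inverse q) at_top"
    by (rule tendsto_inverse[OF q_lim]) (use q_ge_1 in auto)
  then show ?thesis by (simp add: eps_def field_simps)
qed

lemma y_deriv: "t0 < t \<Longrightarrow> (y has_real_derivative 1 - g t * eps t) (at t)"
  unfolding y_def[abs_def] using g1_pos[of t]
  by (auto intro!: derivative_eq_intros g_deriv g1_deriv simp: eps_def field_simps power2_eq_square)

lemma dy_lim: "((\<lambda>t. 1 - g t * eps t) \<longlongrightarrow> kap) at_top"
  unfolding kap_def by (intro tendsto_intros g_eps_lim)

lemma eps_lim: "(eps \<longlongrightarrow> 0) at_top"
proof -
  have "((\<lambda>t. g t * eps t * inverse (g t)) \<longlongrightarrow> 1 / q * 0) at_top"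
    by (intro tendsto_mult g_eps_lim tendsto_inverse_0_at_top filterlim_g)
  moreover have "\<forall>\<^sub>F t in at_top. g t * eps t * inverse (g t) = eps t"
    using ev_g_gt[of 0] by eventually_elim auto
  ultimately show ?thesis by (auto simp: tendsto_cong)
qed

lemma y_over_t: "((\<lambda>t. y t / t) \<longlongrightarrow> kap) at_top"
  by (rule lhospital_at_top_at_top[where f' = "\<lambda>t. 1 - g t * eps t" and g' = "\<lambda>_. 1"])
     (use dy_lim in \<open>auto intro!: filterlim_ident eventually_mono[OF eventually_gt_at_top[of t0]] y_deriv\<close>)

text \<open>Since \<open>q < 2\<close>, eventually \<open>g * eps > 1/2\<close>, and then
  \<open>ln g1 - ln g / 2\<close> is nondecreasing. Hence \<open>g1\<close> grows at least like a
  multiple of the square root of \<open>g\<close>.\<close>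

lemma filterlim_g1: "filterlim g1 at_top at_top"
proof -
  define F where "F t = ln (g1 t) - ln (g t) / 2" for t
  have "1/2 < 1/q" using q_ge_1 q_less_2 by (auto simp: field_simps)
  then have "\<forall>\<^sub>F t in at_top. g t * eps t > 1/2"
    using order_tendstoD(1)[OF g_eps_lim] by blast
  then have "\<forall>\<^sub>F t in at_top. g t * eps t > 1/2 \<and> g t > 0 \<and> t > t0"
    using ev_g_gt[of 0] eventually_gt_at_top[of t0] by eventually_elim auto
  then obtain N where N: "\<And>t. t \<ge> N \<Longrightarrow> g t * eps t > 1/2 \<and> g t > 0 \<and> t > t0"
    by (auto simp: eventually_at_top_linorder)
  have mono: "F N \<le> F t" if "t \<ge> N" for t
  proof (rule DERIV_nonneg_imp_nondecreasing[OF that])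
    fix x assume "N \<le> x" "x \<le> t"
    then have x: "g x * eps x > 1/2" "g x > 0" "x > t0" using N[of x] by auto
    have "(F has_real_derivative (g1 x / g x) * (g x * eps x - 1/2)) (at x)"
      unfolding F_def[abs_def] using x g1_pos[OF x(3)]
      by (auto intro!: derivative_eq_intros g_deriv g1_deriv simp: eps_def field_simps power2_eq_square)
    then show "\<exists>y. (F has_real_derivative y) (at x) \<and> 0 \<le> y"
      using x g1_pos[OF x(3)] by (intro exI conjI) auto
  qed
  have "filterlim (\<lambda>t. exp (F N + 1/2 * ln (g t))) at_top at_top"
    by (intro filterlim_compose[OF exp_at_top] filterlim_tendsto_add_at_top[OF tendsto_const]
          filterlim_tendsto_pos_mult_at_top[OF tendsto_const] filterlim_compose[OF ln_at_top] filterlim_g) auto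
  then show ?thesis
  proof (rule filterlim_at_top_mono)
    show "\<forall>\<^sub>F t in at_top. exp (F N + 1/2 * ln (g t)) \<le> g1 t"
      using eventually_ge_at_top[of N]
    proof eventually_elim
      case (elim t)
      then have "F N + ln (g t)/2 \<le> ln (g1 t)" using mono[of t] by (simp add: F_def)
      then show ?case using N[OF elim] g1_pos[of t] by (simp add: ln_ge_iff)
    qed
  qed
qed

text \<open>The quotient of the derivatives is \<open>eps\<close>. This makes the factor
  \<open>g'\<close> in \<open>f' = g' * exp g\<close> negligible on the logarithmic scale.\<close>

lemma ln_g1_over_g: "((\<lambda>t. ln (g1 t) / g t) \<longlongrightarrow> 0) at_top"
proof (rule lhospital_at_top_at_top[where f' = "\<lambda>t. g2 t / g1 t" and g' = g1])
  show "((\<lambda>t. g2 t / g1 t / g1 t) \<longlongrightarrow> 0) at_top"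
    using eps_lim by (simp add: eps_def[abs_def] power2_eq_square)
  show "\<forall>\<^sub>F x in at_top. ((\<lambda>t. ln (g1 t)) has_real_derivative g2 x / g1 x) (at x)"
    using eventually_gt_at_top[of t0]
    by eventually_elim (use g1_pos in \<open>auto intro!: derivative_eq_intros g1_deriv\<close>)
qed (auto intro!: filterlim_g eventually_mono[OF eventually_gt_at_top[of t0]] g_deriv dest: g1_pos)

text \<open>\<open>E\<close> is the limit of \<open>g(t - z * y t) / g(t)\<close>: it equals \<open>(1 - z / p)\<^sup>p\<close> with \<open>p = 1 / kap\<close>, or \<open>exp (- z)\<close> if \<open>kap = 0\<close>.\<close>

definition LE :: "real \<Rightarrow> real" where
  "LE z = (if kap = 0 then - z else ln (1 - kap * z) / kap)"
definition E :: "real \<Rightarrow> real" where "E z = exp (LE z)"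
text \<open>Minus the derivative of \<open>E\<close>, and also the limit of
  \<open>g1 (t - z * y t) / g1 t\<close>: since \<open>g1 = g / y\<close>, the limiting ratio of
  \<open>g\<close> is divided by that of \<open>y\<close>, which is
  \<open>1 - kap * z\<close>.\<close>

definition E1 :: "real \<Rightarrow> real" where "E1 z = E z / (1 - kap * z)"

lemma LE_0 [simp]: "LE 0 = 0" and E_0 [simp]: "E 0 = 1" and E1_0 [simp]: "E1 0 = 1"
  by (auto simp: LE_def E_def E1_def)

lemma E_pos [simp]: "E z > 0" by (simp add: E_def)
lemma E1_pos: "kap * z < 1 \<Longrightarrow> E1 z > 0" by (simp add: E1_def)

lemma LE_deriv: "kap * z < 1 \<Longrightarrow> (LE has_real_derivative - 1 / (1 - kap * z)) (at z)"
  unfolding LE_def[abs_def]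
  by (cases "kap = 0") (auto intro!: derivative_eq_intros simp: field_simps)

lemma E_deriv: "kap * z < 1 \<Longrightarrow> (E has_real_derivative - E1 z) (at z)"
  unfolding E_def[abs_def] E1_def
  by (auto intro!: derivative_eq_intros LE_deriv simp: E_def)

lemma E1_deriv:
  assumes "kap * z < 1"
  shows "(E1 has_real_derivative - (1 - kap) * E z / (1 - kap * z)\<^sup>2) (at z)"
proof -
  have nz: "1 - kap * z \<noteq> 0" using assms by simp
  have "((\<lambda>z. E z / (1 - kap * z)) has_real_derivative
      (- E1 z * (1 - kap * z) - E z * (0 - kap * 1)) / ((1 - kap * z) * (1 - kap * z))) (at z)"
    by (intro DERIV_divide E_deriv[OF assms] nz) (auto intro!: derivative_eq_intros)
  also have "- E1 z * (1 - kap * z) = - E z" using nz by (simp add: E1_def)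
  finally show ?thesis unfolding E1_def[abs_def] by (simp add: power2_eq_square algebra_simps)
qed

lemma kap_mult_less: "z \<le> z' \<Longrightarrow> kap * z' < 1 \<Longrightarrow> kap * z < 1"
  using kap_nonneg by (smt (verit) mult_left_mono)

lemma E1_strict_antimono:
  assumes "z < z'" "kap * z' < 1"
  shows "E1 z' < E1 z"
proof -
  have "- E1 z < - E1 z'"
  proof (rule DERIV_pos_imp_increasing[OF assms(1)])
    fix x assume x: "z \<le> x" "x \<le> z'"
    then have "kap * x < 1" using kap_mult_less assms by blast
    then have "((\<lambda>x. - E1 x) has_real_derivative (1 - kap) * E x / (1 - kap * x)\<^sup>2) (at x)"
      using DERIV_minus[OF E1_deriv[of x]] by (simp only: mult_minus_left minus_divide_left[symmetric] minus_minus)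
    then show "\<exists>y. ((\<lambda>x. - E1 x) has_real_derivative y) (at x) \<and> 0 < y"
      using \<open>kap * x < 1\<close> kap_less_half
      by (intro exI conjI) (auto intro!: divide_pos_pos mult_pos_pos)
  qed
  then show ?thesis by simp
qed

lemma E1_antimono: "z \<le> z' \<Longrightarrow> kap * z' < 1 \<Longrightarrow> E1 z' \<le> E1 z"
  using E1_strict_antimono[of z z'] by (cases "z = z'") auto

text \<open>On the whole window \<open>y'\<close> is close to \<open>kap\<close>, so the mean value
  theorem gives the ratio of \<open>y\<close>. In the variable \<open>z\<close>, \<open>ln g\<close>
  has derivative minus the reciprocal of that ratio, to be compared with
  \<open>LE' = - 1 / (1 - kap * z)\<close>. Uniformity in \<open>z\<close> is needed because depths
  will vary with the sequence index.\<close>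

lemma ratio_uniform:
  assumes Z: "0 \<le> Z" "kap * Z < 1" and "e > 0"
  shows "\<forall>\<^sub>F t in at_top. \<forall>z\<in>{0..Z}. \<bar>ln (g (t - z * y t) / g t) - LE z\<bar> \<le> e
           \<and> \<bar>y (t - z * y t) / y t - (1 - kap * z)\<bar> \<le> e"
proof -
  define m where "m = 1 - kap * Z"
  have m: "m > 0" using Z by (simp add: m_def)
  \<comment> \<open>The three bounds on the error in \<open>y'\<close> keep the error in the ratio
    of \<open>y\<close> below \<open>e\<close>, keep that ratio above \<open>m / 2\<close>, and
    absorb the division by \<open>m / 2 * m\<close> when the logarithms are compared.\<close>
  define \<eta> where "\<eta> = Min {e / (Z+1), m / (2*(Z+1)), e * m\<^sup>2 / (2 * (Z+1)\<^sup>2)}"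
  have \<eta>: "\<eta> > 0" using m Z \<open>e > 0\<close> by (auto simp: \<eta>_def)
  have "\<eta> \<le> e / (Z+1)" "\<eta> \<le> m / (2*(Z+1))" "\<eta> \<le> e * m\<^sup>2 / (2 * (Z+1)\<^sup>2)" by (auto simp: \<eta>_def)
  then have \<eta>2: "\<eta> * (Z+1) \<le> e" "\<eta> * (Z+1) \<le> m/2" "\<eta> * (Z+1)\<^sup>2 \<le> e * m\<^sup>2/2"
    using Z by (auto simp: field_simps)
  have "filterlim (\<lambda>t. (1 - Z * (y t / t)) * t) at_top at_top"
  proof (rule filterlim_tendsto_pos_mult_at_top[OF _ _ filterlim_ident])
    show "((\<lambda>t. 1 - Z * (y t / t)) \<longlongrightarrow> 1 - Z * kap) at_top" by (intro tendsto_intros y_over_t)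
  qed (use Z in \<open>auto simp: mult.commute\<close>)
  moreover have "\<forall>\<^sub>F t in at_top. (1 - Z * (y t / t)) * t = t - Z * y t"
    using eventually_gt_at_top[of 0] by eventually_elim (simp add: algebra_simps)
  ultimately have lim: "filterlim (\<lambda>t. t - Z * y t) at_top at_top"
    by (rule filterlim_cong[OF refl refl, THEN iffD1, rotated])
  have "\<forall>\<^sub>F x in at_top. \<bar>1 - g x * eps x - kap\<bar> < \<eta>"
    using tendstoD[OF dy_lim \<eta>] by (simp add: dist_real_def)
  then have "\<forall>\<^sub>F x in at_top. \<bar>1 - g x * eps x - kap\<bar> < \<eta> \<and> x > t0 \<and> g x > 0"
    using ev_g_gt[of 0] eventually_gt_at_top[of t0] by eventually_elim auto
  from eventually_at_top_ge[OF this lim]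
  have "\<forall>\<^sub>F t in at_top. \<forall>x\<ge>t - Z * y t. \<bar>1 - g x * eps x - kap\<bar> < \<eta> \<and> x > t0 \<and> g x > 0" .
  moreover have "\<forall>\<^sub>F t in at_top. t > t0 \<and> g t > 0"
    using ev_g_gt[of 0] eventually_gt_at_top[of t0] by eventually_elim auto
  ultimately show ?thesis
  proof eventually_elim
    case (elim t)
    have yt: "y t > 0" using elim g1_pos[of t] by (auto simp: y_def)
    have dom: "t - z * y t \<ge> t - Z * y t" if "z \<le> Z" for z using that yt by simp
    have A: "\<bar>y (t - z * y t) / y t - (1 - kap * z)\<bar> \<le> z * \<eta>" if z: "0 \<le> z" "z \<le> Z" for z
    proof (cases "z = 0")
      case False
      then have "t - z * y t < t" using z yt by simp
      then obtain \<xi> where \<xi>: "t - z * y t < \<xi>" "\<xi> < t"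
         "y t - y (t - z * y t) = (t - (t - z * y t)) * (1 - g \<xi> * eps \<xi>)"
        using MVT2[of "t - z * y t" t y "\<lambda>x. 1 - g x * eps x"] y_deriv dom[OF z(2)] elim(1) by fastforce
      then have "y (t - z * y t) / y t - (1 - kap * z) = - z * (1 - g \<xi> * eps \<xi> - kap)"
        using yt by (simp add: field_simps)
      moreover have "\<bar>1 - g \<xi> * eps \<xi> - kap\<bar> < \<eta>" using elim(1) dom[OF z(2)] \<xi>(1) by simp
      ultimately show ?thesis using z by (auto simp: abs_mult intro!: mult_left_mono)
    qed (use yt in auto)
    have A': "\<bar>y (t - z * y t) / y t - (1 - kap * z)\<bar> \<le> e \<and> y (t - z * y t) / y t \<ge> m/2 \<and> 1 - kap * z \<ge> m"
      if z: "0 \<le> z" "z \<le> Z" for z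
    proof -
      have "z * \<eta> \<le> \<eta> * (Z+1)" using z \<eta> by (simp add: mult.commute)
      moreover have "1 - kap * z \<ge> m" unfolding m_def using z kap_nonneg by (simp add: mult_left_mono)
      ultimately show ?thesis using A[OF z] \<eta>2 by auto
    qed
    have B: "\<bar>ln (g (t - z * y t) / g t) - LE z\<bar> \<le> e" if z: "0 \<le> z" "z \<le> Z" for z
    proof (cases "z = 0")
      case False
      then have "0 < z" using z by simp
      define D where "D s = ln (g (t - s * y t) / g t) - LE s" for s
      define D' where "D' s = 1 / (1 - kap * s) - 1 / (y (t - s * y t) / y t)" for s
      have "(D has_real_derivative D' s) (at s)" if s: "0 \<le> s" "s \<le> z" for s
      proof -
        have s': "s \<le> Z" using s z by simp
        have gp: "g (t - s * y t) > 0" "t - s * y t > t0" using elim(1) dom[OF s'] by auto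
        have "kap * s < 1" using kap_mult_less[OF s' Z(2)] .
        have "((\<lambda>s. g (t - s * y t)) has_real_derivative g1 (t - s * y t) * (0 - 1 * y t)) (at s)"
          by (rule DERIV_chain2[where f = g and g = "\<lambda>s. t - s * y t", OF g_deriv[OF gp(2)]]) (auto intro!: derivative_eq_intros)
        then have "((\<lambda>s. ln (g (t - s * y t) / g t)) has_real_derivative
            (g1 (t - s * y t) * (0 - y t) / g t) / (g (t - s * y t) / g t)) (at s)"
          using gp elim(2) by (auto intro!: derivative_eq_intros)
        then have "(D has_real_derivative (g1 (t - s * y t) * (0 - y t) / g t) / (g (t - s * y t) / g t) - (- 1 / (1 - kap * s))) (at s)"
          unfolding D_def[abs_def] by (intro DERIV_diff LE_deriv \<open>kap * s < 1\<close>)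
        also have "(g1 (t - s * y t) * (0 - y t) / g t) / (g (t - s * y t) / g t) - (- 1 / (1 - kap * s)) = D' s"
          using gp elim(2) yt g1_pos[OF gp(2)] unfolding D'_def y_def[of "t - s * y t"] by (simp add: field_simps)
        finally show ?thesis .
      qed
      then obtain \<xi> where \<xi>: "0 < \<xi>" "\<xi> < z" "D z - D 0 = (z - 0) * D' \<xi>"
        using MVT2[OF \<open>0 < z\<close>, of D D'] by auto
      have D0: "D 0 = 0" using elim(2) by (simp add: D_def)
      have x: "0 \<le> \<xi>" "\<xi> \<le> Z" using \<xi> z by auto
      let ?r = "y (t - \<xi> * y t) / y t" and ?k = "1 - kap * \<xi>"
      have r: "?r \<ge> m/2" "?k \<ge> m" "\<bar>?r - ?k\<bar> \<le> \<xi> * \<eta>" using A'[OF x] A[OF x] by auto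
      have "\<xi> * \<eta> \<le> (Z+1) * \<eta>" using x \<eta> by auto
      then have r3: "\<bar>?r - ?k\<bar> \<le> (Z+1) * \<eta>" using r by linarith
      have nz: "?r \<noteq> 0" "?k \<noteq> 0" using r m by linarith+
      have gen: "x / (r * k) \<le> c / (m/2 * m)" if "x \<le> c" "m/2 \<le> r" "m \<le> k" "0 \<le> c" for x r k c :: real
        using that m by (intro frac_le mult_mono mult_pos_pos) auto
      have rk: "?r * ?k > 0" using r m by (intro mult_pos_pos) linarith+
      have aux: "1 / b - 1 / a = (a - b) / (a * b)" if "a \<noteq> 0" "b \<noteq> 0" for a b :: real
        using that by (simp add: field_simps)
      have "D' \<xi> = (?r - ?k) / (?r * ?k)" unfolding D'_def using aux[OF nz] .
      then have "\<bar>D' \<xi>\<bar> = \<bar>?r - ?k\<bar> / (?r * ?k)" using rk by (simp only: abs_divide abs_of_pos)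
      also have "\<dots> \<le> ((Z+1) * \<eta>) / (m/2 * m)"
        by (rule gen[OF r3 r(1,2)]) (use \<eta> Z in auto)
      finally have d: "\<bar>D' \<xi>\<bar> \<le> 2 * (Z+1) * \<eta> / m\<^sup>2" using m by (simp add: field_simps power2_eq_square)
      have "\<bar>D z\<bar> = z * \<bar>D' \<xi>\<bar>" using \<xi> D0 by (simp add: abs_mult)
      also have "\<dots> \<le> (Z+1) * (2 * (Z+1) * \<eta> / m\<^sup>2)"
        by (intro mult_mono d) (use z \<eta> m in auto)
      also have "\<dots> = 2 * (\<eta> * (Z+1)\<^sup>2) / m\<^sup>2" by (simp add: power2_eq_square)
      also have "\<dots> \<le> 2 * (e * m\<^sup>2/2) / m\<^sup>2" by (intro divide_right_mono mult_left_mono \<eta>2) auto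
      also have "\<dots> = e" using m by simp
      finally show ?thesis unfolding D_def .
    qed (use elim(2) \<open>e > 0\<close> in auto)
    show ?case using A' B by auto
  qed
qed

text \<open>The height is \<open>m * (1 - z * y m / m)\<close>, and the second factor tends to
  \<open>1 - kap * z0 > 0\<close>.\<close>

lemma level_at_top:
  assumes m: "filterlim m at_top F" and z: "(z \<longlongrightarrow> z0) F" and z0: "kap * z0 < 1"
  shows "filterlim (\<lambda>n. m n - z n * y (m n)) at_top F"
proof -
  have "filterlim (\<lambda>n. (1 - z n * (y (m n) / m n)) * m n) at_top F"
  proof (rule filterlim_tendsto_pos_mult_at_top[OF _ _ m])
    show "((\<lambda>n. 1 - z n * (y (m n) / m n)) \<longlongrightarrow> 1 - z0 * kap) F"
      by (intro tendsto_intros z filterlim_compose[OF y_over_t m])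
  qed (use z0 in \<open>auto simp: mult.commute\<close>)
  moreover have "\<forall>\<^sub>F n in F. m n > 0" using m by (auto simp: filterlim_at_top_dense)
  then have "\<forall>\<^sub>F n in F. (1 - z n * (y (m n) / m n)) * m n = m n - z n * y (m n)"
    by eventually_elim (simp add: algebra_simps)
  ultimately show ?thesis by (rule filterlim_cong[OF refl refl, THEN iffD1, rotated])
qed

text \<open>Admissible depths form an open half-line, bounded by \<open>1 / kap\<close> if
  \<open>kap > 0\<close>. The slack is used when an estimate at one depth relies on a slightly
  deeper one.\<close>

lemma kap_room:
  assumes "kap * z < 1" obtains Z where "z < Z" "kap * Z < 1"
proof (cases "kap = 0")
  case False
  then have k: "kap > 0" using kap_nonneg by simp
  show ?thesis
    by (rule that[of "(z + 1/kap)/2"]) (use assms k in \<open>auto simp: field_simps\<close>)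
qed (use that[of "z+1"] in auto)

lemma ratio_tendsto:
  assumes m: "filterlim m at_top F" and z: "(z \<longlongrightarrow> z0) F" and z0: "kap * z0 < 1"
    and nn: "\<forall>\<^sub>F n in F. 0 \<le> z n"
  shows "((\<lambda>n. g (m n - z n * y (m n)) / g (m n)) \<longlongrightarrow> E z0) F" (is ?A)
    and "((\<lambda>n. g1 (m n - z n * y (m n)) / g1 (m n)) \<longlongrightarrow> E1 z0) F" (is ?B)
proof -
  obtain Z0 where Z0: "z0 < Z0" "kap * Z0 < 1" using kap_room[OF z0] .
  define Z where "Z = max Z0 0"
  have Z: "0 \<le> Z" "kap * Z < 1" "z0 < Z" using Z0 by (auto simp: Z_def max_def)
  have zev: "\<forall>\<^sub>F n in F. z n \<in> {0..Z}"
    using nn order_tendstoD(2)[OF z Z(3)] by eventually_elim auto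
  define xx where "xx n = m n - z n * y (m n)" for n
  have ev: "\<forall>\<^sub>F n in F. \<bar>ln (g (xx n) / g (m n)) - LE (z n)\<bar> \<le> e
           \<and> \<bar>y (xx n) / y (m n) - (1 - kap * z n)\<bar> \<le> e" if "e > 0" for e
  proof -
    have "\<forall>\<^sub>F n in F. \<forall>z\<in>{0..Z}. \<bar>ln (g (m n - z * y (m n)) / g (m n)) - LE z\<bar> \<le> e
           \<and> \<bar>y (m n - z * y (m n)) / y (m n) - (1 - kap * z)\<bar> \<le> e"
      using eventually_compose_filterlim[OF ratio_uniform[OF Z(1,2) that] m] .
    with zev show ?thesis by eventually_elim (auto simp: xx_def)
  qed
  have z1: "((\<lambda>n. ln (g (xx n) / g (m n)) - LE (z n)) \<longlongrightarrow> 0) F"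
  proof (rule tendstoI)
    fix e :: real assume "e > 0"
    with ev[of "e/2"] show "\<forall>\<^sub>F n in F. dist (ln (g (xx n) / g (m n)) - LE (z n)) 0 < e"
      by (auto simp: dist_real_def elim!: eventually_mono)
  qed
  have z2: "((\<lambda>n. y (xx n) / y (m n) - (1 - kap * z n)) \<longlongrightarrow> 0) F"
  proof (rule tendstoI)
    fix e :: real assume "e > 0"
    with ev[of "e/2"] show "\<forall>\<^sub>F n in F. dist (y (xx n) / y (m n) - (1 - kap * z n)) 0 < e"
      by (auto simp: dist_real_def elim!: eventually_mono)
  qed
  have "isCont LE z0" using LE_deriv[OF z0] by (rule DERIV_isCont)
  then have "((\<lambda>n. LE (z n)) \<longlongrightarrow> LE z0) F" using z by (rule isCont_tendsto_compose)
  from tendsto_add[OF z1 this] have "((\<lambda>n. exp (ln (g (xx n) / g (m n)))) \<longlongrightarrow> E z0) F"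
    unfolding E_def by (intro tendsto_exp) simp
  moreover have gpos: "\<forall>\<^sub>F n in F. g (xx n) > 0 \<and> g (m n) > 0"
    using eventually_compose_filterlim[OF ev_g_gt[of 0] m]
      eventually_compose_filterlim[OF ev_g_gt[of 0] level_at_top[OF m z z0]] unfolding xx_def
    by eventually_elim auto
  then have "\<forall>\<^sub>F n in F. exp (ln (g (xx n) / g (m n))) = g (xx n) / g (m n)"
    by eventually_elim simp
  ultimately have gl: "((\<lambda>n. g (xx n) / g (m n)) \<longlongrightarrow> E z0) F" by (simp add: tendsto_cong)
  then show ?A by (simp add: xx_def)
  have "((\<lambda>n. 1 - kap * z n) \<longlongrightarrow> 1 - kap * z0) F" by (intro tendsto_intros z)
  from tendsto_add[OF z2 this] have "((\<lambda>n. y (xx n) / y (m n)) \<longlongrightarrow> 1 - kap * z0) F" by simp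
  from tendsto_divide[OF gl this]
  have "((\<lambda>n. (g (xx n) / g (m n)) / (y (xx n) / y (m n))) \<longlongrightarrow> E1 z0) F" unfolding E1_def using z0 by simp
  moreover have "\<forall>\<^sub>F n in F. (g (xx n) / g (m n)) / (y (xx n) / y (m n)) = g1 (xx n) / g1 (m n)"
    using gpos eventually_compose_filterlim[OF eventually_gt_at_top[of t0] m]
      eventually_compose_filterlim[OF eventually_gt_at_top[of t0] level_at_top[OF m z z0]]
    unfolding xx_def[symmetric]
  proof eventually_elim
    case (elim n)
    then show ?case using g1_pos[of "xx n"] g1_pos[of "m n"] by (simp add: y_def field_simps)
  qed
  ultimately show ?B unfolding xx_def by (simp add: tendsto_cong)
qed

text \<open>For \<open>kap > 0\<close> put \<open>d = 1 - kap * Z\<close>. Then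
  \<open>E1 Z = d powr (1 / kap - 1)\<close>, and \<open>1 / kap \<ge> 2\<close> makes this at most
  \<open>d\<close>.\<close>

lemma E1_small:
  assumes "e > 0" "kap * Z0 < 1" obtains Z where "Z \<ge> Z0" "kap * Z < 1" "E1 Z < e"
proof (cases "kap = 0")
  case True
  show ?thesis
  proof (rule that[of "max Z0 (1 - ln e)"])
    have "exp (- max Z0 (1 - ln e)) \<le> exp (ln e - 1)" by (simp add: max_def)
    also have "\<dots> < exp (ln e)" by simp
    finally show "E1 (max Z0 (1 - ln e)) < e" using assms True by (simp add: E1_def E_def LE_def)
  qed (use True in auto)
next
  case False
  then have k: "kap > 0" using kap_nonneg by simp
  define d where "d = min (1 - kap * Z0) (min (e/2) (1/2))"
  have d: "d > 0" "d \<le> 1 - kap * Z0" "d < e" "d < 1" using assms by (auto simp: d_def min_def)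
  define Z where "Z = (1 - d) / kap"
  have Z: "1 - kap * Z = d" using k by (simp add: Z_def)
  show ?thesis
  proof (rule that[of Z])
    show "Z \<ge> Z0" using d k by (simp add: Z_def field_simps)
    have "ln d < 0" using d by simp
    have "1 / kap \<ge> 2" using k kap_less_half by (simp add: field_simps)
    then have "ln d * (1 / kap) \<le> ln d * 2" using \<open>ln d < 0\<close> by (intro mult_left_mono_neg) auto
    then have "ln d / kap \<le> 2 * ln d" by (simp add: mult.commute)
    moreover have "E Z = exp (ln d / kap)" unfolding E_def LE_def Z using k by simp
    ultimately have "E Z \<le> exp (2 * ln d)" by (simp only: exp_le_cancel_iff)
    also have "\<dots> = d * d" by (simp only: mult_2 exp_add exp_ln[OF d(1)])
    finally have "E1 Z \<le> d" unfolding E1_def Z using d by (simp add: field_simps)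
    then show "E1 Z < e" using d by simp
    show "kap * Z < 1" using Z d by linarith
  qed
qed

end

section \<open>Profiles in the logarithmic radius\<close>

lemma DERIV_nonnegI:
  "(F has_real_derivative D) (at x) \<Longrightarrow> 0 \<le> D \<Longrightarrow> \<exists>y. (F has_real_derivative y) (at x) \<and> 0 \<le> y"
  by blast

lemma DERIV_posI:
  "(F has_real_derivative D) (at x) \<Longrightarrow> 0 < D \<Longrightarrow> \<exists>y. (F has_real_derivative y) (at x) \<and> 0 < y"
  by blast

text \<open>\<open>hh t\<close> stands for \<open>h (exp (- t))\<close> and \<open>H\<close> for its logarithmic derivative.\<close>

locale profiles = nonlinearity +
  fixes ff hh H :: "real \<Rightarrow> real" and Hb hlo hhi :: real
    and lam mu :: "nat \<Rightarrow> real" and w v :: "nat \<Rightarrow> real \<Rightarrow> real"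
  assumes Hb_nonneg: "0 \<le> Hb" and hlo_pos: "0 < hlo"
    and lam_pos: "0 < lam n"
    and w_deriv: "0 < t \<Longrightarrow> (w n has_real_derivative v n t) (at t)"
    and v_deriv: "0 < t \<Longrightarrow> (v n has_real_derivative - (lam n * exp (- 2 * t) * hh t * ff (w n t))) (at t)"
    and ff_nonneg: "0 < t \<Longrightarrow> 0 \<le> ff (w n t)"
    and ff_eq: "t0 < x \<Longrightarrow> ff x = exp (g x)"
    and hh_deriv: "0 < t \<Longrightarrow> (hh has_real_derivative hh t * H t) (at t)"
    and H_bound: "0 < t \<Longrightarrow> \<bar>H t\<bar> \<le> Hb * exp (- t)"
    and hh_bounds: "0 < t \<Longrightarrow> hlo \<le> hh t" "0 < t \<Longrightarrow> hh t \<le> hhi"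
    and w_lim: "(w n \<longlongrightarrow> mu n) at_top" and v_lim: "(v n \<longlongrightarrow> 0) at_top"
    and w_zero: "(w n \<longlongrightarrow> 0) (at_right 0)"
    and mu_lim: "filterlim mu at_top sequentially"
begin

definition P :: "nat \<Rightarrow> real \<Rightarrow> real" where "P n t = g1 (w n t) * v n t"
definition Y :: "nat \<Rightarrow> real \<Rightarrow> real" where
  "Y n t = g1 (w n t) * (lam n * exp (- 2 * t) * hh t * exp (g (w n t)))"
definition Q :: "nat \<Rightarrow> real \<Rightarrow> real" where "Q n t = (P n t - 2)\<^sup>2 / 2 + Y n t"
text \<open>\<open>P0\<close> will bound \<open>P\<close> at all heights above \<open>t0\<close>: it
  is twice the constant \<open>2 + Hb\<close>, which is admissible in \<open>pohozaev\<close> at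
  every time. \<open>CH\<close> bounds the oscillation of \<open>ln hh\<close>.\<close>

definition P0 :: real where "P0 = 4 + 2 * Hb"
definition CH :: real where "CH = ln hhi - ln hlo"

lemma P0_ge: "4 \<le> P0" using Hb_nonneg by (simp add: P0_def)

lemma hh_pos: "0 < t \<Longrightarrow> 0 < hh t"
  using hh_bounds(1)[of t] hlo_pos by linarith

lemma ln_hh_diff: "0 < s \<Longrightarrow> 0 < t \<Longrightarrow> \<bar>ln (hh s) - ln (hh t)\<bar> \<le> CH"
  using hh_bounds[of s] hh_bounds[of t] hlo_pos unfolding CH_def
  by (smt (verit, best) ln_le_cancel_iff)

section \<open>Concavity of the profiles and the system for \<open>P\<close> and
  \<open>Y\<close>\<close>

lemma v_antimono: assumes "0 < a" "a \<le> b" shows "v n b \<le> v n a"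
proof -
  have "- v n a \<le> - v n b"
  proof (rule DERIV_nonneg_imp_nondecreasing[where f = "\<lambda>t. - v n t", OF assms(2)])
    fix x assume "a \<le> x" "x \<le> b"
    then have x: "0 < x" using assms by simp
    show "\<exists>y. ((\<lambda>x. - v n x) has_real_derivative y) (at x) \<and> 0 \<le> y"
      by (rule DERIV_nonnegI[OF DERIV_minus[OF v_deriv[OF x, of n]]])
        (use lam_pos[of n] hh_pos[OF x] ff_nonneg[OF x, of n] in auto)
  qed
  then show ?thesis by simp
qed

lemma v_nonneg: assumes "0 < t" shows "0 \<le> v n t"
proof (rule tendsto_upperbound[OF v_lim])
  show "\<forall>\<^sub>F x in at_top. v n x \<le> v n t"
    using eventually_ge_at_top[of t] by eventually_elim (use assms v_antimono in auto)
qed simp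

lemma w_diff:
  assumes "0 < a" "a \<le> b"
  shows "v n b * (b - a) \<le> w n b - w n a" "w n b - w n a \<le> v n a * (b - a)"
proof -
  have "v n b * (b - a) \<le> w n b - w n a \<and> w n b - w n a \<le> v n a * (b - a)"
  proof (cases "a = b")
    case False
    then obtain x where x: "a < x" "x < b" "w n b - w n a = (b - a) * v n x"
      using MVT2[of a b "w n" "v n"] w_deriv assms by (metis less_eq_real_def order_less_le_trans)
    have "v n b \<le> v n x" "v n x \<le> v n a" using v_antimono assms x by auto
    then show ?thesis unfolding x(3) using assms by (simp add: mult.commute mult_left_mono)
  qed auto
  then show "v n b * (b - a) \<le> w n b - w n a" "w n b - w n a \<le> v n a * (b - a)" by auto
qed

lemma w_mono: "0 < a \<Longrightarrow> a \<le> b \<Longrightarrow> w n a \<le> w n b"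
  using w_diff(1)[of a b n] v_nonneg[of b n] by (smt (verit) mult_nonneg_nonneg)

lemma w_le_mu: assumes "0 < t" shows "w n t \<le> mu n"
proof (rule tendsto_lowerbound[OF w_lim])
  show "\<forall>\<^sub>F x in at_top. w n t \<le> w n x"
    using eventually_ge_at_top[of t] by eventually_elim (use assms w_mono in auto)
qed simp

lemma region_up: "0 < a \<Longrightarrow> a \<le> b \<Longrightarrow> t0 < w n a \<Longrightarrow> t0 < w n b"
  using w_mono[of a b n] by simp

lemma v_pos: assumes "0 < t" "t0 < w n t" shows "0 < v n t"
proof -
  have "- v n t < - v n (t+1)"
  proof (rule DERIV_pos_imp_increasing[where f = "\<lambda>t. - v n t"])
    fix x assume "t \<le> x" "x \<le> t+1"
    then have x: "0 < x" "t0 < w n x" using assms region_up[of t x n] by auto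
    show "\<exists>y. ((\<lambda>x. - v n x) has_real_derivative y) (at x) \<and> 0 < y"
      by (rule DERIV_posI[OF DERIV_minus[OF v_deriv[OF x(1), of n]]])
        (use lam_pos[of n] hh_pos[OF x(1)] ff_eq[OF x(2)] in auto)
  qed simp
  then show ?thesis using v_nonneg[of "t+1" n] assms by simp
qed

lemma w_less_imp: "0 < a \<Longrightarrow> 0 < b \<Longrightarrow> w n a < w n b \<Longrightarrow> a < b"
  using w_mono[of b a n] by (meson leI not_less)

lemma P_pos: "0 < t \<Longrightarrow> t0 < w n t \<Longrightarrow> 0 < P n t"
  unfolding P_def using v_pos g1_pos by simp

lemma Y_pos: "0 < t \<Longrightarrow> t0 < w n t \<Longrightarrow> 0 < Y n t"
  unfolding Y_def using hh_pos g1_pos lam_pos by simp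

lemma g1w_deriv:
  assumes "0 < t" "t0 < w n t"
  shows "((\<lambda>t. g1 (w n t)) has_real_derivative g1 (w n t) * (eps (w n t) * P n t)) (at t)"
proof -
  have "((\<lambda>t. g1 (w n t)) has_real_derivative g2 (w n t) * v n t) (at t)"
    by (rule DERIV_chain2[where f = g1, OF g1_deriv w_deriv]) (use assms in auto)
  then show ?thesis using g1_pos[OF assms(2)] by (simp add: eps_def P_def power2_eq_square field_simps)
qed

lemma v_deriv': "0 < t \<Longrightarrow> t0 < w n t \<Longrightarrow> (v n has_real_derivative - (Y n t / g1 (w n t))) (at t)"
  using v_deriv[of t n] ff_eq[of "w n t"] g1_pos[of "w n t"] by (simp add: Y_def)

lemma P_deriv:
  assumes "0 < t" "t0 < w n t"
  shows "(P n has_real_derivative eps (w n t) * (P n t)\<^sup>2 - Y n t) (at t)"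
proof -
  have "((\<lambda>t. g1 (w n t) * v n t) has_real_derivative
     g1 (w n t) * (eps (w n t) * P n t) * v n t + (- (Y n t / g1 (w n t))) * g1 (w n t)) (at t)"
    by (intro DERIV_mult g1w_deriv v_deriv' assms)
  then show ?thesis unfolding P_def[abs_def]
    using g1_pos[OF assms(2)] by (simp add: power2_eq_square algebra_simps)
qed

lemma ln_g1w_deriv:
  assumes "0 < t" "t0 < w n t"
  shows "((\<lambda>t. ln (g1 (w n t))) has_real_derivative eps (w n t) * P n t) (at t)"
  using DERIV_chain2[where f = ln, OF DERIV_ln_divide g1w_deriv[OF assms]] g1_pos[OF assms(2)] by simp

lemma Y_deriv:
  assumes "0 < t" "t0 < w n t"
  shows "(Y n has_real_derivative Y n t * (P n t - 2 + (eps (w n t) * P n t + H t))) (at t)"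
proof -
  have g: "((\<lambda>t. g (w n t)) has_real_derivative P n t) (at t)"
    unfolding P_def by (rule DERIV_chain2[where f = g, OF g_deriv w_deriv]) (use assms in auto)
  have e: "((\<lambda>t. exp (- 2 * t)) has_real_derivative exp (- 2 * t) * (- 2)) (at t)"
    by (auto intro!: derivative_eq_intros)
  have "((\<lambda>t. g1 (w n t) * (lam n * exp (- 2 * t) * hh t * exp (g (w n t)))) has_real_derivative
     (g1 (w n t) * (eps (w n t) * P n t)) * (lam n * exp (- 2 * t) * hh t * exp (g (w n t)))
       + ((lam n * (exp (- 2 * t) * (- 2)) * hh t + hh t * H t * (lam n * exp (- 2 * t))) * exp (g (w n t))
         + exp (g (w n t)) * P n t * (lam n * exp (- 2 * t) * hh t)) * g1 (w n t)) (at t)"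
    by (intro DERIV_mult g1w_deriv DERIV_cmult e hh_deriv DERIV_chain2[where f = exp, OF DERIV_exp g] assms)
  then show ?thesis unfolding Y_def[abs_def] by (simp add: algebra_simps)
qed

lemma isCont_w: "0 < t \<Longrightarrow> isCont (w n) t" using w_deriv DERIV_isCont by blast
lemma isCont_P: "0 < t \<Longrightarrow> t0 < w n t \<Longrightarrow> isCont (P n) t" using P_deriv DERIV_isCont by blast
lemma continuous_on_P: "0 < a \<Longrightarrow> t0 < w n a \<Longrightarrow> continuous_on {a..b} (P n)"
  using isCont_P region_up by (intro continuous_at_imp_continuous_on) fastforce

lemma g1w_lim: "t0 < mu n \<Longrightarrow> ((\<lambda>t. g1 (w n t)) \<longlongrightarrow> g1 (mu n)) at_top"
  using w_lim by (rule isCont_tendsto_compose[rotated]) (use g1_deriv DERIV_isCont in blast)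

lemma P_lim: assumes "t0 < mu n" shows "(P n \<longlongrightarrow> 0) at_top"
  unfolding P_def[abs_def] using tendsto_mult[OF g1w_lim[OF assms] v_lim] by simp

lemma Y_lim: assumes "t0 < mu n" shows "(Y n \<longlongrightarrow> 0) at_top"
proof -
  have "((\<lambda>t::real. exp (- 2 * t)) \<longlongrightarrow> 0) at_top"
    by (rule filterlim_compose[OF exp_at_bot]) (auto simp: filterlim_uminus_at_bot intro!: filterlim_tendsto_pos_mult_at_top[OF tendsto_const] filterlim_ident)
  from tendsto_mult_right_zero[OF this, of hhi] have "((\<lambda>t. hhi * exp (- 2 * t)) \<longlongrightarrow> 0) at_top" .
  then have 1: "((\<lambda>t. exp (- 2 * t) * hh t) \<longlongrightarrow> 0) at_top"
  proof (rule Lim_null_comparison[rotated])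
    show "\<forall>\<^sub>F t in at_top. norm (exp (- 2 * t) * hh t) \<le> hhi * exp (- 2 * t)"
      using eventually_gt_at_top[of 0] by eventually_elim (use hh_bounds(2) hh_pos in \<open>auto simp: abs_mult abs_of_pos\<close>)
  qed
  have 2: "((\<lambda>t. g (w n t)) \<longlongrightarrow> g (mu n)) at_top"
    using w_lim by (rule isCont_tendsto_compose[rotated]) (use g_deriv assms DERIV_isCont in blast)
  have "((\<lambda>t. g1 (w n t) * (lam n * (exp (- 2 * t) * hh t) * exp (g (w n t)))) \<longlongrightarrow>
      g1 (mu n) * (lam n * 0 * exp (g (mu n)))) at_top"
    by (intro tendsto_mult g1w_lim assms 1 tendsto_const tendsto_exp 2)
  then show ?thesis unfolding Y_def[abs_def] by (simp add: algebra_simps)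
qed

lemma mu_gt: "0 < t \<Longrightarrow> t0 < w n t \<Longrightarrow> t0 < mu n"
  using w_le_mu[of t n] by simp

text \<open>For \<open>B = P\<^sup>2 / 2 + Y - c * P\<close> the quotient \<open>B / g'(w)\<close> is nondecreasing and vanishes at infinity.\<close>

lemma pohozaev:
  assumes t: "0 < t" "t0 < w n t" and c: "2 + Hb * exp (- t) \<le> c"
  shows "(P n t)\<^sup>2 / 2 + Y n t \<le> c * P n t"
proof -
  define B where "B s = (P n s)\<^sup>2 / 2 + Y n s - c * P n s" for s
  have mu: "t0 < mu n" using mu_gt t by blast
  have "B t / g1 (w n t) \<le> 0"
  proof (rule DERIV_nonneg_le_lim[where F = "\<lambda>t. B t / g1 (w n t)"])
    have "((\<lambda>s. B s / g1 (w n s)) \<longlongrightarrow> (0\<^sup>2 / 2 + 0 - c * 0) / g1 (mu n)) at_top"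
      unfolding B_def[abs_def] using g1_pos[OF mu]
      by (intro tendsto_intros P_lim Y_lim mu g1w_lim) auto
    then show "((\<lambda>s. B s / g1 (w n s)) \<longlongrightarrow> 0) at_top" by simp
  next
    fix s assume s: "t \<le> s"
    then have s': "0 < s" "t0 < w n s" using t region_up[of t s n] by auto
    let ?e = "eps (w n s)" and ?P = "P n s" and ?Y = "Y n s" and ?g = "g1 (w n s)"
    have gp: "?g > 0" using g1_pos s' by blast
    have "(B has_real_derivative (2 * ?P * (?e * ?P\<^sup>2 - ?Y)) / 2 + ?Y * (?P - 2 + (?e * ?P + H s)) - c * (?e * ?P\<^sup>2 - ?Y)) (at s)"
      unfolding B_def[abs_def]
      by (auto intro!: derivative_eq_intros P_deriv Y_deriv s')
    then have "((\<lambda>s. B s / g1 (w n s)) has_real_derivative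
       (((2 * ?P * (?e * ?P\<^sup>2 - ?Y)) / 2 + ?Y * (?P - 2 + (?e * ?P + H s)) - c * (?e * ?P\<^sup>2 - ?Y)) * ?g - B s * (?g * (?e * ?P))) / (?g * ?g)) (at s)"
      by (intro DERIV_divide g1w_deriv s') (use gp in auto)
    also have "(((2 * ?P * (?e * ?P\<^sup>2 - ?Y)) / 2 + ?Y * (?P - 2 + (?e * ?P + H s)) - c * (?e * ?P\<^sup>2 - ?Y)) * ?g - B s * (?g * (?e * ?P))) / (?g * ?g)
       = (?e * ?P ^ 3 / 2 + ?Y * (c - 2 + H s)) / ?g"
      using gp unfolding B_def by (simp add: field_simps power2_eq_square power3_eq_cube)
    finally have D: "((\<lambda>s. B s / g1 (w n s)) has_real_derivative (?e * ?P ^ 3 / 2 + ?Y * (c - 2 + H s)) / ?g) (at s)" .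
    \<comment> \<open>The bound for \<open>H\<close> decreases in time, so a condition on
      \<open>c\<close> at the left end covers all later times.\<close>
    have "Hb * exp (- s) \<le> Hb * exp (- t)" using s Hb_nonneg by (intro mult_left_mono) auto
    then have "c - 2 + H s \<ge> 0" using c H_bound[OF s'(1)] by linarith
    show "\<exists>y. ((\<lambda>s. B s / g1 (w n s)) has_real_derivative y) (at s) \<and> 0 \<le> y"
      by (rule DERIV_nonnegI[OF D]) (use \<open>c - 2 + H s \<ge> 0\<close> gp eps_pos[OF s'(2)] P_pos[OF s'] Y_pos[OF s'] in auto)
  qed
  then show ?thesis using g1_pos[OF t(2)] by (simp add: B_def divide_le_0_iff)
qed

text \<open>Drop \<open>Y\<close> in \<open>pohozaev\<close> and divide by \<open>P\<close>. For
  large \<open>t\<close> the bound is close to 4, which is what the proof of \<open>P_lower\<close>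
  collides with.\<close>

lemma P_le:
  assumes t: "0 < t" "t0 < w n t" and c: "2 + Hb * exp (- t) \<le> c"
  shows "P n t \<le> 2 * c"
proof -
  have "(P n t)\<^sup>2 / 2 \<le> c * P n t" using pohozaev[OF assms] Y_pos[OF t] by simp
  then have "P n t * P n t \<le> (2 * c) * P n t" by (simp add: power2_eq_square)
  then show ?thesis using P_pos[OF t] by simp
qed

lemma P_le_P0: "0 < t \<Longrightarrow> t0 < w n t \<Longrightarrow> P n t \<le> P0"
  using P_le[of t n "2 + Hb"] Hb_nonneg by (simp add: P0_def mult_left_le)

definition Y0 :: real where "Y0 = (2 + Hb) * P0"

lemma Y_le: assumes "0 < t" "t0 < w n t" shows "Y n t \<le> Y0"
proof -
  have "Y n t \<le> (2 + Hb) * P n t"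
  proof -
    have "Hb * exp (- t) \<le> Hb" using Hb_nonneg assms by (simp add: mult_left_le)
    then have "(P n t)\<^sup>2 / 2 + Y n t \<le> (2 + Hb) * P n t" by (intro pohozaev assms) simp
    then show ?thesis using zero_le_power2[of "P n t"] by linarith
  qed
  also have "\<dots> \<le> Y0" unfolding Y0_def using P_le_P0[OF assms] Hb_nonneg by (intro mult_left_mono) auto
  finally show ?thesis .
qed

text \<open>An integrated bound for \<open>Y\<close>: the term \<open>(P0 - P) * (eps * P)\<close>
  is nonnegative, so the integral of \<open>Y\<close> over an interval is at most the increment of
  this function, hence at most \<open>P0\<close> times the increment of \<open>ln (g1 w)\<close>
  plus \<open>P0\<close>.\<close>

lemma X_deriv:
  assumes t: "0 < t" "t0 < w n t"
  shows "((\<lambda>t. P0 * ln (g1 (w n t)) - P n t) has_real_derivative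
      (P0 - P n t) * (eps (w n t) * P n t) + Y n t) (at t)"
  using DERIV_diff[OF DERIV_cmult[OF ln_g1w_deriv[OF t], of P0] P_deriv[OF t]]
  by (simp add: algebra_simps power2_eq_square)

lemma epsP_nonneg: "0 < t \<Longrightarrow> t0 < w n t \<Longrightarrow> 0 \<le> eps (w n t) * P n t"
  using eps_pos[of "w n t"] P_pos[of t n] by simp

text \<open>The mean value theorem for the function of \<open>X_deriv\<close>: \<open>Y\<close> must
  be small somewhere on a long interval over which \<open>g1 w\<close> changes by a bounded
  factor.\<close>

lemma Y_small_point:
  assumes t: "0 < a" "a < b" "t0 < w n a"
  obtains x where "a < x" "x < b"
    "Y n x * (b - a) \<le> P0 * (ln (g1 (w n b)) - ln (g1 (w n a))) + P0"
proof -
  let ?X = "\<lambda>t. P0 * ln (g1 (w n t)) - P n t"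
  let ?X' = "\<lambda>t. (P0 - P n t) * (eps (w n t) * P n t) + Y n t"
  have r: "0 < x" "t0 < w n x" if "a \<le> x" for x using that t region_up[of a x n] by auto
  obtain x where x: "a < x" "x < b" "?X b - ?X a = (b - a) * ?X' x"
    using MVT2[OF t(2), of ?X ?X'] X_deriv[OF r] by auto
  have rx: "0 < x" "t0 < w n x" and rb: "0 < b" "t0 < w n b" using r x t by auto
  have "Y n x \<le> ?X' x"
    using P_le_P0[OF rx] epsP_nonneg[OF rx] by simp
  then have "Y n x * (b - a) \<le> ?X b - ?X a" unfolding x(3) using t by (simp add: mult.commute)
  also have "\<dots> \<le> P0 * (ln (g1 (w n b)) - ln (g1 (w n a))) + P0"
    using P_pos[OF rb] P_le_P0[OF t(1,3)] by (simp add: algebra_simps)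
  finally show ?thesis using that x by blast
qed

text \<open>A bound for the modulus of \<open>(P - 2) * P\<close>, the coefficient of
  \<open>eps * P\<close> in the derivative of the energy.\<close>

definition AQ :: real where "AQ = P0 * (P0 + 2)"

text \<open>In \<open>Q' = (P - 2) * P * (eps * P) + Y * (eps * P + H)\<close> the large terms have
  cancelled. The factor \<open>eps * P\<close> is the derivative of \<open>ln (g1 w)\<close>, which
  controls the first summand; the second is at most \<eta> times \<open>Y\<close>, which
  \<open>X_deriv\<close> integrates.\<close>

lemma Q_var:
  assumes t: "0 < a" "a \<le> b" "t0 < w n a"
    and eta: "\<And>s. a \<le> s \<Longrightarrow> s \<le> b \<Longrightarrow> \<bar>eps (w n s) * P n s + H s\<bar> \<le> \<eta>"
  shows "\<bar>Q n b - Q n a\<bar> \<le> (AQ + \<eta> * P0) * (ln (g1 (w n b)) - ln (g1 (w n a))) + \<eta> * P0"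
proof -
  let ?X = "\<lambda>t. P0 * ln (g1 (w n t)) - P n t"
  have r: "0 < x" "t0 < w n x" if "a \<le> x" for x using that t region_up[of a x n] by auto
  have eta0: "0 \<le> \<eta>" using eta[of a] t by auto
  have key: "\<exists>D. ((\<lambda>t. AQ * ln (g1 (w n t)) + \<eta> * ?X t + \<sigma> * Q n t) has_real_derivative D) (at s) \<and> 0 \<le> D"
    if s: "a \<le> s" "s \<le> b" and sig: "\<sigma> = 1 \<or> \<sigma> = -1" for s \<sigma> :: real
  proof -
    note rs = r[OF s(1)]
    let ?e = "eps (w n s)" and ?P = "P n s" and ?Y = "Y n s"
    define Q' where "Q' = (?P - 2) * ?P * (?e * ?P) + ?Y * (?e * ?P + H s)"
    have "((\<lambda>s. (P n s - 2)\<^sup>2 / 2) has_real_derivative (?P - 2) * (?e * ?P\<^sup>2 - ?Y)) (at s)"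
      using DERIV_cdivide[OF DERIV_power[OF DERIV_diff[OF P_deriv[OF rs] DERIV_const[of 2]], of 2], of 2]
      by (simp add: mult.commute)
    from DERIV_add[OF this Y_deriv[OF rs]] have "(Q n has_real_derivative Q') (at s)"
      unfolding Q_def[abs_def] Q'_def by (simp add: algebra_simps power2_eq_square)
    then have D: "((\<lambda>t. AQ * ln (g1 (w n t)) + \<eta> * ?X t + \<sigma> * Q n t) has_real_derivative
       AQ * (?e * ?P) + \<eta> * ((P0 - ?P) * (?e * ?P) + ?Y) + \<sigma> * Q') (at s)"
      by (intro DERIV_add DERIV_cmult ln_g1w_deriv X_deriv rs)
    have p: "0 < ?P" "?P \<le> P0" "0 < ?Y" "0 \<le> ?e * ?P" using rs P_pos P_le_P0 Y_pos epsP_nonneg by auto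
    have "\<bar>(?P - 2) * ?P\<bar> \<le> (P0 + 2) * P0"
      unfolding abs_mult using p by (intro mult_mono) auto
    then have 1: "\<bar>(?P - 2) * ?P * (?e * ?P)\<bar> \<le> AQ * (?e * ?P)"
      unfolding AQ_def abs_mult[of _ "?e * ?P"] abs_of_nonneg[OF p(4)] mult.commute[of P0]
      using p(4) by (rule mult_right_mono)
    have 2: "\<bar>?Y * (?e * ?P + H s)\<bar> \<le> \<eta> * ?Y"
      unfolding abs_mult using p eta[OF s] by (simp add: mult.commute)
    have 3: "0 \<le> \<eta> * ((P0 - ?P) * (?e * ?P))" using eta0 p by simp
    have "\<bar>\<sigma> * Q'\<bar> \<le> AQ * (?e * ?P) + \<eta> * ?Y"
    proof -
      have "\<bar>Q'\<bar> \<le> AQ * (?e * ?P) + \<eta> * ?Y" using 1 2 unfolding Q'_def by linarith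
      moreover have "\<bar>\<sigma> * Q'\<bar> = \<bar>Q'\<bar>" using sig by auto
      ultimately show ?thesis by simp
    qed
    then have "0 \<le> AQ * (?e * ?P) + \<eta> * ((P0 - ?P) * (?e * ?P) + ?Y) + \<sigma> * Q'"
      using 3 unfolding distrib_left by linarith
    then show ?thesis using D by blast
  qed
  have m: "AQ * ln (g1 (w n a)) + \<eta> * ?X a + \<sigma> * Q n a \<le> AQ * ln (g1 (w n b)) + \<eta> * ?X b + \<sigma> * Q n b"
    if "\<sigma> = 1 \<or> \<sigma> = -1" for \<sigma> :: real
    by (rule DERIV_nonneg_imp_nondecreasing[where f = "\<lambda>t. AQ * ln (g1 (w n t)) + \<eta> * ?X t + \<sigma> * Q n t",
          OF t(2) key[OF _ _ that]])
  have "\<eta> * (P n a - P n b) \<le> \<eta> * P0"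
    using P_pos[OF r[OF t(2)]] P_le_P0[OF t(1,3)] eta0 by (intro mult_left_mono) auto
  then show ?thesis using m[of 1] m[of "-1"] by (simp add: algebra_simps abs_le_iff)
qed

text \<open>Two comparisons from infinity: \<open>P - Y\<close> is nondecreasing with limit 0, so
  \<open>P \<le> Y\<close>; therefore \<open>w + Y / g1 w\<close> is nonincreasing with limit
  \<open>mu\<close>. A profile whose slope has become small can gain no more than the height
  \<open>Y / g1 w\<close> afterwards.\<close>

lemma base_level:
  assumes t: "0 < t" "t0 < w n t"
    and small: "\<And>s. t \<le> s \<Longrightarrow> P n s \<le> 1/2 \<and> eps (w n s) * P n s + H s \<le> 1/2"
  shows "mu n \<le> w n t + Y n t / g1 (w n t)"
proof -
  have mu: "t0 < mu n" using mu_gt t by blast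
  have PY: "P n s \<le> Y n s" if s: "t \<le> s" for s
  proof -
    have "P n s - Y n s \<le> 0 - 0"
    proof (rule DERIV_nonneg_le_lim[where F = "\<lambda>s. P n s - Y n s"])
      show "((\<lambda>s. P n s - Y n s) \<longlongrightarrow> 0 - 0) at_top" by (intro tendsto_diff P_lim Y_lim mu)
      fix x assume "s \<le> x"
      then have x: "0 < x" "t0 < w n x" "t \<le> x" using s t region_up[of t x n] by auto
      have D: "((\<lambda>s. P n s - Y n s) has_real_derivative
         eps (w n x) * (P n x)\<^sup>2 + Y n x * (1 - P n x - (eps (w n x) * P n x + H x))) (at x)"
        by (auto intro!: derivative_eq_intros P_deriv Y_deriv x simp: algebra_simps)
      show "\<exists>y. ((\<lambda>s. P n s - Y n s) has_real_derivative y) (at x) \<and> 0 \<le> y"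
        by (rule DERIV_nonnegI[OF D], use small[OF x(3)] Y_pos[OF x(1,2)] eps_pos[OF x(2)] in
            \<open>auto intro!: add_nonneg_nonneg mult_nonneg_nonneg\<close>)
    qed
    then show ?thesis by simp
  qed
  have "- (w n t + Y n t / g1 (w n t)) \<le> - (mu n + 0 / g1 (mu n))"
  proof (rule DERIV_nonneg_le_lim[where F = "\<lambda>t. - (w n t + Y n t / g1 (w n t))"])
    show "((\<lambda>t. - (w n t + Y n t / g1 (w n t))) \<longlongrightarrow> - (mu n + 0 / g1 (mu n))) at_top"
      using g1_pos[OF mu] by (intro tendsto_intros w_lim Y_lim g1w_lim mu) auto
    fix x assume x0: "t \<le> x"
    then have x: "0 < x" "t0 < w n x" using t region_up[of t x n] by auto
    let ?e = "eps (w n x)" and ?P = "P n x" and ?Y = "Y n x" and ?g = "g1 (w n x)"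
    have gp: "?g > 0" using g1_pos x by blast
    have "((\<lambda>t. - (w n t + Y n t / g1 (w n t))) has_real_derivative
      - (v n x + (?Y * (?P - 2 + (?e * ?P + H x)) * ?g - ?Y * (?g * (?e * ?P))) / (?g * ?g))) (at x)"
      by (intro DERIV_minus DERIV_add DERIV_divide w_deriv Y_deriv g1w_deriv x) (use gp in auto)
    moreover have "v n x = ?P / ?g" using gp by (simp add: P_def)
    moreover have "- (?P / ?g + (?Y * (?P - 2 + (?e * ?P + H x)) * ?g - ?Y * (?g * (?e * ?P))) / (?g * ?g))
       = ((?Y - ?P) + ?Y * (1 - ?P - H x)) / ?g" using gp by (simp add: field_simps)
    ultimately have D: "((\<lambda>t. - (w n t + Y n t / g1 (w n t))) has_real_derivative
        ((?Y - ?P) + ?Y * (1 - ?P - H x)) / ?g) (at x)" by simp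
    have "1 - ?P - H x \<ge> 0" using small[OF x0] epsP_nonneg[OF x] by linarith
    show "\<exists>y. ((\<lambda>t. - (w n t + Y n t / g1 (w n t))) has_real_derivative y) (at x) \<and> 0 \<le> y"
      by (rule DERIV_nonnegI[OF D], use \<open>1 - ?P - H x \<ge> 0\<close> gp PY[OF x0] Y_pos[OF x] in
          \<open>auto intro!: divide_nonneg_pos add_nonneg_nonneg mult_nonneg_nonneg\<close>)
  qed
  then show ?thesis by simp
qed

text \<open>At an upward crossing of the value 2 one would have \<open>Y \<le> 4 * eps\<close>,
  whereas \<open>Q = Y\<close> there. With the energy above \<open>4 * eps\<close>, the value 2
  cannot be reached from below.\<close>

lemma P_stays_above:
  assumes t: "0 < a" "a \<le> b" "t0 < w n a" and b: "P n b = 2"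
    and Q: "\<And>s. a \<le> s \<Longrightarrow> s \<le> b \<Longrightarrow> 4 * eps (w n s) < Q n s" and s: "a \<le> s" "s \<le> b"
  shows "2 \<le> P n s"
proof (rule ccontr)
  assume "\<not> 2 \<le> P n s"
  then have lt: "P n s < 2" by simp
  have rs: "0 < s" "t0 < w n s" using s t region_up[of a s n] by auto
  obtain x where x: "s < x" "x \<le> b" "P n x = 2" "\<And>x'. s \<le> x' \<Longrightarrow> x' < x \<Longrightarrow> P n x' < 2"
    using first_hit[OF s(2) continuous_on_P[OF rs] lt] b by (metis order_refl)
  have rx: "0 < x" "t0 < w n x" using rs x region_up[of s x n] by auto
  have "0 \<le> eps (w n x) * (P n x)\<^sup>2 - Y n x"
    by (rule DERIV_left_max_nonneg[OF P_deriv[OF rx] x(1)]) (use x in auto)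
  moreover have "Q n x = Y n x" unfolding Q_def x(3) by simp
  ultimately show False using Q[of x] x s by simp
qed

text \<open>Up to bounded or slowly varying terms \<open>ln Y\<close> is
  \<open>g w - 2 * t + ln lam\<close>; the levels and times of the peaks are computed from this
  balance.\<close>

lemma ln_Y:
  assumes "0 < t" "t0 < w n t"
  shows "ln (Y n t) = ln (g1 (w n t)) + ln (lam n) - 2 * t + ln (hh t) + g (w n t)"
  unfolding Y_def using g1_pos[OF assms(2)] lam_pos[of n] hh_pos[OF assms(1)] by (simp add: ln_mult)

lemma level_exists:
  assumes "0 < x" "x < mu n" obtains t where "0 < t" "w n t = x"
proof -
  have "\<forall>\<^sub>F t in at_right 0. w n t < x" using order_tendstoD(2)[OF w_zero assms(1)] .
  then obtain a where a: "0 < a" "w n a < x"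
    by (metis eventually_at_right_field dense)
  have "\<forall>\<^sub>F t in at_top. x < w n t" using order_tendstoD(1)[OF w_lim assms(2)] .
  then obtain b where b: "b > a" "x < w n b"
    by (metis (full_types) eventually_at_top_dense gt_ex less_trans linorder_less_linear)
  have "\<exists>t\<ge>a. t \<le> b \<and> w n t = x"
    by (rule IVT') (use a b isCont_w in \<open>auto intro!: continuous_at_imp_continuous_on\<close>)
  then obtain t where "a \<le> t" "w n t = x" by blast
  then show ?thesis using that[of t] a by simp
qed

lemma v_diff:
  assumes t: "0 < a" "a < b" "t0 < w n a"
  obtains x where "a < x" "x < b" "v n a - v n b = (b - a) * (Y n x / g1 (w n x))"
proof -
  have r: "0 < x" "t0 < w n x" if "a \<le> x" for x using that t region_up[of a x n] by auto
  obtain x where x: "a < x" "x < b" "v n b - v n a = (b - a) * - (Y n x / g1 (w n x))"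
    using MVT2[OF t(2), of "v n" "\<lambda>x. - (Y n x / g1 (w n x))"] v_deriv'[OF r] by auto
  have "v n a - v n b = - (v n b - v n a)" by simp
  also have "\<dots> = (b - a) * (Y n x / g1 (w n x))" unfolding x(3) by simp
  finally show ?thesis using that x(1,2) by blast
qed

end

section \<open>A lower bound for the slope\<close>

context nonlinearity begin

lemma g_chord:
  assumes "t0 < a" "a \<le> x" "x \<le> b"
  shows "(g x - g a) * (b - a) \<le> (g b - g a) * (x - a)"
proof -
  have "(g x - g a) * (b - x) \<le> g1 x * (x - a) * (b - x)"
    by (intro mult_right_mono g_tangent) (use assms in auto)
  also have "\<dots> = g1 x * (b - x) * (x - a)" by simp
  also have "\<dots> \<le> (g b - g x) * (x - a)"
    by (intro mult_right_mono g_tangent) (use assms in auto)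
  finally show ?thesis by (simp add: algebra_simps)
qed

lemma g1_attains:
  assumes "t0 < a" "g1 a \<le> c" obtains b where "a \<le> b" "g1 b = c"
proof -
  have "\<forall>\<^sub>F t in at_top. c \<le> g1 t \<and> a \<le> t"
    using filterlim_g1 by (auto simp: filterlim_at_top eventually_ge_at_top intro: eventually_conj)
  then obtain d where d: "c \<le> g1 d" "a \<le> d" by (auto simp: eventually_at_top_linorder)
  have "\<exists>x\<ge>a. x \<le> d \<and> g1 x = c"
  proof (rule IVT'[OF assms(2) d])
    have "isCont g1 x" if "a \<le> x" for x using that assms g1_deriv[of x] DERIV_isCont by force
    then show "continuous_on {a..d} g1" by (intro continuous_at_imp_continuous_on) auto
  qed
  then show ?thesis using that by blast
qed

end

context profiles begin

text \<open>At the first time at which \<open>P\<close> climbs to a small value \<open>c\<close> we have \<open>Y \<le> eps * c\<^sup>2\<close>; from there on \<open>w\<close> stays almost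
  linear up to the height where \<open>P > 4\<close>, which contradicts \<open>pohozaev\<close>.\<close>

lemma P_lower:
  obtains M c where "t0 < M" "0 < c" "c \<le> 2"
    "\<forall>n t T. 0 < t \<longrightarrow> t \<le> T \<longrightarrow> M \<le> w n t \<longrightarrow> c \<le> P n T \<longrightarrow> c \<le> P n t"
proof -
  \<comment> \<open>\<open>kap < 1/2\<close> is what allows an admissible depth
    \<open>Zs > 2\<close>. A line of slope \<open>A / g1 x4\<close> climbs \<open>Zs * y x4\<close>
    in time \<open>Zs * g x4 / A\<close>, so \<open>g\<close> grows along it at average rate at most
    \<open>A / Zs\<close>. As \<open>A = 2 + Zs\<close>, this is below the rate 2 of
    \<open>exp (- 2 * t)\<close>, with margin \<eta>, and yet \<open>A > 4\<close>.\<close>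
  obtain Zs where Zs: "2 < Zs" "kap * Zs < 1" using kap_room[of 2] kap_less_half by auto
  define A where "A = 2 + Zs"
  define A' where "A' = (A + 4) / 2"
  define \<eta> where "\<eta> = 1 - 2 / Zs"
  have A: "4 < A" "4 < A'" "A' < A" using Zs by (auto simp: A_def A'_def)
  have \<eta>: "0 < \<eta>" "2 - \<eta> = A / Zs" using Zs by (auto simp: \<eta>_def A_def field_simps)
  \<comment> \<open>\<rho> becomes the ratio of \<open>g1\<close> between the two ends of the linear
    flight. Being below \<open>E1 Zs\<close>, it makes the climb longer than \<open>Zs\<close>
    units, and \<open>c = \<rho> * A\<close> turns the initial slope into
    \<open>A / g1 x4\<close>.\<close>
  define \<rho> where "\<rho> = min (E1 Zs / 2) (1 / A)"
  have \<rho>: "0 < \<rho>" "\<rho> < E1 Zs" "\<rho> * A \<le> 1"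
    using E1_pos[OF Zs(2)] A by (auto simp: \<rho>_def min_def field_simps)
  define c where "c = \<rho> * A"
  have c: "0 < c" "c \<le> 1" using \<rho> A by (auto simp: c_def)
  \<comment> \<open>The opposite inequality keeps the climb below \<open>Z2\<close> units, so that
    losing a fraction \<tau> of it costs at most \<open>\<tau> * Z2\<close> units of height.\<close>
  obtain Z2 where Z2: "Zs \<le> Z2" "kap * Z2 < 1" "E1 Z2 < \<rho>" using E1_small[OF \<rho>(1) Zs(2)] .
  have "((\<lambda>\<tau>. A * (1 - \<tau>) * E1 (\<tau> * Z2)) \<longlongrightarrow> A * (1 - 0) * E1 (0 * Z2)) (at_right 0)"
    by (intro tendsto_intros isCont_tendsto_compose[OF DERIV_isCont[OF E1_deriv]]) auto
  then have "\<forall>\<^sub>F \<tau> in at_right 0. A' < A * (1 - \<tau>) * E1 (\<tau> * Z2)"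
    by (rule order_tendstoD) (use A in auto)
  moreover have "\<forall>\<^sub>F \<tau> in at_right (0::real). \<tau> < 1" by (rule order_tendstoD(2)[OF tendsto_ident_at]) simp
  moreover have "\<forall>\<^sub>F \<tau> in at_right (0::real). 0 < \<tau>" by (rule eventually_at_right_less)
  ultimately have "\<forall>\<^sub>F \<tau> in at_right 0. A' < A * (1 - \<tau>) * E1 (\<tau> * Z2) \<and> \<tau> < 1 \<and> 0 < \<tau>"
    by eventually_elim auto
  \<comment> \<open>\<tau> is the tolerated relative loss of slope: even after it, \<open>P\<close>
    exceeds \<open>A' > 4\<close> at the end of the flight.\<close>
  then obtain \<tau> where \<tau>: "A' < A * (1 - \<tau>) * E1 (\<tau> * Z2)" "\<tau> < 1" "0 < \<tau>"
    using eventually_happens by (metis (no_types, lifting) trivial_limit_at_right_real)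
  have \<tau>Z2: "\<tau> * Z2 \<le> Z2" using \<tau> Z2 Zs by (simp add: mult_left_le_one_le)
  have lim: "((\<lambda>x. g1 (x - z * y x) / g1 x) \<longlongrightarrow> E1 z) at_top"
    "filterlim (\<lambda>x. x - z * y x) at_top at_top" if "kap * z < 1" "0 \<le> z" for z
  proof -
    have a: "filterlim (\<lambda>x::real. x) at_top at_top" by (rule filterlim_ident)
    have b: "((\<lambda>_::real. z) \<longlongrightarrow> z) at_top" by simp
    show "((\<lambda>x. g1 (x - z * y x) / g1 x) \<longlongrightarrow> E1 z) at_top" "filterlim (\<lambda>x. x - z * y x) at_top at_top"
      using ratio_tendsto(2)[OF a b that(1)] level_at_top[OF a b that(1)] that(2) by simp_all
  qed
  have "((\<lambda>x. A * (1 - \<tau>) * (g1 (x - \<tau> * Z2 * y x) / g1 x)) \<longlongrightarrow> A * (1 - \<tau>) * E1 (\<tau> * Z2)) at_top"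
    by (intro tendsto_mult tendsto_const lim) (use Z2 Zs \<tau> kap_mult_less[OF \<tau>Z2 Z2(2)] in auto)
  then have ev1: "\<forall>\<^sub>F x in at_top. A' < A * (1 - \<tau>) * (g1 (x - \<tau> * Z2 * y x) / g1 x)"
    by (rule order_tendstoD) (use \<tau> in auto)
  have ev2: "\<forall>\<^sub>F x in at_top. \<rho> < g1 (x - Zs * y x) / g1 x"
    by (rule order_tendstoD(1)[OF lim(1)]) (use Zs \<rho> in auto)
  have ev3: "\<forall>\<^sub>F x in at_top. g1 (x - Z2 * y x) / g1 x < \<rho>"
    by (rule order_tendstoD(2)[OF lim(1)]) (use Zs Z2 in auto)
  have ev4: "\<forall>\<^sub>F x in at_top. t0 < x - Z2 * y x" and ev5: "\<forall>\<^sub>F x in at_top. t0 < x"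
    using lim(2)[of Z2] Z2 Zs by (auto simp: filterlim_at_top_dense eventually_gt_at_top)
  have "((\<lambda>x. eps x * (c * exp CH / \<eta>)) \<longlongrightarrow> 0 * (c * exp CH / \<eta>)) at_top"
    by (intro tendsto_mult eps_lim tendsto_const)
  then have ev6: "\<forall>\<^sub>F x in at_top. eps x * (c * exp CH / \<eta>) < \<tau>"
    by (rule order_tendstoD) (use \<tau> in auto)
  have "filterlim (\<lambda>x. Zs / A * g x) at_top at_top"
    by (rule filterlim_tendsto_pos_mult_at_top[OF tendsto_const _ filterlim_g]) (use A Zs in auto)
  then have "filterlim (\<lambda>x. - (Zs / A * g x)) at_bot at_top"
    by (simp only: filterlim_uminus_at_bot minus_minus)
  then have "((\<lambda>x. Hb * exp (- (Zs / A * g x))) \<longlongrightarrow> Hb * 0) at_top"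
    by (intro tendsto_mult tendsto_const filterlim_compose[OF exp_at_bot])
  then have ev7: "\<forall>\<^sub>F x in at_top. Hb * exp (- (Zs / A * g x)) < (A' - 4) / 2"
    by (rule order_tendstoD) (use A in auto)
  have "\<forall>\<^sub>F x in at_top. A' < A * (1 - \<tau>) * (g1 (x - \<tau> * Z2 * y x) / g1 x) \<and>
     \<rho> < g1 (x - Zs * y x) / g1 x \<and> g1 (x - Z2 * y x) / g1 x < \<rho> \<and> t0 < x - Z2 * y x \<and> t0 < x \<and>
     eps x * (c * exp CH / \<eta>) < \<tau> \<and> Hb * exp (- (Zs / A * g x)) < (A' - 4) / 2 \<and> 0 < g x"
    using ev1 ev2 ev3 ev4 ev5 ev6 ev7 ev_g_gt[of 0] by eventually_elim auto
  then obtain M where M: "\<And>x. M \<le> x \<Longrightarrow> A' < A * (1 - \<tau>) * (g1 (x - \<tau> * Z2 * y x) / g1 x) \<and>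
     \<rho> < g1 (x - Zs * y x) / g1 x \<and> g1 (x - Z2 * y x) / g1 x < \<rho> \<and> t0 < x - Z2 * y x \<and> t0 < x \<and>
     eps x * (c * exp CH / \<eta>) < \<tau> \<and> Hb * exp (- (Zs / A * g x)) < (A' - 4) / 2 \<and> 0 < g x"
    by (auto simp: eventually_at_top_linorder)
  have Mt0: "t0 < M" using M[of M] by simp
  have "c \<le> P n t" if t: "0 < t" "t \<le> T" "M \<le> w n t" and T: "c \<le> P n T" for n t T
  proof (rule ccontr)
    assume "\<not> c \<le> P n t"
    then have lt: "P n t < c" by simp
    have wt: "t0 < w n t" using t Mt0 by simp
    obtain a where a: "t < a" "a \<le> T" "P n a = c" "\<And>x. t \<le> x \<Longrightarrow> x < a \<Longrightarrow> P n x < c"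
      using first_hit[OF t(2) continuous_on_P[OF t(1) wt] lt T] by metis
    have ra: "0 < a" "t0 < w n a" "M \<le> w n a" using t a wt region_up[of t a n] w_mono[of t a n] by auto
    have r: "0 < s" "t0 < w n s" "w n a \<le> w n s" if "a \<le> s" for s using that ra region_up[of a s n] w_mono[of a s n] by auto
    have "0 \<le> eps (w n a) * (P n a)\<^sup>2 - Y n a"
      by (rule DERIV_left_max_nonneg[OF P_deriv[OF ra(1,2)] a(1)]) (use a in auto)
    then have Ya: "Y n a \<le> eps (w n a) * c\<^sup>2" using a by simp
    define x1 where "x1 = w n a"
    note Mx1 = M[of x1, unfolded x1_def, OF ra(3)]
    have g1x1: "0 < g1 x1" using g1_pos ra by (simp add: x1_def)
    define b where "b = v n a"
    have b: "b = c / g1 x1" "0 < b" using a(3) g1x1 v_pos[OF ra(1,2)] by (auto simp: b_def P_def x1_def field_simps)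
    have "\<rho> * 1 \<le> \<rho> * A" using \<rho> A by (intro mult_left_mono) auto
    then have "\<rho> \<le> 1" using \<rho>(3) by linarith
    then have "1 \<le> 1 / \<rho>" using \<rho> by (simp add: field_simps)
    then have "g1 x1 * 1 \<le> g1 x1 * (1 / \<rho>)" using g1x1 by (intro mult_left_mono) auto
    \<comment> \<open>\<open>x4\<close> is the height at which a line of the initial slope would
      have \<open>P = A\<close>.\<close>
    then obtain x4 where x4: "x1 \<le> x4" "g1 x4 = g1 x1 * (1 / \<rho>)"
      using g1_attains[of x1] ra x1_def by auto
    have g14: "g1 x1 = \<rho> * g1 x4" "0 < g1 x4" using x4(2) \<rho> g1x1 by auto
    have M4: "M \<le> x4" using x4 ra by (simp add: x1_def)
    have y4: "0 < y x4" using M[OF M4] g14 by (simp add: y_def)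
    have lo: "x1 < x4 - Zs * y x4"
    proof (rule ccontr)
      assume "\<not> ?thesis"
      moreover have "Zs * y x4 \<le> Z2 * y x4" using Z2 y4 by simp
      ultimately have "g1 (x4 - Zs * y x4) \<le> g1 x1" using M[OF M4] by (intro g1_mono) linarith+
      moreover have "\<rho> * g1 x4 < g1 (x4 - Zs * y x4)" using M[OF M4] g14(2) by (simp add: field_simps)
      ultimately show False using g14 by simp
    qed
    have hi: "x4 - Z2 * y x4 < x1"
    proof (rule ccontr)
      assume "\<not> ?thesis"
      then have "g1 x1 \<le> g1 (x4 - Z2 * y x4)" using ra by (intro g1_mono) (auto simp: x1_def)
      moreover have "g1 (x4 - Z2 * y x4) < \<rho> * g1 x4" using M[OF M4] g14(2) by (simp add: field_simps)
      ultimately show False using g14 by simp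
    qed
    have b4: "b = A / g1 x4" unfolding b(1) g14(1) c_def using \<rho> by simp
    define \<sigma> where "\<sigma> = (x4 - x1) / b"
    have \<sigma>: "\<sigma> * b = x4 - x1" "\<sigma> = (x4 - x1) * g1 x4 / A"
      using b(2) by (simp_all add: \<sigma>_def, simp add: b4)
    have x41: "0 < x4 - x1" "Zs * y x4 \<le> x4 - x1"
    proof -
      have "0 < Zs * y x4" using y4 Zs by (intro mult_pos_pos) auto
      then show "0 < x4 - x1" "Zs * y x4 \<le> x4 - x1" using lo by linarith+
    qed
    have \<sigma>0: "0 < \<sigma>" unfolding \<sigma>_def using x41(1) b(2) by (rule divide_pos_pos)
    have gx: "g x4 \<le> (2 - \<eta>) * \<sigma>"
    proof -
      have "g x4 = y x4 * g1 x4" using g14 by (simp add: y_def)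
      also have "\<dots> \<le> ((x4 - x1) / Zs) * g1 x4" using x41 Zs g14 by (intro mult_right_mono) (simp_all add: pos_le_divide_eq mult.commute)
      also have "\<dots> = (2 - \<eta>) * \<sigma>" unfolding \<sigma>(2) \<eta>(2) using A Zs by (simp add: field_simps)
      finally show ?thesis .
    qed
    \<comment> \<open>Concavity keeps \<open>w\<close> below its tangent, and convexity keeps
      \<open>g\<close> along this tangent below its chord, whose slope in time is at most
      \<open>2 - \<eta>\<close>.\<close>
    have growth: "g (w n s) - g x1 \<le> (2 - \<eta>) * (s - a)" if s: "a \<le> s" "s \<le> a + \<sigma>" for s
    proof -
      define x where "x = x1 + b * (s - a)"
      have xs: "x1 \<le> x" "x \<le> x4" using s b(2) \<sigma>(1) mult_left_mono[of "s - a" \<sigma> b] by (auto simp: x_def mult.commute)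
      have "w n s \<le> x" using w_diff(2)[OF ra(1) s(1), of n] by (simp add: x_def b_def x1_def)
      then have "g (w n s) \<le> g x" using r[OF s(1)] by (intro g_mono) auto
      have "(g x - g x1) * (x4 - x1) \<le> (g x4 - g x1) * (x - x1)"
        using xs ra by (intro g_chord) (auto simp: x1_def)
      also have "\<dots> \<le> ((2 - \<eta>) * \<sigma>) * (x - x1)"
        using gx Mx1 xs by (intro mult_right_mono) (auto simp: x1_def)
      also have "\<dots> = (2 - \<eta>) * (s - a) * (x4 - x1)" unfolding \<sigma>(1)[symmetric] x_def by simp
      finally have "g x - g x1 \<le> (2 - \<eta>) * (s - a)" using x41 by simp
      then show ?thesis using \<open>g (w n s) \<le> g x\<close> by simp
    qed
    define F where "F s = Y n s / g1 (w n s)" for s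
    have F: "F s = lam n * exp (- 2 * s) * hh s * exp (g (w n s))" if "a \<le> s" for s
      using g1_pos[OF r(2)[OF that]] by (simp add: F_def Y_def)
    define K where "K = F a * exp CH"
    have Fle: "F s \<le> K * exp (- \<eta> * (s - a))" if s: "a \<le> s" "s \<le> a + \<sigma>" for s
    proof -
      have "ln (hh s) \<le> ln (hh a) + CH" using ln_hh_diff[OF r(1)[OF s(1)] ra(1)] by linarith
      then have hs: "hh s \<le> hh a * exp CH" using hh_pos[OF r(1)[OF s(1)]] hh_pos[OF ra(1)]
        by (metis exp_add exp_le_cancel_iff exp_ln)
      have "- 2 * s + g (w n s) \<le> (- 2 * a + g x1) + - \<eta> * (s - a)" using growth[OF s] by (simp add: algebra_simps)
      then have e: "exp (- 2 * s + g (w n s)) \<le> exp ((- 2 * a + g x1) + - \<eta> * (s - a))" by (simp only: exp_le_cancel_iff)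
      have "F s = (lam n * hh s) * exp (- 2 * s + g (w n s))" unfolding F[OF s(1)] exp_add by simp
      also have "\<dots> \<le> (lam n * (hh a * exp CH)) * exp ((- 2 * a + g x1) + - \<eta> * (s - a))"
        by (intro mult_mono mult_left_mono hs e) (use lam_pos[of n] hh_pos[OF ra(1)] in auto)
      also have "\<dots> = K * exp (- \<eta> * (s - a))" unfolding K_def F[OF order_refl] exp_add x1_def by simp
      finally show ?thesis .
    qed
    \<comment> \<open>\<open>K / \<eta>\<close> bounds the total loss of slope, the integral of the
      decaying bound for \<open>F\<close>. It is at most the fraction \<tau> of \<open>b\<close>,
      because \<open>Y\<close> starts below \<open>eps * c\<^sup>2\<close> and \<open>eps\<close> is
      small above \<open>M\<close>.\<close>
    have K: "K / \<eta> \<le> b * \<tau>"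
    proof -
      have "K / \<eta> \<le> eps x1 * c\<^sup>2 / g1 x1 * exp CH / \<eta>"
        unfolding K_def F_def x1_def[symmetric] using Ya g1x1 \<eta>
        by (intro divide_right_mono mult_right_mono) (auto simp: x1_def)
      also have "\<dots> = b * (eps x1 * (c * exp CH / \<eta>))" unfolding b(1) by (simp add: power2_eq_square)
      also have "\<dots> \<le> b * \<tau>" using Mx1 b by (intro mult_left_mono) (auto simp: x1_def)
      finally show ?thesis .
    qed
    have K0: "0 \<le> K" using Y_pos[OF ra(1,2)] g1_pos[OF ra(2)] by (auto simp: K_def F_def)
    have vlo: "b * (1 - \<tau>) \<le> v n (a + \<sigma>)"
    proof -
      let ?V = "\<lambda>s. v n s - K / \<eta> * exp (- \<eta> * (s - a))"
      have "?V a \<le> ?V (a + \<sigma>)"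
      proof (rule DERIV_nonneg_imp_nondecreasing[where f = ?V])
        fix s assume s: "a \<le> s" "s \<le> a + \<sigma>"
        have "((\<lambda>s. K / \<eta> * exp (- \<eta> * (s - a))) has_real_derivative K / \<eta> * (exp (- \<eta> * (s - a)) * (- \<eta>))) (at s)"
          by (auto intro!: derivative_eq_intros)
        moreover have "K / \<eta> * (exp (- \<eta> * (s - a)) * (- \<eta>)) = - (K * exp (- \<eta> * (s - a)))" using \<eta> by simp
        ultimately have e: "((\<lambda>s. K / \<eta> * exp (- \<eta> * (s - a))) has_real_derivative - (K * exp (- \<eta> * (s - a)))) (at s)" by metis
        have "(?V has_real_derivative - F s - - (K * exp (- \<eta> * (s - a)))) (at s)"
          unfolding F_def by (intro DERIV_diff e v_deriv' r[OF s(1)])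
        then show "\<exists>y. (?V has_real_derivative y) (at s) \<and> 0 \<le> y"
          by (rule DERIV_nonnegI) (use Fle[OF s] in simp)
      qed (use \<sigma>0 in simp)
      moreover have "0 \<le> K / \<eta> * exp (- \<eta> * (a + \<sigma> - a))" using K0 \<eta> by simp
      ultimately have "b - K / \<eta> \<le> v n (a + \<sigma>)" by (simp add: b_def)
      then show ?thesis using K by (simp add: algebra_simps)
    qed
    have sig: "a \<le> a + \<sigma>" using \<sigma>0 by simp
    note r4 = r[OF sig]
    have "(1 - \<tau>) * (x4 - x1) = b * (1 - \<tau>) * \<sigma>" unfolding \<sigma>(1)[symmetric] by simp
    also have "\<dots> \<le> v n (a + \<sigma>) * \<sigma>" using vlo \<sigma>0 by (intro mult_right_mono) auto
    also have "\<dots> \<le> w n (a + \<sigma>) - x1" using w_diff(1)[OF ra(1) sig, of n] by (simp add: x1_def)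
    finally have "x4 - \<tau> * (x4 - x1) \<le> w n (a + \<sigma>)" by (simp add: algebra_simps)
    moreover have "\<tau> * (x4 - x1) \<le> \<tau> * (Z2 * y x4)" using hi \<tau> by (intro mult_left_mono) auto
    ultimately have w4: "x4 - \<tau> * Z2 * y x4 \<le> w n (a + \<sigma>)" by simp
    have "\<tau> * Z2 * y x4 \<le> Z2 * y x4" by (rule mult_right_mono[OF \<tau>Z2]) (use y4 in simp)
    then have t04: "t0 < x4 - \<tau> * Z2 * y x4" using M[OF M4] by linarith
    have "A' < A * (1 - \<tau>) * (g1 (x4 - \<tau> * Z2 * y x4) / g1 x4)" using M[OF M4] by simp
    also have "\<dots> = g1 (x4 - \<tau> * Z2 * y x4) * (b * (1 - \<tau>))" unfolding b4 by simp
    also have "\<dots> \<le> P n (a + \<sigma>)" unfolding P_def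
      by (intro mult_mono g1_mono t04 w4 vlo) (use g1_pos[OF r4(2)] b(2) \<tau> in auto)
    \<comment> \<open>The flight has lasted at least \<open>Zs / A * g x4\<close>, so the correction
      that \<open>H\<close> adds to the bound 4 is small.\<close>
    also have "\<dots> \<le> 2 * (2 + Hb * exp (- (a + \<sigma>)))" by (intro P_le r4) simp
    also have "Hb * exp (- (a + \<sigma>)) \<le> Hb * exp (- (Zs / A * g x4))"
    proof (intro mult_left_mono Hb_nonneg)
      have "Zs / A * g x4 = (Zs * y x4) * g1 x4 / A" using g14 by (simp add: y_def)
      also have "\<dots> \<le> \<sigma>" unfolding \<sigma>(2) using x41 g14 A by (intro divide_right_mono mult_right_mono) auto
      finally show "exp (- (a + \<sigma>)) \<le> exp (- (Zs / A * g x4))" using ra by simp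
    qed
    also have "\<dots> < (A' - 4) / 2" using M[OF M4] by simp
    finally show False by (simp add: field_simps)
  qed
  then show ?thesis using that[of M c] Mt0 c by simp
qed

end

section \<open>Asymptotics at the top and the first peak\<close>

text \<open>\<open>T n\<close> is taken within \<open>1 / (n + 1)\<close> of the infimum of
  \<open>d n\<close>. One sequence then serves all tolerances, without a diagonal argument.\<close>

lemma choose_sequence:
  fixes d :: "nat \<Rightarrow> 'a \<Rightarrow> real"
  assumes "\<And>\<delta>. \<delta> > 0 \<Longrightarrow> \<forall>\<^sub>F n in sequentially. \<exists>t. R n t \<and> d n t \<le> \<delta>" and d: "\<And>n t. 0 \<le> d n t"
  obtains T where "\<forall>\<^sub>F n in sequentially. R n (T n)" "(\<lambda>n. d n (T n)) \<longlonglongrightarrow> 0"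
proof -
  define m where "m n = (INF t\<in>{t. R n t}. d n t)" for n
  define T where "T n = (SOME t. R n t \<and> d n t \<le> m n + inverse (real (Suc n)))" for n
  have bdd: "bdd_below (d n ` {t. R n t})" for n using d by (auto intro!: bdd_belowI)
  have T: "R n (T n) \<and> d n (T n) \<le> m n + inverse (real (Suc n))" if "\<exists>t. R n t" for n
  proof -
    have "d n ` {t. R n t} \<noteq> {}" using that by auto
    then have "\<exists>x\<in>d n ` {t. R n t}. x < m n + inverse (real (Suc n))"
      using cInf_lessD[of "d n ` {t. R n t}" "m n + inverse (real (Suc n))"] unfolding m_def by simp
    then have "\<exists>t. R n t \<and> d n t \<le> m n + inverse (real (Suc n))" by force
    then show ?thesis unfolding T_def by (rule someI_ex)
  qed
  have "\<forall>\<^sub>F n in sequentially. R n (T n)"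
    using assms(1)[of 1, OF zero_less_one] by eventually_elim (use T in blast)
  moreover have "(\<lambda>n. d n (T n)) \<longlonglongrightarrow> 0"
  proof (rule tendstoI)
    fix e :: real assume e: "e > 0"
    have "\<forall>\<^sub>F n in sequentially. inverse (real (Suc n)) < e/2"
      using order_tendstoD(2)[OF LIMSEQ_inverse_real_of_nat, of "e/2"] e by simp
    moreover have "\<forall>\<^sub>F n in sequentially. \<exists>t. R n t \<and> d n t \<le> e/3" using assms(1)[of "e/3"] e by simp
    ultimately show "\<forall>\<^sub>F n in sequentially. dist (d n (T n)) 0 < e"
    proof eventually_elim
      case (elim n)
      then obtain t where t: "R n t" "d n t \<le> e/3" by blast
      then have "m n \<le> e/3" unfolding m_def using bdd by (meson cINF_lower2 mem_Collect_eq)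
      moreover have "d n (T n) \<le> m n + inverse (real (Suc n))" using T t by blast
      ultimately have "d n (T n) < e" using elim(1) e by linarith
      then show ?case using d[of n "T n"] by (simp add: dist_real_def)
    qed
  qed
  ultimately show ?thesis using that by blast
qed

context nonlinearity begin

lemma isCont_E: "kap * z < 1 \<Longrightarrow> isCont E z" using E_deriv DERIV_isCont by blast
lemma isCont_E1: "kap * z < 1 \<Longrightarrow> isCont E1 z" using E1_deriv DERIV_isCont by blast

text \<open>A convex function minus a linear one is largest at an end point. In this form an
  estimate for \<open>ln Y\<close> at two depths extends to all depths between them.\<close>

lemma g_le_max:
  assumes "t0 < a" "a \<le> x" "x \<le> b"
  shows "g x - k * x \<le> max (g a - k * a) (g b - k * b)"
proof (cases "a = b")
  case False
  then have ab: "0 < b - a" using assms by simp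
  let ?m = "max (g a - k * a) (g b - k * b)"
  have "(g x - k * x - (g a - k * a)) * (b - a) \<le> ((g b - k * b) - (g a - k * a)) * (x - a)"
    using g_chord[OF assms] by (simp add: algebra_simps)
  also have "\<dots> \<le> (?m - (g a - k * a)) * (x - a)" using assms by (intro mult_right_mono) auto
  also have "\<dots> \<le> (?m - (g a - k * a)) * (b - a)" using assms by (intro mult_left_mono) auto
  finally show ?thesis using ab by simp
qed (use assms in auto)

end

section \<open>Uniform estimates at bounded scaled depth\<close>

context profiles begin

text \<open>Heights are measured from the top in units of \<open>y (mu n)\<close>; \<open>tau n z\<close> is the time at which the scaled depth is \<open>z\<close>
  (arbitrary if that depth is not reached).\<close>

definition G :: "nat \<Rightarrow> real" where "G n = g (mu n)"
definition ym :: "nat \<Rightarrow> real" where "ym n = y (mu n)"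
definition gm :: "nat \<Rightarrow> real" where "gm n = g1 (mu n)"
definition zz :: "nat \<Rightarrow> real \<Rightarrow> real" where "zz n t = (mu n - w n t) / ym n"
definition tau :: "nat \<Rightarrow> real \<Rightarrow> real" where
  "tau n z = (SOME t. 0 < t \<and> w n t = mu n - z * ym n)"

lemma filterlim_G: "filterlim G at_top sequentially"
  unfolding G_def[abs_def] by (rule filterlim_compose[OF filterlim_g mu_lim])

lemma ev_top: "\<forall>\<^sub>F n in sequentially. t0 < mu n \<and> 0 < G n \<and> 0 < ym n \<and> 0 < gm n \<and> ym n * gm n = G n"
  using eventually_compose_filterlim[OF eventually_gt_at_top[of t0] mu_lim]
    eventually_compose_filterlim[OF ev_g_gt[of 0] mu_lim]
proof eventually_elim
  case (elim n)
  then show ?case using g1_pos[of "mu n"] by (auto simp: G_def ym_def gm_def y_def)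
qed

lemma zz_level: "0 < ym n \<Longrightarrow> w n t = mu n - zz n t * ym n"
  by (simp add: zz_def)

lemma zz_nonneg: "0 < ym n \<Longrightarrow> 0 < t \<Longrightarrow> 0 \<le> zz n t"
  using w_le_mu[of t n] by (simp add: zz_def)

lemma level_lims:
  assumes z: "z \<longlonglongrightarrow> z0" and z0: "kap * z0 < 1" and nn: "\<forall>\<^sub>F n in sequentially. 0 \<le> z n"
  shows "(\<lambda>n. g (mu n - z n * ym n) / G n) \<longlonglongrightarrow> E z0"
    and "(\<lambda>n. g1 (mu n - z n * ym n) / gm n) \<longlonglongrightarrow> E1 z0"
    and "filterlim (\<lambda>n. mu n - z n * ym n) at_top sequentially"
  unfolding G_def gm_def ym_def
  by (rule ratio_tendsto[OF mu_lim assms] level_at_top[OF mu_lim z z0])+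

lemma time_lims:
  assumes z: "(\<lambda>n. zz n (T n)) \<longlonglongrightarrow> z0" and z0: "kap * z0 < 1" and T: "\<forall>\<^sub>F n in sequentially. 0 < T n"
  shows "(\<lambda>n. g (w n (T n)) / G n) \<longlonglongrightarrow> E z0"
    and "(\<lambda>n. g1 (w n (T n)) / gm n) \<longlonglongrightarrow> E1 z0"
    and "filterlim (\<lambda>n. w n (T n)) at_top sequentially"
proof -
  have nn: "\<forall>\<^sub>F n in sequentially. 0 \<le> zz n (T n)"
    using T ev_top by eventually_elim (use zz_nonneg in auto)
  have eq: "\<forall>\<^sub>F n in sequentially. mu n - zz n (T n) * ym n = w n (T n)"
    using ev_top by eventually_elim (use zz_level in auto)
  note L = level_lims[OF z z0 nn]
  have "\<forall>\<^sub>F n in sequentially. g (mu n - zz n (T n) * ym n) / G n = g (w n (T n)) / G n"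
    using eq by eventually_elim simp
  from tendsto_cong[OF this] L(1) show "(\<lambda>n. g (w n (T n)) / G n) \<longlonglongrightarrow> E z0" by simp
  have "\<forall>\<^sub>F n in sequentially. g1 (mu n - zz n (T n) * ym n) / gm n = g1 (w n (T n)) / gm n"
    using eq by eventually_elim simp
  from tendsto_cong[OF this] L(2) show "(\<lambda>n. g1 (w n (T n)) / gm n) \<longlonglongrightarrow> E1 z0" by simp
  show "filterlim (\<lambda>n. w n (T n)) at_top sequentially"
    by (rule filterlim_cong[OF refl refl eq, THEN iffD1, OF L(3)])
qed

lemma ev_tau:
  assumes "0 < z" "kap * z < 1"
  shows "\<forall>\<^sub>F n in sequentially. 0 < tau n z \<and> w n (tau n z) = mu n - z * ym n \<and> zz n (tau n z) = z \<and> t0 < w n (tau n z)"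
proof -
  have "filterlim (\<lambda>n. mu n - z * ym n) at_top sequentially"
    using level_lims(3)[of "\<lambda>_. z" z] assms by simp
  then have "\<forall>\<^sub>F n in sequentially. t0 < mu n - z * ym n" by (simp add: filterlim_at_top_dense)
  then show ?thesis using ev_top
  proof eventually_elim
    case (elim n)
    then have "0 < z * ym n" using assms by simp
    then have "\<exists>t. 0 < t \<and> w n t = mu n - z * ym n"
      using level_exists[of "mu n - z * ym n" n] elim t0_nonneg by auto
    then have "0 < tau n z \<and> w n (tau n z) = mu n - z * ym n"
      unfolding tau_def by (rule someI_ex)
    then show ?case using elim by (auto simp: zz_def)
  qed
qed

lemma tau_zz:
  assumes "0 < z" "kap * z < 1"
  shows "(\<lambda>n. zz n (tau n z)) \<longlonglongrightarrow> z" "\<forall>\<^sub>F n in sequentially. 0 < tau n z"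
proof -
  have "\<forall>\<^sub>F n in sequentially. zz n (tau n z) = z" using ev_tau[OF assms] by eventually_elim simp
  then show "(\<lambda>n. zz n (tau n z)) \<longlonglongrightarrow> z" by (simp add: tendsto_cong)
  show "\<forall>\<^sub>F n in sequentially. 0 < tau n z" using ev_tau[OF assms] by eventually_elim simp
qed

lemma tau_lims:
  assumes "0 < z" "kap * z < 1"
  shows "(\<lambda>n. g (w n (tau n z)) / G n) \<longlonglongrightarrow> E z"
    and "(\<lambda>n. g1 (w n (tau n z)) / gm n) \<longlonglongrightarrow> E1 z"
    and "filterlim (\<lambda>n. w n (tau n z)) at_top sequentially"
  using time_lims[OF tau_zz(1)[OF assms] assms(2) tau_zz(2)[OF assms]] .

lemma zz_antimono: "0 < ym n \<Longrightarrow> 0 < a \<Longrightarrow> a \<le> b \<Longrightarrow> zz n b \<le> zz n a"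
  using w_mono[of a b n] by (simp add: zz_def divide_right_mono)

lemma zz_less_imp: "0 < ym n \<Longrightarrow> 0 < a \<Longrightarrow> 0 < b \<Longrightarrow> zz n b < zz n a \<Longrightarrow> a < b"
  using zz_antimono[of n b a] by (meson leI not_less)

text \<open>\<open>P \<le> P0\<close> caps the slope at a slightly greater depth \<open>Z'\<close>,
  so climbing from \<open>Z'\<close> to \<open>Z\<close> takes a time at least of order
  \<open>G\<close>. Every time at depth at most \<open>Z\<close> is therefore that large, and
  \<open>exp (- t)\<close> is exponentially small in \<open>G\<close>.\<close>

lemma level_bounds:
  assumes Z: "0 \<le> Z" "kap * Z < 1"
  obtains C where "0 < C" "\<forall>\<^sub>F n in sequentially. \<forall>t. 0 < t \<longrightarrow> zz n t \<le> Z \<longrightarrow>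
     t0 < w n t \<and> gm n \<le> C * g1 (w n t) \<and> G n \<le> C * t \<and> eps (w n t) * G n \<le> C"
proof -
  obtain Z' where Z': "Z < Z'" "kap * Z' < 1" using kap_room[OF Z(2)] .
  have Z'0: "0 < Z'" using Z Z' by simp
  define C1 where "C1 = 2 / E1 Z'"
  define C2 where "C2 = P0 * C1 / (Z' - Z)"
  define C3 where "C3 = 4 / E Z'"
  have C: "0 < C1" "0 < C2" "0 < C3" using E1_pos[OF Z'(2)] P0_ge Z' by (auto simp: C1_def C2_def C3_def)
  have ev1: "\<forall>\<^sub>F n in sequentially. E1 Z' / 2 < g1 (w n (tau n Z')) / gm n"
    by (rule order_tendstoD[OF tau_lims(2)]) (use Z' Z'0 E1_pos[OF Z'(2)] in auto)
  have ev2: "\<forall>\<^sub>F n in sequentially. E Z' / 2 < g (w n (tau n Z')) / G n"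
    by (rule order_tendstoD[OF tau_lims(1)]) (use Z' Z'0 in auto)
  have "1/q < 2" using q_ge_1 by (auto simp: field_simps)
  then have "\<forall>\<^sub>F x in at_top. g x * eps x < 2" using order_tendstoD(2)[OF g_eps_lim] by blast
  then have "\<forall>\<^sub>F x in at_top. g x * eps x < 2 \<and> 0 < g x"
    using ev_g_gt[of 0] by eventually_elim auto
  from eventually_at_top_ge[OF this tau_lims(3)[OF Z'0 Z'(2)]]
  have ev3: "\<forall>\<^sub>F n in sequentially. \<forall>x\<ge>w n (tau n Z'). g x * eps x < 2 \<and> 0 < g x" .
  have main: "\<forall>\<^sub>F n in sequentially. \<forall>t. 0 < t \<longrightarrow> zz n t \<le> Z \<longrightarrow>
     t0 < w n t \<and> gm n \<le> C1 * g1 (w n t) \<and> G n \<le> C2 * t \<and> eps (w n t) * G n \<le> C3"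
    using ev1 ev2 ev3 ev_tau[OF Z'0 Z'(2)] ev_top
  proof eventually_elim
    case (elim n)
    show ?case
    proof (intro allI impI)
      fix t assume t: "0 < t" "zz n t \<le> Z"
      let ?x = "w n (tau n Z')" let ?t = "tau n Z'"
      have "zz n t < zz n ?t" using t elim Z' by simp
      then have lt: "?t < t" using zz_less_imp elim t by blast
      have xw: "?x \<le> w n t" using w_mono[of ?t t n] lt elim by simp
      have t0w: "t0 < w n t" using xw elim by simp
      have gmx: "gm n \<le> C1 * g1 ?x" using elim(1,5) E1_pos[OF Z'(2)] by (simp add: C1_def field_simps)
      also have "\<dots> \<le> C1 * g1 (w n t)" using C xw elim by (intro mult_left_mono g1_mono) auto
      finally have a: "gm n \<le> C1 * g1 (w n t)" .
      have g1x: "0 < g1 ?x" using g1_pos elim by blast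
      have "P n ?t \<le> P0" using P_le_P0 elim by blast
      then have "v n ?t \<le> P0 / g1 ?x" using g1x by (simp add: P_def field_simps)
      have "(Z' - Z) * ym n \<le> (Z' - zz n t) * ym n" using t elim by (intro mult_right_mono) auto
      also have "\<dots> = w n t - ?x" using elim zz_level[of n t] by (simp add: algebra_simps)
      also have "\<dots> \<le> v n ?t * (t - ?t)" by (rule w_diff) (use lt elim in auto)
      also have "\<dots> \<le> P0 / g1 ?x * t"
        by (intro mult_mono \<open>v n ?t \<le> P0 / g1 ?x\<close>) (use lt elim g1x P0_ge v_nonneg in auto)
      finally have "(Z' - Z) * ym n * g1 ?x \<le> P0 * t" using g1x by (simp add: field_simps)
      then have "(Z' - Z) * ym n * g1 ?x * C1 \<le> P0 * t * C1" using C by (intro mult_right_mono) auto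
      moreover have "(Z' - Z) * ym n * gm n \<le> (Z' - Z) * ym n * (C1 * g1 ?x)"
        using gmx Z' elim by (intro mult_left_mono) auto
      moreover have "(Z' - Z) * ym n * gm n = (Z' - Z) * G n" using elim by (metis mult.assoc)
      ultimately have "(Z' - Z) * G n \<le> P0 * C1 * t" by (simp add: algebra_simps)
      then have b: "G n \<le> C2 * t" using Z' by (simp add: C2_def field_simps)
      have gx: "G n \<le> 2 / E Z' * g ?x" using elim(2,5) by (simp add: field_simps)
      have "g ?x \<le> g (w n t)" using xw elim by (intro g_mono) auto
      then have "eps (w n t) * g ?x \<le> eps (w n t) * g (w n t)" using eps_pos[OF t0w] by simp
      also have "\<dots> \<le> 2" using elim(3) xw by (auto simp: mult.commute less_imp_le)
      finally have e2: "eps (w n t) * g ?x \<le> 2" .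
      have "eps (w n t) * G n \<le> eps (w n t) * (2 / E Z' * g ?x)"
        by (rule mult_left_mono[OF gx]) (use eps_pos[OF t0w] in simp)
      also have "\<dots> = 2 / E Z' * (eps (w n t) * g ?x)" by (simp only: mult_ac)
      also have "\<dots> \<le> 2 / E Z' * 2" using e2 by (intro mult_left_mono) (auto simp: less_imp_le)
      finally have c: "eps (w n t) * G n \<le> C3" by (simp add: C3_def)
      show "t0 < w n t \<and> gm n \<le> C1 * g1 (w n t) \<and> G n \<le> C2 * t \<and> eps (w n t) * G n \<le> C3"
        using t0w a b c by simp
    qed
  qed
  show ?thesis
  proof (rule that[of "max C1 (max C2 C3)"])
    show "\<forall>\<^sub>F n in sequentially. \<forall>t. 0 < t \<longrightarrow> zz n t \<le> Z \<longrightarrow> t0 < w n t \<and> gm n \<le> max C1 (max C2 C3) * g1 (w n t) \<and>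
        G n \<le> max C1 (max C2 C3) * t \<and> eps (w n t) * G n \<le> max C1 (max C2 C3)"
      using main
    proof eventually_elim
      case (elim n)
      show ?case
      proof (intro allI impI)
        fix t assume t: "0 < t" "zz n t \<le> Z"
        then have *: "t0 < w n t \<and> gm n \<le> C1 * g1 (w n t) \<and> G n \<le> C2 * t \<and> eps (w n t) * G n \<le> C3" using elim by blast
        then have "0 < g1 (w n t)" using g1_pos by blast
        then have "C1 * g1 (w n t) \<le> max C1 (max C2 C3) * g1 (w n t)" "C2 * t \<le> max C1 (max C2 C3) * t"
          using t by (auto intro!: mult_right_mono)
        then show "t0 < w n t \<and> gm n \<le> max C1 (max C2 C3) * g1 (w n t) \<and>
          G n \<le> max C1 (max C2 C3) * t \<and> eps (w n t) * G n \<le> max C1 (max C2 C3)"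
          using * by linarith
      qed
    qed
  qed (use C in auto)
qed

text \<open>By \<open>level_bounds\<close>, \<open>eps\<close> is at most of order
  \<open>1 / G\<close> and \<open>H\<close> is exponentially small in \<open>G\<close>.\<close>

lemma drift_small:
  assumes Z: "0 \<le> Z" "kap * Z < 1" and e: "0 < e"
  shows "\<forall>\<^sub>F n in sequentially. \<forall>t. 0 < t \<longrightarrow> zz n t \<le> Z \<longrightarrow>
     t0 < w n t \<and> \<bar>eps (w n t) * P n t + H t\<bar> \<le> e \<and> eps (w n t) \<le> e"
proof -
  obtain C where C: "0 < C" "\<forall>\<^sub>F n in sequentially. \<forall>t. 0 < t \<longrightarrow> zz n t \<le> Z \<longrightarrow>
     t0 < w n t \<and> gm n \<le> C * g1 (w n t) \<and> G n \<le> C * t \<and> eps (w n t) * G n \<le> C"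
    using level_bounds[OF Z] .
  have l1: "((\<lambda>x. C * P0 / x) \<longlongrightarrow> 0) at_top" and l2: "((\<lambda>x. C / x) \<longlongrightarrow> 0) at_top"
    by (intro tendsto_divide_0[OF tendsto_const] filterlim_at_top_imp_at_infinity filterlim_ident)+
  have l3: "((\<lambda>x. Hb * exp (- (1/C * x))) \<longlongrightarrow> Hb * 0) at_top"
  proof -
    have "filterlim (\<lambda>x. 1/C * x) at_top at_top"
      by (rule filterlim_tendsto_pos_mult_at_top[OF tendsto_const _ filterlim_ident]) (use C in auto)
    then have "filterlim (\<lambda>x. - (1/C * x)) at_bot at_top"
      by (simp only: filterlim_uminus_at_bot minus_minus)
    then show ?thesis by (intro tendsto_mult tendsto_const filterlim_compose[OF exp_at_bot])
  qed
  have "\<forall>\<^sub>F x in at_top. C * P0 / x < e/2" by (rule order_tendstoD(2)[OF l1]) (use e in simp)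
  moreover have "\<forall>\<^sub>F x in at_top. C / x < e" by (rule order_tendstoD(2)[OF l2 e])
  moreover have "\<forall>\<^sub>F x in at_top. Hb * exp (- (1/C * x)) < e/2" by (rule order_tendstoD(2)[OF l3]) (use e in simp)
  ultimately have "\<forall>\<^sub>F x in at_top. C * P0 / x < e/2 \<and> C / x < e \<and> Hb * exp (- (1/C * x)) < e/2"
    by eventually_elim auto
  from eventually_compose_filterlim[OF this filterlim_G] ev_top C(2)
  show ?thesis
  proof eventually_elim
    case (elim n)
    show ?case
    proof (intro allI impI)
      fix t assume t: "0 < t" "zz n t \<le> Z"
      then have *: "t0 < w n t" "G n \<le> C * t" "eps (w n t) * G n \<le> C" using elim by auto
      have e1: "eps (w n t) \<le> C / G n" using * elim by (simp add: field_simps)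
      have p: "0 < P n t" "P n t \<le> P0" using P_pos P_le_P0 t * by auto
      have "eps (w n t) * P n t \<le> C / G n * P0"
        using e1 p eps_pos[OF *(1)] C elim by (intro mult_mono) auto
      moreover have "C * P0 / G n < e/2" "Hb * exp (- (1/C * G n)) < e/2" "C / G n < e" using elim(1) by blast+
      moreover have "C / G n * P0 = C * P0 / G n" by simp
      ultimately have 1: "eps (w n t) * P n t < e/2" by linarith
      have "exp (- t) \<le> exp (- (1/C * G n))" using *(2) C by (simp add: field_simps)
      then have "Hb * exp (- t) \<le> Hb * exp (- (1/C * G n))" using Hb_nonneg by (rule mult_left_mono)
      then have "\<bar>H t\<bar> < e/2" using H_bound[OF t(1)] \<open>Hb * exp (- (1/C * G n)) < e/2\<close> by linarith
      then show "t0 < w n t \<and> \<bar>eps (w n t) * P n t + H t\<bar> \<le> e \<and> eps (w n t) \<le> e"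
        using 1 epsP_nonneg[OF t(1) *(1)] *(1) e1 \<open>C / G n < e\<close> by linarith
    qed
  qed
qed

text \<open>The \<eta>-terms of \<open>Q_var\<close> vanish in the limit. The term with
  \<open>AQ\<close> does not, since \<open>ln (g1 w)\<close> changes by a fixed amount over a fixed
  depth; it becomes small only between nearby depths.\<close>

lemma Q_cont:
  assumes Z: "0 \<le> Z" "kap * Z < 1" and e: "0 < e"
  shows "\<forall>\<^sub>F n in sequentially. \<forall>a b. 0 < a \<longrightarrow> a \<le> b \<longrightarrow> zz n a \<le> Z \<longrightarrow>
     \<bar>Q n b - Q n a\<bar> \<le> AQ * (ln (g1 (w n b)) - ln (g1 (w n a))) + e"
proof -
  obtain C where C: "0 < C" "\<forall>\<^sub>F n in sequentially. \<forall>t. 0 < t \<longrightarrow> zz n t \<le> Z \<longrightarrow>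
     t0 < w n t \<and> gm n \<le> C * g1 (w n t) \<and> G n \<le> C * t \<and> eps (w n t) * G n \<le> C"
    using level_bounds[OF Z] .
  define K where "K = P0 * \<bar>ln C\<bar> + P0"
  have K: "0 < K" using P0_ge by (auto simp: K_def intro!: add_nonneg_pos)
  define \<eta> where "\<eta> = e / K"
  have \<eta>: "0 < \<eta>" "\<eta> * K = e" using K e by (auto simp: \<eta>_def)
  show ?thesis using drift_small[OF Z \<eta>(1)] ev_top C(2)
  proof eventually_elim
    case (elim n)
    show ?case
    proof (intro allI impI)
      fix a b assume ab: "0 < a" "a \<le> b" "zz n a \<le> Z"
      have r: "0 < s \<and> zz n s \<le> Z" if "a \<le> s" for s
        using that ab zz_antimono[of n a s] elim by auto
      have ra: "t0 < w n a" and rb: "0 < b" "t0 < w n b" using elim(1) r[of a] r[of b] ab by auto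
      have p: "0 < g1 (w n a)" "0 < g1 (w n b)" using g1_pos ra rb by auto
      have "g1 (w n b) \<le> gm n" unfolding gm_def using rb w_le_mu[of b n] by (intro g1_mono) auto
      also have "gm n \<le> C * g1 (w n a)" using elim(3) ab by blast
      finally have "ln (g1 (w n b)) \<le> ln (C * g1 (w n a))" using p by simp
      also have "\<dots> = ln C + ln (g1 (w n a))" using C p by (simp add: ln_mult)
      finally have L: "ln (g1 (w n b)) - ln (g1 (w n a)) \<le> \<bar>ln C\<bar>" by simp
      have "\<bar>Q n b - Q n a\<bar> \<le> (AQ + \<eta> * P0) * (ln (g1 (w n b)) - ln (g1 (w n a))) + \<eta> * P0"
        by (rule Q_var[OF ab(1,2) ra]) (use elim(1) r in blast)
      also have "\<dots> = AQ * (ln (g1 (w n b)) - ln (g1 (w n a))) + \<eta> * (P0 * (ln (g1 (w n b)) - ln (g1 (w n a))) + P0)"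
        by (simp add: algebra_simps)
      also have "\<eta> * (P0 * (ln (g1 (w n b)) - ln (g1 (w n a))) + P0) \<le> \<eta> * K"
        unfolding K_def using \<eta> L P0_ge by (intro mult_left_mono add_right_mono) auto
      also have "\<eta> * K = e" by (rule \<eta>(2))
      finally show "\<bar>Q n b - Q n a\<bar> \<le> AQ * (ln (g1 (w n b)) - ln (g1 (w n a))) + e" by simp
    qed
  qed
qed

text \<open>At infinity \<open>P\<close> and \<open>Y\<close> vanish, so the energy starts from the
  value 2.\<close>

lemma Q_cont_inf:
  assumes Z: "0 \<le> Z" "kap * Z < 1" and e: "0 < e"
  shows "\<forall>\<^sub>F n in sequentially. \<forall>a. 0 < a \<longrightarrow> zz n a \<le> Z \<longrightarrow>
     \<bar>2 - Q n a\<bar> \<le> AQ * (ln (gm n) - ln (g1 (w n a))) + e"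
  using Q_cont[OF assms] ev_top
proof eventually_elim
  case (elim n)
  show ?case
  proof (intro allI impI)
    fix a assume a: "0 < a" "zz n a \<le> Z"
    have mu: "t0 < mu n" using elim by simp
    have "((\<lambda>b. (P n b - 2)\<^sup>2 / 2 + Y n b) \<longlongrightarrow> (0 - 2)\<^sup>2 / 2 + 0) at_top"
      by (intro tendsto_intros P_lim Y_lim mu) simp
    then have "((\<lambda>b. Q n b) \<longlongrightarrow> 2) at_top" unfolding Q_def by simp
    then have L: "((\<lambda>b. \<bar>Q n b - Q n a\<bar>) \<longlongrightarrow> \<bar>2 - Q n a\<bar>) at_top" by (intro tendsto_intros)
    have R: "((\<lambda>b. AQ * (ln (g1 (w n b)) - ln (g1 (w n a))) + e) \<longlongrightarrow> AQ * (ln (gm n) - ln (g1 (w n a))) + e) at_top"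
      unfolding gm_def using g1_pos[OF mu] by (intro tendsto_intros g1w_lim mu) auto
    show "\<bar>2 - Q n a\<bar> \<le> AQ * (ln (gm n) - ln (g1 (w n a))) + e"
    proof (rule tendsto_le[OF _ R L])
      show "\<forall>\<^sub>F b in at_top. \<bar>Q n b - Q n a\<bar> \<le> AQ * (ln (g1 (w n b)) - ln (g1 (w n a))) + e"
        using eventually_ge_at_top[of a] by eventually_elim (use elim(1) a in blast)
    qed simp
  qed
qed

lemma tau_less:
  assumes "0 < z1" "z1 < z2" "kap * z2 < 1"
  shows "\<forall>\<^sub>F n in sequentially. tau n z2 < tau n z1"
proof -
  have "0 < z2" "kap * z1 < 1" using assms kap_mult_less[of z1 z2] by auto
  from ev_tau[OF assms(1) this(2)] ev_tau[OF this(1) assms(3)] ev_top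
  show ?thesis
  proof eventually_elim
    case (elim n)
    then show ?case using zz_less_imp[of n "tau n z2" "tau n z1"] assms by simp
  qed
qed

text \<open>Between two fixed depths the elapsed time is at least of order \<open>G\<close> while
  the integral of \<open>Y\<close> stays bounded, so \<open>Y\<close> is at most a multiple of
  \<open>1 / G\<close> somewhere.\<close>

lemma Y_small_between:
  assumes z: "0 < z1" "z1 < z2" "kap * z2 < 1" and e: "0 < e"
  shows "\<forall>\<^sub>F n in sequentially. \<exists>x. tau n z2 < x \<and> x < tau n z1 \<and> Y n x \<le> e"
proof -
  have z2: "0 < z2" "0 \<le> z2" and kz1: "kap * z1 < 1" using z kap_mult_less[of z1 z2] by auto
  obtain C where C: "0 < C" "\<forall>\<^sub>F n in sequentially. \<forall>t. 0 < t \<longrightarrow> zz n t \<le> z2 \<longrightarrow>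
     t0 < w n t \<and> gm n \<le> C * g1 (w n t) \<and> G n \<le> C * t \<and> eps (w n t) * G n \<le> C"
    using level_bounds[OF z2(2) z(3)] .
  define K where "K = (P0 * \<bar>ln C\<bar> + P0) * P0 * C / (z2 - z1)"
  have "((\<lambda>x. K / x) \<longlongrightarrow> 0) at_top"
    by (intro tendsto_divide_0[OF tendsto_const] filterlim_at_top_imp_at_infinity filterlim_ident)
  then have "\<forall>\<^sub>F x in at_top. K / x < e" using e by (rule order_tendstoD)
  from eventually_compose_filterlim[OF this filterlim_G] C(2) ev_top ev_tau[OF z(1) kz1] ev_tau[OF z2(1) z(3)] tau_less[OF z]
  show ?thesis
  proof eventually_elim
    case (elim n)
    define a where "a = tau n z2" define b where "b = tau n z1"
    have ab: "0 < a" "a < b" "t0 < w n a" "0 < b" "t0 < w n b" using elim by (auto simp: a_def b_def)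
    have p: "0 < g1 (w n a)" "0 < g1 (w n b)" using g1_pos ab by auto
    have gC: "gm n \<le> C * g1 (w n a)" using elim(2,5) by (auto simp: a_def)
    obtain x where x: "a < x" "x < b"
      "Y n x * (b - a) \<le> P0 * (ln (g1 (w n b)) - ln (g1 (w n a))) + P0"
      using Y_small_point[OF ab(1,2,3)] .
    have "g1 (w n b) \<le> gm n" unfolding gm_def using ab w_le_mu[of b n] by (intro g1_mono) auto
    then have "ln (g1 (w n b)) \<le> ln (C * g1 (w n a))" using p gC by simp
    also have "\<dots> = ln C + ln (g1 (w n a))" using C p by (simp add: ln_mult)
    finally have L: "ln (g1 (w n b)) - ln (g1 (w n a)) \<le> \<bar>ln C\<bar>" by simp
    have "P0 * (ln (g1 (w n b)) - ln (g1 (w n a))) \<le> P0 * \<bar>ln C\<bar>" using L P0_ge by (intro mult_left_mono) auto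
    then have Y1: "Y n x * (b - a) \<le> P0 * \<bar>ln C\<bar> + P0" using x by linarith
    have "P n a \<le> P0" using P_le_P0 ab by blast
    then have "v n a \<le> P0 / g1 (w n a)" using p by (simp add: P_def field_simps)
    have "(z2 - z1) * ym n = w n b - w n a" using elim by (simp add: a_def b_def algebra_simps)
    also have "\<dots> \<le> v n a * (b - a)" by (rule w_diff) (use ab in auto)
    also have "\<dots> \<le> P0 / g1 (w n a) * (b - a)" using \<open>v n a \<le> P0 / g1 (w n a)\<close> ab by (intro mult_right_mono) auto
    finally have A: "(z2 - z1) * ym n * g1 (w n a) \<le> P0 * (b - a)" using p by (simp add: field_simps)
    have "(z2 - z1) * G n = (z2 - z1) * ym n * gm n" using elim by (metis mult.assoc)
    also have "\<dots> \<le> (z2 - z1) * ym n * (C * g1 (w n a))" using gC z elim by (intro mult_left_mono) auto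
    also have "\<dots> = C * ((z2 - z1) * ym n * g1 (w n a))" by simp
    also have "\<dots> \<le> C * (P0 * (b - a))" using A C by (intro mult_left_mono) auto
    finally have B: "(z2 - z1) * G n \<le> P0 * C * (b - a)" by (simp only: mult_ac)
    have Yp: "0 < Y n x" using Y_pos[of x n] region_up[of a x n] ab x by auto
    have "Y n x * ((z2 - z1) * G n) \<le> Y n x * (P0 * C * (b - a))" using B Yp by (intro mult_left_mono) auto
    also have "\<dots> = P0 * C * (Y n x * (b - a))" by simp
    also have "\<dots> \<le> P0 * C * (P0 * \<bar>ln C\<bar> + P0)" using Y1 C P0_ge by (intro mult_left_mono) auto
    finally have "Y n x * ((z2 - z1) * G n) \<le> P0 * C * (P0 * \<bar>ln C\<bar> + P0)" .
    then have "Y n x \<le> K / G n" using elim z by (simp add: K_def field_simps)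
    then show ?case using x elim unfolding a_def b_def by (intro exI[of _ x]) auto
  qed
qed

text \<open>Peaks are located by \<open>P = 2\<close> rather than by a maximum of \<open>Y\<close>:
  such times are supplied by the intermediate value theorem, and the energy there is exactly
  \<open>Y\<close>.\<close>

definition bubble :: "real \<Rightarrow> real \<Rightarrow> bool" where
  "bubble s a \<longleftrightarrow> (\<exists>T. (\<forall>\<^sub>F n in sequentially. 0 < T n \<and> P n (T n) = 2) \<and>
     (\<lambda>n. zz n (T n)) \<longlonglongrightarrow> s \<and> (\<lambda>n. Y n (T n)) \<longlonglongrightarrow> a\<^sup>2 / 2)"

section \<open>The peak at scaled depth 0\<close>

lemma Q_P2: "P n t = 2 \<Longrightarrow> Q n t = Y n t" by (simp add: Q_def)

lemma P_mono_bound: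
  assumes "0 < a" "a \<le> b" "t0 < w n a"
  shows "P n b \<le> P n a * (g1 (w n b) / g1 (w n a))"
proof -
  have "0 < g1 (w n a)" "0 < g1 (w n b)" using g1_pos region_up assms by auto
  then have "P n b \<le> g1 (w n b) * v n a" unfolding P_def using v_antimono[OF assms(1,2)] by simp
  also have "\<dots> = P n a * (g1 (w n b) / g1 (w n a))" using \<open>0 < g1 (w n a)\<close> by (simp add: P_def)
  finally show ?thesis .
qed

text \<open>If \<open>P\<close> never equalled 2 down to depth \<open>d\<close>, it would stay below
  2 there. At a point with \<open>Y\<close> small, energy near 2 forces \<open>P\<close> near 0, and
  \<open>base_level\<close> then puts the point at depth of order \<open>1 / G\<close>, although it
  was chosen deeper than \<open>d / 2\<close>.\<close>

lemma first_bubble_near: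
  assumes "0 < \<delta>"
  shows "\<forall>\<^sub>F n in sequentially. \<exists>t. (0 < t \<and> P n t = 2) \<and> \<bar>zz n t\<bar> \<le> \<delta>"
proof -
  \<comment> \<open>Small enough that \<open>4 - 6 * e\<close> exceeds the square of
    \<open>19/10\<close>, whence \<open>P \<le> 1/10\<close>; as \<open>g1\<close> varies by at most
    a factor 2, \<open>P\<close> then remains below \<open>1/2\<close>.\<close>
  define e where "e = (1/50::real)"
  have k0: "kap * 0 < 1" by simp
  have "((\<lambda>d. AQ * (- ln (E1 d))) \<longlongrightarrow> AQ * (- ln (E1 0))) (at_right 0)"
    by (intro tendsto_intros isCont_tendsto_compose[OF isCont_E1]) auto
  then have 1: "\<forall>\<^sub>F d in at_right 0. AQ * (- ln (E1 d)) < e" by (rule order_tendstoD) (simp add: e_def)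
  have "(E1 \<longlongrightarrow> E1 0) (at_right 0)"
    using isCont_E1[OF k0] by (simp add: continuous_within filterlim_at_split isCont_def)
  then have 2: "\<forall>\<^sub>F d in at_right 0. 1/2 < E1 d" by (rule order_tendstoD) simp
  obtain Z where Z: "0 < Z" "kap * Z < 1" using kap_room[OF k0] .
  have 3: "\<forall>\<^sub>F d in at_right 0. d < min \<delta> Z" by (rule order_tendstoD(2)[OF tendsto_ident_at]) (use assms Z in simp)
  have 4: "\<forall>\<^sub>F d in at_right (0::real). 0 < d" by (rule eventually_at_right_less)
  have "\<forall>\<^sub>F d in at_right 0. AQ * (- ln (E1 d)) < e \<and> 1/2 < E1 d \<and> d < min \<delta> Z \<and> 0 < d"
    using 1 2 3 4 by eventually_elim auto
  then obtain d where d: "AQ * (- ln (E1 d)) < e" "1/2 < E1 d" "d < \<delta>" "d < Z" "0 < d"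
    using eventually_happens[of _ "at_right (0::real)"] by auto
  have kd: "kap * d < 1" "0 \<le> d" using kap_mult_less[of d Z] Z d by auto
  have e0: "0 < e" and half: "0 < (1/2::real)" by (simp_all add: e_def)
  have l1: "(\<lambda>n. g1 (w n (tau n d)) / gm n) \<longlonglongrightarrow> E1 d" by (rule tau_lims(2)) (use d kd in auto)
  then have ev1: "\<forall>\<^sub>F n in sequentially. 1/2 < g1 (w n (tau n d)) / gm n" by (rule order_tendstoD) (use d in auto)
  have "(\<lambda>n. AQ * (- ln (g1 (w n (tau n d)) / gm n))) \<longlonglongrightarrow> AQ * (- ln (E1 d))"
    using d by (intro tendsto_intros l1) auto
  then have ev2: "\<forall>\<^sub>F n in sequentially. AQ * (- ln (g1 (w n (tau n d)) / gm n)) < e" by (rule order_tendstoD) (rule d)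
  have "((\<lambda>x. 2 * e / x) \<longlongrightarrow> 0) at_top"
    by (intro tendsto_divide_0[OF tendsto_const] filterlim_at_top_imp_at_infinity filterlim_ident)
  then have "\<forall>\<^sub>F x in at_top. 2 * e / x < d/2" using d by (intro order_tendstoD(2)) auto
  from eventually_compose_filterlim[OF this filterlim_G]
  have ev3: "\<forall>\<^sub>F n in sequentially. 2 * e / G n < d/2" .
  have d2: "0 < d/2" "d/2 < d" "kap * (d/2) < 1" using d kap_mult_less[of "d/2" d] kd by auto
  have ev4: "\<forall>\<^sub>F n in sequentially. \<exists>x. tau n d < x \<and> x < tau n (d/2) \<and> Y n x \<le> e"
    by (rule Y_small_between) (use d2 kd e0 in auto)
  show ?thesis
    using ev1 ev2 ev3 ev4 Q_cont_inf[OF kd(2,1) e0] drift_small[OF kd(2,1) half] ev_tau[OF d(5) kd(1)]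
      ev_tau[OF d2(1,3)] ev_top
  proof eventually_elim
    case (elim n)
    show ?case
    proof (rule ccontr)
      assume no: "\<not> ?thesis"
      define a where "a = tau n d"
      have a: "0 < a" "t0 < w n a" "zz n a = d" using elim by (auto simp: a_def)
      have r: "0 < s" "zz n s \<le> d" "t0 < w n s" "0 \<le> zz n s" if "a \<le> s" for s
        using that a zz_antimono[of n a s] elim region_up[of a s n] zz_nonneg[of n s] by auto
      have ne: "P n s \<noteq> 2" if "a \<le> s" for s
        using no r[OF that] d by auto
      have lt: "P n s < 2" if s: "a \<le> s" for s
      proof (rule ccontr)
        assume "\<not> P n s < 2"
        then have ge: "2 \<le> P n s" by simp
        have "\<forall>\<^sub>F b in at_top. P n b < 2" using P_lim[of n] elim by (intro order_tendstoD(2)) auto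
        then obtain b where b: "b \<ge> s" "P n b < 2"
          by (metis (full_types) eventually_at_top_linorder linorder_le_cases order_refl)
        have "\<exists>x\<ge>s. x \<le> b \<and> P n x = 2"
          by (rule IVT2') (use b ge continuous_on_P[OF r(1,3)[OF s]] in auto)
        then show False using ne s by force
      qed
      obtain x where x: "a < x" "x < tau n (d/2)" "Y n x \<le> e" using elim(4) by (auto simp: a_def)
      have ax: "a \<le> x" using x by simp
      note rx = r[OF ax]
      have gp: "0 < g1 (w n a)" "0 < g1 (w n x)" "0 < gm n" using g1_pos a rx elim by auto
      have gax: "g1 (w n a) \<le> g1 (w n x)" using a w_mono[OF a(1) ax] by (intro g1_mono) auto
      have "\<bar>2 - Q n x\<bar> \<le> AQ * (ln (gm n) - ln (g1 (w n x))) + e" using elim(5) rx by blast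
      also have "AQ * (ln (gm n) - ln (g1 (w n x))) \<le> AQ * (ln (gm n) - ln (g1 (w n a)))"
        using gax gp P0_ge by (intro mult_left_mono) (auto simp: AQ_def)
      also have "ln (gm n) - ln (g1 (w n a)) = - ln (g1 (w n a) / gm n)" using gp by (simp add: ln_div)
      also have "AQ * (- ln (g1 (w n a) / gm n)) < e" using elim(2) by (simp add: a_def)
      finally have "2 - 2 * e \<le> Q n x" by simp
      then have "4 - 6 * e \<le> (2 - P n x)\<^sup>2" using x(3) by (simp add: Q_def power2_commute[of 2])
      then have "(19/10)\<^sup>2 \<le> (2 - P n x)\<^sup>2" by (simp add: e_def power2_eq_square)
      then have "19/10 \<le> 2 - P n x" using lt[OF ax] by (intro power2_le_imp_le[of "19/10"]) auto
      then have Px: "P n x \<le> 1/10" by simp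
      have gmx: "gm n \<le> 2 * g1 (w n x)" using elim(1) gax gp by (simp add: a_def field_simps)
      have "mu n \<le> w n x + Y n x / g1 (w n x)"
      proof (rule base_level[OF rx(1,3)])
        fix s assume s: "x \<le> s"
        then have rs: "0 < s" "zz n s \<le> d" "t0 < w n s" using r[of s] x by auto
        have "g1 (w n s) \<le> gm n" unfolding gm_def using rs w_le_mu[of s n] by (intro g1_mono) auto
        then have q2: "g1 (w n s) / g1 (w n x) \<le> 2" using gmx gp by (simp add: field_simps)
        have "P n s \<le> P n x * (g1 (w n s) / g1 (w n x))" by (rule P_mono_bound[OF rx(1) s rx(3)])
        also have "\<dots> \<le> 1/10 * 2" using Px q2 gp g1_pos[OF rs(3)] P_pos[OF rx(1,3)]
          by (intro mult_mono) auto
        finally have "P n s \<le> 1/2" by simp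
        moreover have "\<bar>eps (w n s) * P n s + H s\<bar> \<le> 1/2" using elim(6) rs by simp
        ultimately show "P n s \<le> 1/2 \<and> eps (w n s) * P n s + H s \<le> 1/2" by linarith
      qed
      then have "zz n x * ym n \<le> Y n x / g1 (w n x)" using elim by (simp add: zz_def)
      also have "\<dots> \<le> e / (gm n / 2)" using x(3) gmx gp e0 by (intro frac_le) auto
      finally have "zz n x * (ym n * gm n) \<le> 2 * e" using gp by (simp add: field_simps)
      then have "zz n x * G n \<le> 2 * e" using elim(9) by metis
      then have "zz n x \<le> 2 * e / G n" using elim(9) by (simp add: pos_le_divide_eq)
      then have "zz n x < d/2" using elim by simp
      moreover have "zz n (tau n (d/2)) \<le> zz n x" using x rx elim by (intro zz_antimono) auto
      ultimately show False using elim by simp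
    qed
  qed
qed

text \<open>The energy at the peak is \<open>Y\<close>, and as the depth tends to 0 it keeps its
  starting value \<open>2 = 2\<^sup>2 / 2\<close>.\<close>

lemma bubble_0: "bubble 0 2"
proof -
  obtain T where T: "\<forall>\<^sub>F n in sequentially. 0 < T n \<and> P n (T n) = 2" "(\<lambda>n. \<bar>zz n (T n)\<bar>) \<longlonglongrightarrow> 0"
    using choose_sequence[where R = "\<lambda>n t. 0 < t \<and> P n t = 2" and d = "\<lambda>n t. \<bar>zz n t\<bar>", OF first_bubble_near]
    by (metis abs_ge_zero)
  have zT: "(\<lambda>n. zz n (T n)) \<longlonglongrightarrow> 0" using T(2) by (simp add: tendsto_rabs_zero_iff)
  have Tpos: "\<forall>\<^sub>F n in sequentially. 0 < T n" using T(1) by eventually_elim auto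
  have k0: "kap * 0 < 1" by simp
  obtain Z where Z: "0 < Z" "kap * Z < 1" using kap_room[OF k0] .
  have l: "(\<lambda>n. AQ * (- ln (g1 (w n (T n)) / gm n))) \<longlonglongrightarrow> AQ * (- ln (E1 0))"
    by (intro tendsto_intros time_lims(2)[OF zT k0 Tpos]) auto
  have "(\<lambda>n. Y n (T n)) \<longlonglongrightarrow> 2"
  proof (rule tendstoI)
    fix e :: real assume e: "0 < e"
    have ev1: "\<forall>\<^sub>F n in sequentially. AQ * (- ln (g1 (w n (T n)) / gm n)) < e/2"
      by (rule order_tendstoD(2)[OF l]) (use e in simp)
    have ev2: "\<forall>\<^sub>F n in sequentially. zz n (T n) < Z" by (rule order_tendstoD(2)[OF zT Z(1)])
    have e3: "0 < e/3" using e by simp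
    show "\<forall>\<^sub>F n in sequentially. dist (Y n (T n)) 2 < e"
      using ev1 ev2 Q_cont_inf[OF less_imp_le[OF Z(1)] Z(2) e3] T(1) ev_top drift_small[OF less_imp_le[OF Z(1)] Z(2) e3]
    proof eventually_elim
      case (elim n)
      then have "t0 < w n (T n)" by auto
      then have gp: "0 < g1 (w n (T n))" "0 < gm n" using g1_pos elim by auto
      have "\<bar>2 - Q n (T n)\<bar> \<le> AQ * (ln (gm n) - ln (g1 (w n (T n)))) + e/3" using elim by simp
      also have "ln (gm n) - ln (g1 (w n (T n))) = - ln (g1 (w n (T n)) / gm n)" using gp by (simp add: ln_div)
      finally have "\<bar>2 - Q n (T n)\<bar> < e" using elim(1) e by linarith
      then show ?case using elim Q_P2[of n "T n"] by (simp add: dist_real_def abs_minus_commute)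
    qed
  qed
  then show ?thesis unfolding bubble_def using T(1) zT by (intro exI[of _ T]) auto
qed

section \<open>From one peak to the next\<close>

text \<open>Between \<open>t\<close> and \<open>b\<close> the slope is at least
  \<open>v n b\<close>, so the elapsed time is at most the height difference over
  \<open>v n b\<close>.\<close>

lemma ln_Y_upper:
  assumes "0 < t" "t \<le> b" "t0 < w n t"
  shows "ln (Y n t) \<le> ln (Y n b) + CH + (g (w n t) - g (w n b)) + 2 * ((w n b - w n t) / v n b)"
proof -
  have b: "0 < b" "t0 < w n b" using assms region_up[of t b n] by auto
  have vb: "0 < v n b" using v_pos b by blast
  have "v n b * (b - t) \<le> w n b - w n t" using w_diff(1)[OF assms(1,2)] .
  then have 1: "b - t \<le> (w n b - w n t) / v n b" using vb by (simp add: field_simps)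
  have "g1 (w n t) \<le> g1 (w n b)" using assms w_mono[of t b n] by (intro g1_mono) auto
  then have 2: "ln (g1 (w n t)) \<le> ln (g1 (w n b))" using g1_pos[OF assms(3)] by simp
  show ?thesis unfolding ln_Y[OF assms(1,3)] ln_Y[OF b]
    using 1 2 ln_hh_diff[OF assms(1) b(1)] by linarith
qed

text \<open>Here the slope is at most \<open>v n t\<close>, its value at the deeper end, which
  bounds the elapsed time from below.\<close>

lemma ln_Y_lower:
  assumes "0 < t" "t \<le> b" "t0 < w n t"
  shows "ln (Y n b) - CH + (ln (g1 (w n t)) - ln (g1 (w n b))) + (g (w n t) - g (w n b)) + 2 * ((w n b - w n t) / v n t) \<le> ln (Y n t)"
proof -
  have b: "0 < b" "t0 < w n b" using assms region_up[of t b n] by auto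
  have vt: "0 < v n t" using v_pos assms by blast
  have "w n b - w n t \<le> v n t * (b - t)" using w_diff(2)[OF assms(1,2)] .
  then have 1: "(w n b - w n t) / v n t \<le> b - t" using vt by (simp add: field_simps)
  show ?thesis unfolding ln_Y[OF assms(1,3)] ln_Y[OF b]
    using 1 ln_hh_diff[OF assms(1) b(1)] by linarith
qed

lemma ym_div:
  assumes "0 < gm n" "ym n * gm n = G n"
  shows "c * ym n / x = c * G n / (gm n * x)"
  using assms(1) unfolding assms(2)[symmetric] by simp

lemma Y0_ge_1: "1 \<le> Y0"
proof -
  have "1 * 1 \<le> (2 + Hb) * P0" using P0_ge Hb_nonneg by (intro mult_mono) auto
  then show ?thesis by (simp add: Y0_def)
qed

lemma ev_const_div_G: "0 < e \<Longrightarrow> \<forall>\<^sub>F n in sequentially. C / G n < e"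
  by (rule order_tendstoD(2)[OF tendsto_divide_0[OF tendsto_const filterlim_at_top_imp_at_infinity[OF filterlim_G]]])

end

text \<open>\<open>S\<close> is the scaled slope just below a peak, where \<open>P\<close> has been
  reflected to \<open>2 + a\<close>. The assumption \<open>root\<close> says that
  \<open>ln Y\<close>, on the scale of \<open>G\<close>, is back at 0 at depth \<open>s'\<close> if
  the profile is linear in between.\<close>

locale bubble_step = profiles +
  fixes T :: "nat \<Rightarrow> real" and s a s' S :: real
  assumes T: "\<forall>\<^sub>F n in sequentially. 0 < T n \<and> P n (T n) = 2"
    and zT: "(\<lambda>n. zz n (T n)) \<longlonglongrightarrow> s" and YT: "(\<lambda>n. Y n (T n)) \<longlonglongrightarrow> a\<^sup>2 / 2"
    and s: "0 \<le> s" "s < s'" "kap * s' < 1" and a_pos: "0 < a"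
    and S_def: "S * E1 s = 2 + a" and root: "E s' - E s + 2 * (s' - s) / S = 0"
begin

text \<open>\<open>bet z\<close> is the limit of \<open>ln Y / G\<close> at depth \<open>z\<close> if the scaled slope is \<open>S\<close>.\<close>

definition bet :: "real \<Rightarrow> real" where "bet z = E z - E s + 2 * (z - s) / S"
definition Sn :: "nat \<Rightarrow> real \<Rightarrow> real" where "Sn n z = gm n * v n (tau n z)"
text \<open>The limiting change of energy that \<open>Q_cont\<close> allows between depths
  \<open>s\<close> and \<open>s + d\<close>.\<close>

definition D :: "real \<Rightarrow> real" where "D d = AQ * (ln (E1 s) - ln (E1 (s + d)))"

lemma ks: "kap * s < 1" using s kap_mult_less[of s s'] by simp
lemma S_pos: "0 < S"
  using S_def E1_pos[OF ks] a_pos by (metis add_pos_pos zero_less_mult_pos2 zero_less_numeral)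
lemma S_eq: "S = (2 + a) / E1 s" using S_def E1_pos[OF ks] by (simp add: field_simps)

lemma Tpos: "\<forall>\<^sub>F n in sequentially. 0 < T n" using T by eventually_elim auto

lemma bet_deriv: "kap * z < 1 \<Longrightarrow> (bet has_real_derivative 2 / S - E1 z) (at z)"
  unfolding bet_def[abs_def] using S_pos by (auto intro!: derivative_eq_intros E_deriv)

lemma bet_root: "bet s = 0" "bet s' = 0" using root by (auto simp: bet_def)

lemma bet_turn: obtains x where "s < x" "x < s'" "2 / S = E1 x"
proof -
  have "\<exists>x. s < x \<and> x < s' \<and> bet s' - bet s = (s' - s) * (2 / S - E1 x)"
    by (rule MVT2[OF s(2)]) (use bet_deriv kap_mult_less s in blast)
  then show ?thesis using that s bet_root by auto
qed

text \<open>\<open>bet\<close> is strictly convex, because \<open>E1\<close> is strictly decreasing,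
  and it vanishes at both ends.\<close>

lemma bet_neg: assumes "s < z" "z < s'" shows "bet z < 0"
proof -
  obtain x where x: "s < x" "x < s'" "2 / S = E1 x" using bet_turn .
  show ?thesis
  proof (cases "z \<le> x")
    case True
    have "\<exists>c. s < c \<and> c < z \<and> bet z - bet s = (z - s) * (2 / S - E1 c)"
      by (rule MVT2[OF assms(1)]) (use bet_deriv kap_mult_less assms s in \<open>meson less_imp_le order_trans\<close>)
    then obtain c where c: "s < c" "c < z" "bet z - bet s = (z - s) * (2 / S - E1 c)" by blast
    have "E1 x < E1 c" using c True x s kap_mult_less[of x s'] by (intro E1_strict_antimono) auto
    then have "(z - s) * (2 / S - E1 c) < 0" using x assms by (intro mult_pos_neg) auto
    then show ?thesis using c(3) bet_root by linarith
  next
    case False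
    have "\<exists>c. z < c \<and> c < s' \<and> bet s' - bet z = (s' - z) * (2 / S - E1 c)"
      by (rule MVT2[OF assms(2)]) (use bet_deriv kap_mult_less assms s in \<open>meson less_imp_le order_trans\<close>)
    then obtain c where c: "z < c" "c < s'" "bet s' - bet z = (s' - z) * (2 / S - E1 c)" by blast
    have "E1 c < E1 x" using c False s kap_mult_less[of c s'] by (intro E1_strict_antimono) auto
    then have "0 < (s' - z) * (2 / S - E1 c)" using x assms by (intro mult_pos_pos) auto
    then show ?thesis using c(3) bet_root by linarith
  qed
qed

text \<open>At its later zero the convex function \<open>bet\<close> has positive derivative. So
  \<open>P\<close> arrives at the next level with a value below 2.\<close>

lemma E1_s'_S: "E1 s' * S < 2"
proof -
  obtain x where x: "s < x" "x < s'" "2 / S = E1 x" using bet_turn .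
  have "E1 s' < 2 / S" unfolding x(3) using x s by (intro E1_strict_antimono) auto
  then show ?thesis using S_pos by (simp add: field_simps)
qed

lemma isCont_D: "kap * (s + d) < 1 \<Longrightarrow> isCont D d"
  unfolding D_def[abs_def] using E1_pos[of "s + d"] E1_pos[OF ks]
  by (intro continuous_intros isCont_o2[OF _ isCont_E1]) auto

lemma D_0 [simp]: "D 0 = 0" by (simp add: D_def)

lemma D_lim: "(D \<longlongrightarrow> 0) (at_right 0)"
  using isCont_D[of 0] ks by (simp add: isCont_def filterlim_at_split)

lemma ev_right_of_s:
  assumes "s < z"
  shows "\<forall>\<^sub>F d in at_right 0. 0 < d \<and> s + d < z"
proof -
  have "\<forall>\<^sub>F d in at_right 0. d < z - s" by (rule order_tendstoD(2)[OF tendsto_ident_at]) (use assms in simp)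
  with eventually_at_right_less[of "0::real"] show ?thesis by eventually_elim auto
qed

lemma shift_lim: "((\<lambda>d. s + d) \<longlongrightarrow> s + 0) (at_right 0)"
  by (intro tendsto_intros)

lemma ln_ratio_lim:
  assumes "0 < z" "kap * z < 1"
  shows "(\<lambda>n. AQ * (ln (g1 (w n (T n))) - ln (g1 (w n (tau n z))))) \<longlonglongrightarrow> AQ * (ln (E1 s) - ln (E1 z))"
proof -
  have "(\<lambda>n. AQ * (ln (g1 (w n (T n)) / gm n) - ln (g1 (w n (tau n z)) / gm n))) \<longlonglongrightarrow> AQ * (ln (E1 s) - ln (E1 z))"
    using E1_pos[OF ks] E1_pos[OF assms(2)]
    by (intro tendsto_intros time_lims(2)[OF zT ks Tpos] tau_lims(2) assms) auto
  moreover have "\<forall>\<^sub>F n in sequentially. AQ * (ln (g1 (w n (T n)) / gm n) - ln (g1 (w n (tau n z)) / gm n))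
      = AQ * (ln (g1 (w n (T n))) - ln (g1 (w n (tau n z))))"
  proof -
    have "\<forall>\<^sub>F n in sequentially. t0 < w n (T n)"
      using time_lims(3)[OF zT ks Tpos] by (simp add: filterlim_at_top_dense)
    then show ?thesis using ev_tau[OF assms] ev_top
    proof eventually_elim
      case (elim n)
      then have "0 < g1 (w n (T n))" "0 < g1 (w n (tau n z))" "0 < gm n" using g1_pos by auto
      then show ?case by (simp add: ln_div)
    qed
  qed
  ultimately show ?thesis by (simp add: tendsto_cong)
qed

lemma tau_less_T:
  assumes "s < z" "kap * z < 1"
  shows "\<forall>\<^sub>F n in sequentially. tau n z < T n"
proof -
  have z0: "0 < z" using assms s by simp
  show ?thesis
    using order_tendstoD(2)[OF zT assms(1)] ev_tau[OF z0 assms(2)] Tpos ev_top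
  proof eventually_elim
    case (elim n)
    then show ?case using zz_less_imp[of n "tau n z" "T n"] by simp
  qed
qed

text \<open>Close below the peak the energy stays near \<open>a\<^sup>2 / 2\<close>, hence away from
  0, and \<open>P_stays_above\<close> selects the branch \<open>P \<ge> 2\<close>. The energy alone
  would determine \<open>P\<close> only up to reflection at 2.\<close>

lemma energy_near_peak:
  assumes d: "0 < d" "kap * (s + d) < 1" "D d < a\<^sup>2 / 4" and e: "0 < e"
  shows "\<forall>\<^sub>F n in sequentially. \<forall>t. tau n (s + d) \<le> t \<longrightarrow> t \<le> T n \<longrightarrow> 2 \<le> P n t \<and> \<bar>Q n t - a\<^sup>2 / 2\<bar> \<le> D d + e"
proof -
  define Z where "Z = s + d"
  have Z: "0 < Z" "0 \<le> Z" "kap * Z < 1" "s < Z" using d s by (auto simp: Z_def)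
  \<comment> \<open>With \<open>D d < a\<^sup>2 / 4\<close> this leaves \<open>Q\<close> above
    \<open>5/32 * a\<^sup>2\<close>, while \<open>4 * eps\<close> is at most
    \<open>4/32 * a\<^sup>2\<close>.\<close>
  define e' where "e' = min (e/3) (a\<^sup>2 / 32)"
  have e': "0 < e'" "3 * e' \<le> e" "e' \<le> a\<^sup>2 / 32" using e a_pos by (auto simp: e'_def)
  have l: "\<forall>\<^sub>F n in sequentially. AQ * (ln (g1 (w n (T n))) - ln (g1 (w n (tau n Z)))) < D d + e'"
    by (rule order_tendstoD(2)[OF ln_ratio_lim[OF Z(1,3)]]) (use e' in \<open>auto simp: D_def Z_def\<close>)
  have y: "\<forall>\<^sub>F n in sequentially. \<bar>Y n (T n) - a\<^sup>2 / 2\<bar> < e'"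
    using tendstoD[OF YT e'(1)] by (simp add: dist_real_def)
  show ?thesis
    using l y Q_cont[OF Z(2,3) e'(1)] drift_small[OF Z(2,3) e'(1)] T ev_tau[OF Z(1,3)] ev_top tau_less_T[OF Z(4,3)]
    unfolding Z_def[symmetric]
  proof eventually_elim
    case (elim n)
    define b where "b = tau n Z"
    have b: "0 < b" "zz n b = Z" "t0 < w n b" "b \<le> T n" using elim by (auto simp: b_def)
    have QT: "Q n (T n) = Y n (T n)" using Q_P2 elim by blast
    have r: "0 < t" "zz n t \<le> Z" "t0 < w n t" if "b \<le> t" for t
      using that b zz_antimono[of n b t] elim region_up[of b t n] by auto
    have Qt: "\<bar>Q n t - a\<^sup>2 / 2\<bar> \<le> D d + 3 * e'" if t: "b \<le> t" "t \<le> T n" for t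
    proof -
      have "\<bar>Q n (T n) - Q n t\<bar> \<le> AQ * (ln (g1 (w n (T n))) - ln (g1 (w n t))) + e'"
        using elim(3) r[OF t(1)] t by blast
      also have "AQ * (ln (g1 (w n (T n))) - ln (g1 (w n t))) \<le> AQ * (ln (g1 (w n (T n))) - ln (g1 (w n b)))"
      proof -
        have "g1 (w n b) \<le> g1 (w n t)" using b w_mono[OF b(1) t(1)] by (intro g1_mono) auto
        then have "ln (g1 (w n b)) \<le> ln (g1 (w n t))" using g1_pos[OF b(3)] by simp
        then show ?thesis using P0_ge by (intro mult_left_mono) (auto simp: AQ_def)
      qed
      also have "\<dots> < D d + e'" using elim(1) by (simp add: b_def)
      finally show ?thesis using elim(2) unfolding QT by linarith
    qed
    show ?case
    proof (intro allI impI conjI)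
      fix t assume t: "tau n Z \<le> t" "t \<le> T n"
      have t': "b \<le> t" using t by (simp add: b_def)
      show "2 \<le> P n t"
      proof (rule P_stays_above[OF b(1,4,3) _ _ t' t(2)])
        fix x assume x: "b \<le> x" "x \<le> T n"
        have "eps (w n x) \<le> e'" using elim(4) r[OF x(1)] by blast
        then have "4 * eps (w n x) \<le> a\<^sup>2 / 8" using e' by simp
        moreover have "a\<^sup>2 / 2 - (D d + 3 * e') \<le> Q n x" using Qt[OF x] by linarith
        moreover have "3 * e' \<le> 3 * a\<^sup>2 / 32" using e' by simp
        moreover have "0 < a\<^sup>2" using a_pos by simp
        ultimately show "4 * eps (w n x) < Q n x" using d(3) by linarith
      qed (use elim in auto)
      show "\<bar>Q n t - a\<^sup>2 / 2\<bar> \<le> D d + e" using Qt[OF t' t(2)] e' by linarith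
    qed
  qed
qed

text \<open>Between depths \<open>s + d / 2\<close> and \<open>s + d\<close> there is a point with
  \<open>Y\<close> small; there the energy is carried by \<open>P\<close>, so the slope is nearly
  \<open>S\<close>. Concavity takes this lower bound to every greater depth, even beyond
  \<open>s'\<close>.\<close>

lemma S_lower:
  assumes z: "s < z" "kap * z < 1" and e: "0 < e"
  shows "\<forall>\<^sub>F n in sequentially. S - e < Sn n z"
proof -
  have "((\<lambda>x. (2 + sqrt (a\<^sup>2 - x)) * (1 / E1 s)) \<longlongrightarrow> (2 + sqrt (a\<^sup>2 - 0)) * (1 / E1 s)) (at_right 0)"
    by (intro tendsto_intros)
  moreover have "(2 + sqrt (a\<^sup>2 - 0)) * (1 / E1 s) = S" using a_pos S_eq by simp
  ultimately have "\<forall>\<^sub>F x in at_right 0. S - e < (2 + sqrt (a\<^sup>2 - x)) * (1 / E1 s)"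
    by (intro order_tendstoD(1)) (use e in auto)
  moreover have "\<forall>\<^sub>F x in at_right 0. x < a\<^sup>2"
    by (rule order_tendstoD(2)[OF tendsto_ident_at]) (use a_pos in simp)
  moreover have "\<forall>\<^sub>F x in at_right (0::real). 0 < x" by (rule eventually_at_right_less)
  ultimately have "\<forall>\<^sub>F x in at_right 0. S - e < (2 + sqrt (a\<^sup>2 - x)) * (1 / E1 s) \<and> x < a\<^sup>2 \<and> 0 < x"
    by eventually_elim auto
  then obtain \<kappa> where k: "S - e < (2 + sqrt (a\<^sup>2 - \<kappa>)) * (1 / E1 s)" "\<kappa> < a\<^sup>2" "0 < \<kappa>"
    using eventually_happens[of _ "at_right (0::real)"] by auto
  have "\<forall>\<^sub>F d in at_right 0. D d < \<kappa> / 4" using D_lim by (rule order_tendstoD) (use k in simp)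
  with ev_right_of_s[OF z(1)] have "\<forall>\<^sub>F d in at_right 0. D d < \<kappa> / 4 \<and> 0 < d \<and> s + d < z" by eventually_elim auto
  then obtain d where d: "D d < \<kappa> / 4" "0 < d" "s + d < z"
    using eventually_happens[of _ "at_right (0::real)"] by auto
  have kd: "kap * (s + d) < 1" using kap_mult_less[of "s+d" z] d z by simp
  have Dd: "D d < a\<^sup>2 / 4" using d k by simp
  have k16: "0 < \<kappa> / 16" using k by simp
  have d2: "0 < s + d/2" "s + d/2 < s + d" "kap * (s + d/2) < 1" "s < s + d/2" "0 < s + d"
    using d s kap_mult_less[of "s+d/2" "s+d"] kd by auto
  have ev1: "\<forall>\<^sub>F n in sequentially. \<exists>x. tau n (s + d) < x \<and> x < tau n (s + d/2) \<and> Y n x \<le> \<kappa> / 16"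
    by (rule Y_small_between) (use d2 kd k16 in auto)
  have "(\<lambda>n. (2 + sqrt (a\<^sup>2 - \<kappa>)) * (1 / (g1 (w n (T n)) / gm n))) \<longlonglongrightarrow> (2 + sqrt (a\<^sup>2 - \<kappa>)) * (1 / E1 s)"
    using E1_pos[OF ks] by (intro tendsto_intros time_lims(2)[OF zT ks Tpos]) auto
  then have ev2: "\<forall>\<^sub>F n in sequentially. S - e < (2 + sqrt (a\<^sup>2 - \<kappa>)) * (1 / (g1 (w n (T n)) / gm n))"
    by (rule order_tendstoD(1)) (rule k(1))
  have z0: "0 < z" using z s by simp
  show ?thesis
    using ev1 ev2 energy_near_peak[OF d(2) kd Dd k16] tau_less_T[OF d2(4,3)] ev_tau[OF d2(5) kd] ev_top ev_tau[OF z0 z(2)] tau_less[OF d2(5) d(3) z(2)]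
  proof eventually_elim
    case (elim n)
    then obtain x where x: "tau n (s + d) < x" "x < tau n (s + d/2)" "Y n x \<le> \<kappa> / 16" by blast
    have rx: "0 < x" "t0 < w n x" using elim x region_up[of "tau n (s+d)" x n] by auto
    have xT: "x \<le> T n" using x elim by simp
    have PQ: "2 \<le> P n x" "\<bar>Q n x - a\<^sup>2 / 2\<bar> \<le> D d + \<kappa> / 16" using elim(3) x xT by auto
    have "a\<^sup>2 / 2 - \<kappa> / 4 - \<kappa> / 16 - \<kappa> / 16 \<le> (P n x - 2)\<^sup>2 / 2"
      using PQ(2) x(3) d(1) unfolding Q_def by linarith
    then have "a\<^sup>2 - \<kappa> \<le> (P n x - 2)\<^sup>2" using k by simp
    then have "sqrt (a\<^sup>2 - \<kappa>) \<le> sqrt ((P n x - 2)\<^sup>2)" by (simp only: real_sqrt_le_iff)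
    then have Px: "2 + sqrt (a\<^sup>2 - \<kappa>) \<le> P n x" using PQ by simp
    have gx: "0 < g1 (w n x)" "g1 (w n x) \<le> g1 (w n (T n))"
      using g1_pos rx w_mono[OF rx(1) xT] by (auto intro!: g1_mono)
    have sq: "0 \<le> sqrt (a\<^sup>2 - \<kappa>)" using k by simp
    have "S - e < (2 + sqrt (a\<^sup>2 - \<kappa>)) * (gm n / g1 (w n (T n)))" using elim(2) by simp
    also have "\<dots> \<le> P n x * (gm n / g1 (w n x))"
      using Px sq gx elim P_pos[OF rx] by (intro mult_mono frac_le) auto
    also have "\<dots> = gm n * v n x" using gx by (simp add: P_def)
    also have "\<dots> \<le> Sn n z" unfolding Sn_def
      using elim x by (intro mult_left_mono v_antimono) auto
    finally show ?case .
  qed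
qed

text \<open>Dropping \<open>Y\<close> from the energy bounds \<open>P\<close> from above. This works
  for depths near \<open>s\<close> only; further down, growth of the slope is excluded by means of
  \<open>Y_tiny\<close>.\<close>

lemma S_upper_near:
  assumes e: "0 < e"
  shows "\<forall>\<^sub>F d in at_right 0. \<forall>\<^sub>F n in sequentially. Sn n (s + d) < S + e"
proof -
  have "((\<lambda>d. E1 (s + d)) \<longlongrightarrow> E1 (s + 0)) (at_right 0)"
    by (rule isCont_tendsto_compose[OF isCont_E1 shift_lim]) (use ks in simp)
  then have "((\<lambda>d. (2 + sqrt (a\<^sup>2 + 2 * D d + 2 * d)) * (1 / E1 (s + d))) \<longlongrightarrow> (2 + sqrt (a\<^sup>2 + 2 * 0 + 2 * 0)) * (1 / E1 s)) (at_right 0)"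
    using E1_pos[OF ks] by (intro tendsto_intros D_lim) auto
  moreover have "(2 + sqrt (a\<^sup>2 + 2 * 0 + 2 * 0)) * (1 / E1 s) = S" using a_pos S_eq by simp
  ultimately have "\<forall>\<^sub>F d in at_right 0. (2 + sqrt (a\<^sup>2 + 2 * D d + 2 * d)) * (1 / E1 (s + d)) < S + e"
    by (intro order_tendstoD(2)) (use e in auto)
  moreover have "\<forall>\<^sub>F d in at_right 0. D d < a\<^sup>2 / 4" using D_lim by (rule order_tendstoD) (use a_pos in simp)
  ultimately show ?thesis using ev_right_of_s[OF s(2)]
  proof eventually_elim
    case (elim d)
    have kd: "kap * (s + d) < 1" using kap_mult_less[of "s+d" s'] elim s by simp
    have d: "0 < d" "0 < s + d" "s < s + d" using elim s by auto
    have "(\<lambda>n. (2 + sqrt (a\<^sup>2 + 2 * D d + 2 * d)) * (1 / (g1 (w n (tau n (s + d))) / gm n)))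
        \<longlonglongrightarrow> (2 + sqrt (a\<^sup>2 + 2 * D d + 2 * d)) * (1 / E1 (s + d))"
      using E1_pos[OF kd] by (intro tendsto_intros tau_lims(2) d kd) auto
    then have "\<forall>\<^sub>F n in sequentially. (2 + sqrt (a\<^sup>2 + 2 * D d + 2 * d)) * (1 / (g1 (w n (tau n (s + d))) / gm n)) < S + e"
      by (rule order_tendstoD(2)) (rule elim(1))
    then show ?case using energy_near_peak[OF d(1) kd elim(2) d(1)] tau_less_T[OF d(3) kd] ev_tau[OF d(2) kd] ev_top
    proof eventually_elim
      case (elim n)
      let ?t = "tau n (s + d)"
      have q: "2 \<le> P n ?t" "\<bar>Q n ?t - a\<^sup>2 / 2\<bar> \<le> D d + d" using elim by auto
      have "0 < Y n ?t" using Y_pos elim by blast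
      then have "(P n ?t - 2)\<^sup>2 \<le> a\<^sup>2 + 2 * D d + 2 * d" using q(2) unfolding Q_def by linarith
      then have "sqrt ((P n ?t - 2)\<^sup>2) \<le> sqrt (a\<^sup>2 + 2 * D d + 2 * d)" by (simp only: real_sqrt_le_iff)
      then have Pt: "P n ?t \<le> 2 + sqrt (a\<^sup>2 + 2 * D d + 2 * d)" using q by simp
      have gt: "0 < g1 (w n ?t)" using g1_pos elim by blast
      have "Sn n (s + d) = P n ?t * (gm n / g1 (w n ?t))" using gt by (simp add: Sn_def P_def)
      also have "\<dots> \<le> (2 + sqrt (a\<^sup>2 + 2 * D d + 2 * d)) * (gm n / g1 (w n ?t))"
        using Pt gt elim by (intro mult_right_mono) auto
      also have "\<dots> < S + e" using elim(1) by simp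
      finally show ?case .
    qed
  qed
qed

text \<open>With the slope bounded below by \<open>S_lower\<close>, \<open>ln Y\<close> is at most
  \<open>bet z * G\<close> up to small multiples of \<open>G\<close>, and \<open>bet\<close> is
  negative strictly between the two levels.\<close>

lemma Y_tiny:
  assumes z: "s < z1" "z1 \<le> z2" "z2 < s'"
  obtains c where "0 < c" "\<forall>\<^sub>F n in sequentially. \<forall>t. tau n z2 \<le> t \<longrightarrow> t \<le> tau n z1 \<longrightarrow> Y n t \<le> exp (- (c * G n))"
proof -
  \<comment> \<open>Of the five shares of \<open>c\<close>, three pay for the errors in
    \<open>E\<close> and in the slope and one for the constant \<open>ln Y0 + CH\<close>; one
    remains.\<close>
  define c where "c = - max (bet z1) (bet z2) / 5"
  have c: "0 < c" "bet z1 \<le> - 5 * c" "bet z2 \<le> - 5 * c" using bet_neg[of z1] bet_neg[of z2] z by (auto simp: c_def)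
  have kz: "kap * z1 < 1" "kap * z2 < 1" using kap_mult_less[of z1 s'] kap_mult_less[of z2 s'] z s by auto
  have z0: "0 < z1" "0 < z2" using z s by auto
  have "((\<lambda>d. E (s + d)) \<longlongrightarrow> E (s + 0)) (at_right 0)"
    by (rule isCont_tendsto_compose[OF isCont_E shift_lim]) (use ks in simp)
  then have "\<forall>\<^sub>F d in at_right 0. E s - c < E (s + d)" by (rule order_tendstoD) (use c in simp)
  with ev_right_of_s[OF z(1)] have "\<forall>\<^sub>F d in at_right 0. E s - c < E (s + d) \<and> 0 < d \<and> s + d < z1" by eventually_elim auto
  then obtain d where d: "E s - c < E (s + d)" "0 < d" "s + d < z1"
    using eventually_happens[of _ "at_right (0::real)"] by auto
  have kd: "kap * (s + d) < 1" using kap_mult_less[of "s+d" z1] d kz by simp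
  have sd: "0 < s + d" "s < s + d" using d s by auto
  have "((\<lambda>e. 2 * (z2 - s) / (S - e)) \<longlongrightarrow> 2 * (z2 - s) / (S - 0)) (at_right 0)"
    using S_pos by (intro tendsto_intros) auto
  then have "\<forall>\<^sub>F e in at_right 0. 2 * (z2 - s) / (S - e) < 2 * (z2 - s) / S + c"
    by (rule order_tendstoD) (use c in simp)
  moreover have "((\<lambda>e. 2 * (z1 - s) / (S - e)) \<longlongrightarrow> 2 * (z1 - s) / (S - 0)) (at_right 0)"
    using S_pos by (intro tendsto_intros) auto
  then have "\<forall>\<^sub>F e in at_right 0. 2 * (z1 - s) / (S - e) < 2 * (z1 - s) / S + c"
    by (rule order_tendstoD) (use c in simp)
  moreover have "\<forall>\<^sub>F e in at_right 0. e < S"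
    by (rule order_tendstoD(2)[OF tendsto_ident_at]) (rule S_pos)
  moreover have "\<forall>\<^sub>F x in at_right (0::real). 0 < x" by (rule eventually_at_right_less)
  ultimately have "\<forall>\<^sub>F e in at_right 0. 2 * (z2 - s) / (S - e) < 2 * (z2 - s) / S + c \<and>
      2 * (z1 - s) / (S - e) < 2 * (z1 - s) / S + c \<and> e < S \<and> 0 < e" by eventually_elim auto
  then obtain e where e: "2 * (z2 - s) / (S - e) < 2 * (z2 - s) / S + c" "2 * (z1 - s) / (S - e) < 2 * (z1 - s) / S + c" "e < S" "0 < e"
    using eventually_happens[of _ "at_right (0::real)"] by auto
  have c2: "0 < c/2" using c by simp
  have evE: "\<forall>\<^sub>F n in sequentially. \<bar>g (w n (tau n x)) / G n - E x\<bar> < c/2" if "0 < x" "kap * x < 1" for x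
    using tendstoD[OF tau_lims(1)[OF that] c2] by (simp add: dist_real_def)
  show ?thesis
  proof (rule that[OF c(1)])
    show "\<forall>\<^sub>F n in sequentially. \<forall>t. tau n z2 \<le> t \<longrightarrow> t \<le> tau n z1 \<longrightarrow> Y n t \<le> exp (- (c * G n))"
      using evE[OF z0(1) kz(1)] evE[OF z0(2) kz(2)] evE[OF sd(1) kd] S_lower[OF sd(2) kd e(4)]
        ev_tau[OF z0(1) kz(1)] ev_tau[OF z0(2) kz(2)] ev_tau[OF sd(1) kd] ev_top
        tau_less[OF sd(1) d(3) kz(1)] ev_const_div_G[OF c(1), of "ln Y0 + CH"]
    proof eventually_elim
      case (elim n)
      show ?case
      proof (intro allI impI)
        fix t assume t: "tau n z2 \<le> t" "t \<le> tau n z1"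
        define b where "b = tau n (s + d)"
        have rt: "0 < t" "t0 < w n t" "t \<le> b" using t elim region_up[of "tau n z2" t n] by (auto simp: b_def)
        have rb: "0 < b" "t0 < w n b" using elim by (auto simp: b_def)
        have vb: "0 < v n b" using v_pos rb by blast
        have "ln (Y n b) \<le> ln Y0" using Y_le[OF rb] Y_pos[OF rb] by simp
        have bnd: "g x + 2 * ((w n b - x) / v n b) - g (w n b) \<le> - 2 * c * G n"
          if x: "x = w n (tau n z)" and z: "z = z1 \<or> z = z2" for x z
        proof -
          have z': "s + d < z" "\<bar>g x / G n - E z\<bar> < c/2" "w n (tau n z) = mu n - z * ym n" "bet z \<le> - 5 * c"
            "2 * (z - s) / (S - e) < 2 * (z - s) / S + c"
            using elim z x d c e assms by auto
          have "w n b - x = (z - (s + d)) * ym n" using z'(3) x elim by (simp add: b_def algebra_simps)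
          moreover have "(z - (s + d)) * ym n / v n b = (z - (s + d)) * G n / Sn n (s + d)"
            unfolding Sn_def b_def[symmetric] by (rule ym_div) (use elim in auto)
          ultimately have "(w n b - x) / v n b = (z - (s + d)) * G n / Sn n (s + d)" by metis
          also have "\<dots> \<le> (z - s) * G n / (S - e)"
            using z'(1) d e elim by (intro frac_le mult_right_mono) auto
          finally have "(w n b - x) / v n b \<le> (z - s) * G n / (S - e)" .
          moreover have "2 * ((z - s) * G n / (S - e)) = 2 * (z - s) / (S - e) * G n" by simp
          ultimately have 1: "2 * ((w n b - x) / v n b) \<le> 2 * (z - s) / (S - e) * G n" by linarith
          have "2 * (z - s) / (S - e) * G n \<le> (2 * (z - s) / S + c) * G n"
            using z' elim by (intro mult_right_mono) auto
          with 1 have 1: "2 * ((w n b - x) / v n b) \<le> (2 * (z - s) / S + c) * G n" by linarith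
          have 2: "g x \<le> (E z + c/2) * G n"
          proof -
            have "g x / G n \<le> E z + c/2" using z'(2) by linarith
            then show ?thesis using elim by (simp add: pos_divide_le_eq)
          qed
          have "E (s + d) - c/2 \<le> g (w n b) / G n" using elim(3) unfolding b_def by linarith
          then have "(E (s + d) - c/2) * G n \<le> g (w n b)" using elim by (simp add: pos_le_divide_eq)
          moreover have "(E s - c - c/2) * G n \<le> (E (s + d) - c/2) * G n" using d elim by (intro mult_right_mono) auto
          ultimately have 3: "(E s - c - c/2) * G n \<le> g (w n b)" by linarith
          have "g x + 2 * ((w n b - x) / v n b) - g (w n b) \<le> (E z + c/2) * G n + (2 * (z - s) / S + c) * G n - (E s - c - c/2) * G n"
            using 1 2 3 by linarith
          also have "\<dots> = (bet z + 3 * c) * G n" unfolding bet_def by (simp add: algebra_simps)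
          also have "\<dots> \<le> (- 2 * c) * G n" using z'(4) elim by (intro mult_right_mono) auto
          finally show ?thesis .
        qed
        \<comment> \<open>For fixed \<open>k\<close>, \<open>g x - k * x\<close> is convex in the
          height \<open>x\<close>, so the estimate at the two extreme depths gives it in
          between.\<close>
        define k where "k = 2 / v n b"
        let ?x1 = "w n (tau n z1)" let ?x2 = "w n (tau n z2)"
        have "g (w n t) - k * w n t \<le> max (g ?x2 - k * ?x2) (g ?x1 - k * ?x1)"
          by (rule g_le_max) (use elim t rt w_mono[of "tau n z2" t n] w_mono[of t "tau n z1" n] in auto)
        then have disj: "g (w n t) - k * w n t \<le> g ?x2 - k * ?x2 \<or> g (w n t) - k * w n t \<le> g ?x1 - k * ?x1"
          by (simp only: le_max_iff_disj)
        have kx: "2 * ((w n b - x) / v n b) = k * w n b - k * x" for x by (simp add: k_def diff_divide_distrib)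
        have "(g (w n t) - g (w n b)) + 2 * ((w n b - w n t) / v n b) \<le> - 2 * c * G n"
          using disj bnd[of ?x1 z1] bnd[of ?x2 z2] unfolding kx by (elim disjE) simp_all
        then have "ln (Y n t) \<le> ln Y0 + CH + (- 2 * c * G n)"
          using ln_Y_upper[OF rt(1,3,2)] \<open>ln (Y n b) \<le> ln Y0\<close> by linarith
        also have "ln Y0 + CH \<le> c * G n" using elim by (simp add: field_simps)
        finally have "ln (Y n t) \<le> - (c * G n)" by simp
        then show "Y n t \<le> exp (- (c * G n))" using Y_pos[OF rt(1,2)] by (metis exp_le_cancel_iff exp_ln)
      qed
    qed
  qed
qed

lemma Y_zero: assumes z: "s < z" "z < s'" shows "(\<lambda>n. Y n (tau n z)) \<longlonglongrightarrow> 0"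
proof -
  have kz: "0 < z" "kap * z < 1" using kap_mult_less[of z s'] z s by auto
  obtain c where c: "0 < c" "\<forall>\<^sub>F n in sequentially. \<forall>t. tau n z \<le> t \<longrightarrow> t \<le> tau n z \<longrightarrow> Y n t \<le> exp (- (c * G n))"
    using Y_tiny[OF z(1) order_refl z(2)] .
  have "filterlim (\<lambda>n. c * G n) at_top sequentially"
    by (rule filterlim_tendsto_pos_mult_at_top[OF tendsto_const c(1) filterlim_G])
  then have "filterlim (\<lambda>n. - (c * G n)) at_bot sequentially"
    by (simp only: filterlim_uminus_at_bot minus_minus)
  then have "(\<lambda>n. exp (- (c * G n))) \<longlonglongrightarrow> 0" by (rule filterlim_compose[OF exp_at_bot])
  then show ?thesis
  proof (rule Lim_null_comparison[rotated])
    show "\<forall>\<^sub>F n in sequentially. norm (Y n (tau n z)) \<le> exp (- (c * G n))"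
      using c(2) ev_tau[OF kz]
    proof eventually_elim
      case (elim n)
      then show ?case using Y_pos[of "tau n z" n] by simp
    qed
  qed
qed

text \<open>The slope changes from depth \<open>s + d\<close> to \<open>z\<close> by the elapsed
  time, of order \<open>G\<close>, multiplied by \<open>Y / g1\<close>, where \<open>Y\<close> is
  exponentially small in \<open>G\<close>. So the upper bound near \<open>s\<close>
  persists.\<close>

lemma S_lim:
  assumes z: "s < z" "z < s'"
  shows "(\<lambda>n. Sn n z) \<longlonglongrightarrow> S"
proof (rule tendstoI)
  fix e :: real assume e: "0 < e"
  have kz: "0 < z" "kap * z < 1" using kap_mult_less[of z s'] z s by auto
  have e2: "0 < e/2" "0 < S/2" using e S_pos by auto
  have "\<forall>\<^sub>F d in at_right 0. (\<forall>\<^sub>F n in sequentially. Sn n (s + d) < S + e/2) \<and> 0 < d \<and> s + d < z"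
    using S_upper_near[OF e2(1)] ev_right_of_s[OF z(1)] by eventually_elim auto
  then obtain d where d: "\<forall>\<^sub>F n in sequentially. Sn n (s + d) < S + e/2" "0 < d" "s + d < z"
    using eventually_happens[of _ "at_right (0::real)"] by auto
  define z1 where "z1 = s + d"
  have z1: "0 < z1" "s < z1" "z1 < z" "kap * z1 < 1" using d s kz kap_mult_less[of z1 z] by (auto simp: z1_def)
  obtain c where c: "0 < c" "\<forall>\<^sub>F n in sequentially. \<forall>t. tau n z \<le> t \<longrightarrow> t \<le> tau n z1 \<longrightarrow> Y n t \<le> exp (- (c * G n))"
    using Y_tiny[OF z1(2) less_imp_le[OF z1(3)] z(2)] .
  obtain C where C: "0 < C" "\<forall>\<^sub>F n in sequentially. \<forall>t. 0 < t \<longrightarrow> zz n t \<le> z \<longrightarrow>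
     t0 < w n t \<and> gm n \<le> C * g1 (w n t) \<and> G n \<le> C * t \<and> eps (w n t) * G n \<le> C"
    using level_bounds[OF less_imp_le[OF kz(1)] kz(2)] .
  define K where "K = C * ((z - z1) / (S/2))"
  have "((\<lambda>x. K / c * (c * x / exp (c * x))) \<longlongrightarrow> K / c * 0) at_top"
  proof -
    have "filterlim (\<lambda>x. c * x) at_top at_top"
      by (rule filterlim_tendsto_pos_mult_at_top[OF tendsto_const c(1) filterlim_ident])
    moreover have "((\<lambda>x::real. x / exp x) \<longlongrightarrow> 0) at_top" using tendsto_power_div_exp_0[of 1] by simp
    ultimately have "((\<lambda>x. c * x / exp (c * x)) \<longlongrightarrow> 0) at_top" by (rule filterlim_compose[rotated])
    then show ?thesis by (intro tendsto_mult tendsto_const)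
  qed
  then have "\<forall>\<^sub>F x in at_top. K / c * (c * x / exp (c * x)) < e/2" using e by (intro order_tendstoD(2)) auto
  from eventually_compose_filterlim[OF this filterlim_G]
  have ev1: "\<forall>\<^sub>F n in sequentially. K / c * (c * G n / exp (c * G n)) < e/2" .
  show "\<forall>\<^sub>F n in sequentially. dist (Sn n z) S < e"
    using ev1 d(1) S_lower[OF z(1) kz(2) e] S_lower[OF z1(2,4) e2(2)] c(2) C(2) ev_tau[OF kz] ev_tau[OF z1(1,4)]
      tau_less[OF z1(1,3) kz(2)] ev_top
    unfolding z1_def[symmetric]
  proof eventually_elim
    case (elim n)
    let ?a = "tau n z" and ?b = "tau n z1"
    have ra: "0 < ?a" "?a < ?b" "t0 < w n ?a" "0 < ?b" using elim by auto
    obtain x where x: "?a < x" "x < ?b" "v n ?a - v n ?b = (?b - ?a) * (Y n x / g1 (w n x))"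
      using v_diff[OF ra(1-3)] .
    have rx: "0 < x" "t0 < w n x" "zz n x \<le> z" using ra x region_up[of ?a x n] zz_antimono[of n ?a x] elim by auto
    have gx: "0 < g1 (w n x)" "gm n \<le> C * g1 (w n x)" using g1_pos rx elim(6) by auto
    have Sb: "S/2 < Sn n z1" "0 < Sn n z1" using elim S_pos by auto
    have vb: "0 < v n ?b" using v_pos elim by blast
    have "v n ?b * (?b - ?a) \<le> w n ?b - w n ?a" by (rule w_diff(1)) (use ra in auto)
    also have "\<dots> = (z - z1) * ym n" using elim by (simp add: algebra_simps)
    finally have "?b - ?a \<le> (z - z1) * ym n / v n ?b" using vb by (simp add: field_simps)
    also have "\<dots> = (z - z1) * G n / Sn n z1" unfolding Sn_def by (rule ym_div) (use elim in auto)
    also have "\<dots> \<le> (z - z1) * G n / (S/2)" using Sb S_pos z1 elim by (intro divide_left_mono) auto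
    finally have L: "?b - ?a \<le> (z - z1) / (S/2) * G n" by (simp only: times_divide_eq_left)
    have Yx: "0 < Y n x" "Y n x \<le> exp (- (c * G n))" using Y_pos rx elim(5) x by auto
    have "Sn n z - Sn n z1 = gm n * (v n ?a - v n ?b)" by (simp add: Sn_def algebra_simps)
    also have "\<dots> = (?b - ?a) * (Y n x * (gm n / g1 (w n x)))" unfolding x(3) by simp
    also have "\<dots> \<le> ((z - z1) / (S/2) * G n) * (exp (- (c * G n)) * C)"
      using L Yx gx ra elim z1 S_pos C by (intro mult_mono) (auto simp: field_simps)
    also have "\<dots> = K * G n * exp (- (c * G n))" unfolding K_def by (simp only: mult_ac)
    also have "\<dots> = K / c * (c * G n / exp (c * G n))" using c(1) by (simp add: exp_minus divide_inverse)
    also have "\<dots> < e/2" by (rule elim(1))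
    finally have "Sn n z < S + e" using elim(2) by simp
    then show ?case using elim(3) by (simp add: dist_real_def abs_less_iff)
  qed
qed

lemma P_lim_tau:
  assumes z: "s < z" "z < s'"
  shows "(\<lambda>n. P n (tau n z)) \<longlonglongrightarrow> E1 z * S"
proof -
  have kz: "0 < z" "kap * z < 1" using kap_mult_less[of z s'] z s by auto
  have "(\<lambda>n. g1 (w n (tau n z)) / gm n * Sn n z) \<longlonglongrightarrow> E1 z * S"
    by (intro tendsto_mult tau_lims(2) S_lim z kz)
  moreover have "\<forall>\<^sub>F n in sequentially. g1 (w n (tau n z)) / gm n * Sn n z = P n (tau n z)"
    using ev_top by eventually_elim (simp add: P_def Sn_def)
  ultimately show ?thesis by (simp add: tendsto_cong)
qed

lemma Q_lim_tau:
  assumes z: "s < z" "z < s'"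
  shows "(\<lambda>n. Q n (tau n z)) \<longlonglongrightarrow> (E1 z * S - 2)\<^sup>2 / 2"
proof -
  have "(\<lambda>n. (P n (tau n z) - 2)\<^sup>2 / 2 + Y n (tau n z)) \<longlonglongrightarrow> (E1 z * S - 2)\<^sup>2 / 2 + 0"
    by (intro tendsto_intros P_lim_tau Y_zero z) auto
  then show ?thesis by (simp add: Q_def)
qed

section \<open>Arrival at the next peak\<close>

definition a' :: real where "a' = 2 - E1 s' * S"

lemma a'_bounds: "0 < a'" "a' < 2"
  using E1_s'_S E1_pos[OF s(3)] S_pos by (auto simp: a'_def)

lemma shift_lim_plus: "((\<lambda>d. s' + d) \<longlongrightarrow> s') (at_right 0)"
  and shift_lim_minus: "((\<lambda>d. s' - d) \<longlongrightarrow> s') (at_right 0)"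
  using tendsto_add[OF tendsto_const[of s'] tendsto_ident_at[of "0::real" "{0<..}"]]
    tendsto_diff[OF tendsto_const[of s'] tendsto_ident_at[of "0::real" "{0<..}"]] by simp_all

lemma E1_lims:
  "((\<lambda>d. E1 (s' + d)) \<longlongrightarrow> E1 s') (at_right 0)" "((\<lambda>d. E1 (s' - d)) \<longlongrightarrow> E1 s') (at_right 0)"
  by (rule isCont_tendsto_compose[OF isCont_E1[OF s(3)]], fact shift_lim_plus shift_lim_minus)+

text \<open>Suppose \<open>P\<close> avoided 2 near depth \<open>s'\<close>. It would still be below
  2 at a deeper point \<open>x\<close> with \<open>Y\<close> small, and the nearly constant energy
  would keep it at most \<open>2 - a' / 2\<close> there. With so small a slope, \<open>ln Y\<close>
  gains a multiple of \<open>G\<close> on the way down to \<open>x\<close>, whereas just before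
  \<open>s'\<close> it was only slightly negative on this scale; so \<open>Y\<close> could not be
  small at \<open>x\<close>.\<close>

lemma second_bubble_near:
  assumes "0 < \<delta>"
  shows "\<forall>\<^sub>F n in sequentially. \<exists>t. (0 < t \<and> P n t = 2) \<and> \<bar>zz n t - s'\<bar> \<le> \<delta>"
proof -
  have E1p: "0 < E1 s'" using E1_pos s by blast
  have E1S: "E1 s' * S = 2 - a'" by (simp add: a'_def)
  have a2: "0 < a'\<^sup>2" using a'_bounds by simp
  have "((\<lambda>d. E1 (s' - d) * S) \<longlongrightarrow> E1 s' * S) (at_right 0)" by (intro tendsto_intros E1_lims)
  then have 1: "\<forall>\<^sub>F d in at_right 0. E1 (s' - d) * S < 2 - 3/4 * a'"
    by (rule order_tendstoD(2)) (use a'_bounds E1S in linarith)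
  have "((\<lambda>d. AQ * (ln (E1 (s' - d)) - ln (E1 (s' + d)))) \<longlongrightarrow> AQ * (ln (E1 s') - ln (E1 s'))) (at_right 0)"
    using E1p by (intro tendsto_intros E1_lims) auto
  then have 2: "\<forall>\<^sub>F d in at_right 0. AQ * (ln (E1 (s' - d)) - ln (E1 (s' + d))) < a'\<^sup>2 / 64"
    by (rule order_tendstoD) (use a2 in simp)
  have "((\<lambda>d. E1 (s' - d) / E1 (s' + d)) \<longlongrightarrow> E1 s' / E1 s') (at_right 0)"
    using E1p by (intro tendsto_intros E1_lims) auto
  then have 3: "\<forall>\<^sub>F d in at_right 0. E1 (s' - d) / E1 (s' + d) < 1 + a' / 8"
    by (rule order_tendstoD) (use E1p a'_bounds in simp)
  have "((\<lambda>d. kap * (s' + d)) \<longlongrightarrow> kap * s') (at_right 0)" by (intro tendsto_intros shift_lim_plus)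
  then have 4: "\<forall>\<^sub>F d in at_right 0. kap * (s' + d) < 1" by (rule order_tendstoD) (rule s(3))
  have 5: "\<forall>\<^sub>F d in at_right 0. d < min \<delta> (s' - s)"
    by (rule order_tendstoD(2)[OF tendsto_ident_at]) (use assms s in simp)
  have "\<forall>\<^sub>F d in at_right 0. E1 (s' - d) * S < 2 - 3/4 * a' \<and> AQ * (ln (E1 (s' - d)) - ln (E1 (s' + d))) < a'\<^sup>2 / 64 \<and>
    E1 (s' - d) / E1 (s' + d) < 1 + a' / 8 \<and> kap * (s' + d) < 1 \<and> d < min \<delta> (s' - s) \<and> 0 < d"
    using 1 2 3 4 5 eventually_at_right_less[of 0] by eventually_elim auto
  from eventually_happens'[OF trivial_limit_at_right_real this]
  obtain d where d: "E1 (s' - d) * S < 2 - 3/4 * a'" "AQ * (ln (E1 (s' - d)) - ln (E1 (s' + d))) < a'\<^sup>2 / 64"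
    "E1 (s' - d) / E1 (s' + d) < 1 + a' / 8" "kap * (s' + d) < 1" "d < \<delta>" "s < s' - d" "0 < d"
    by auto
  define Z where "Z = s' + d"
  define zl where "zl = s' - d"
  have Z: "0 < Z" "0 \<le> Z" "kap * Z < 1" using d s by (auto simp: Z_def)
  have zl: "0 < zl" "zl < s'" "s < zl" "kap * zl < 1" using d s kap_mult_less[of zl s'] by (auto simp: zl_def)
  have mid: "0 < s' + d/2" "s' + d/2 < Z" "kap * (s' + d/2) < 1"
    using d s kap_mult_less[of "s' + d/2" Z] Z by (auto simp: Z_def)
  obtain C where C: "0 < C" "\<forall>\<^sub>F n in sequentially. \<forall>t. 0 < t \<longrightarrow> zz n t \<le> Z \<longrightarrow>
     t0 < w n t \<and> gm n \<le> C * g1 (w n t) \<and> G n \<le> C * t \<and> eps (w n t) * G n \<le> C"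
    using level_bounds[OF Z(2,3)] .
  \<comment> \<open>The gain of \<open>ln Y\<close> in units of \<open>G\<close>: a relative surplus
    \<open>a' / 8\<close> of \<open>2 / P\<close> over the growth of \<open>g\<close>, along a
    height of at least \<open>d / 2\<close> units, with \<open>g1\<close> at least
    \<open>gm n / C\<close>.\<close>
  define k where "k = d * a' / (16 * C)"
  have k: "0 < k" using d a'_bounds C by (simp add: k_def)
  have "((\<lambda>x. bet (s' - x)) \<longlongrightarrow> bet s') (at_right 0)"
    by (rule isCont_tendsto_compose[OF DERIV_isCont[OF bet_deriv[OF s(3)]] shift_lim_minus])
  then have "\<forall>\<^sub>F x in at_right 0. - k / 2 < bet (s' - x)" by (rule order_tendstoD) (use k bet_root in simp)
  moreover have "\<forall>\<^sub>F x in at_right 0. x < d" by (rule order_tendstoD(2)[OF tendsto_ident_at]) (rule d)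
  ultimately have "\<forall>\<^sub>F x in at_right 0. - k / 2 < bet (s' - x) \<and> x < d \<and> 0 < x"
    using eventually_at_right_less[of 0] by eventually_elim auto
  then obtain x0 where x0: "- k / 2 < bet (s' - x0)" "x0 < d" "0 < x0"
    using eventually_happens[of _ "at_right (0::real)"] by auto
  \<comment> \<open>Chosen after \<open>k\<close>, so that the deficit of \<open>ln Y\<close> at
    this depth, about \<open>bet \<zeta> * G n\<close>, is less than half of the gain.\<close>
  define \<zeta> where "\<zeta> = s' - x0"
  have \<zeta>: "- k / 2 < bet \<zeta>" "zl < \<zeta>" "\<zeta> < s'" "s < \<zeta>" "0 < \<zeta>" "kap * \<zeta> < 1" "\<zeta> < s' + d/2"
    using x0 zl s d kap_mult_less[of \<zeta> s'] by (auto simp: \<zeta>_def zl_def)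
  have E1\<zeta>: "E1 \<zeta> * S < 2 - 3/4 * a'"
  proof -
    have "E1 \<zeta> \<le> E1 zl" using \<zeta> by (intro E1_antimono) auto
    then have "E1 \<zeta> * S \<le> E1 zl * S" using S_pos by simp
    then show ?thesis using d(1) by (simp add: zl_def)
  qed
  have ev1: "\<forall>\<^sub>F n in sequentially. P n (tau n \<zeta>) < 2"
    by (rule order_tendstoD(2)[OF P_lim_tau[OF \<zeta>(4,3)]]) (use E1\<zeta> a'_bounds in simp)
  have "(3/4 * a')\<^sup>2 < (2 - E1 \<zeta> * S)\<^sup>2" using E1\<zeta> a'_bounds by (intro power_strict_mono) auto
  then have "9/32 * a'\<^sup>2 < (E1 \<zeta> * S - 2)\<^sup>2 / 2"
    by (simp add: power2_commute[of "E1 \<zeta> * S" 2] power_mult_distrib power_divide)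
  then have ev2: "\<forall>\<^sub>F n in sequentially. 9/32 * a'\<^sup>2 < Q n (tau n \<zeta>)"
    by (rule order_tendstoD(1)[OF Q_lim_tau[OF \<zeta>(4,3)]])
  \<comment> \<open>The bound 1 makes \<open>ln Y \<le> 0\<close> at the point \<open>x\<close>; the
    other bound enters the energy balance.\<close>
  define e0 where "e0 = min (a'\<^sup>2 / 64) 1"
  have e0: "0 < e0" "e0 \<le> a'\<^sup>2 / 64" "e0 \<le> 1" using a2 by (auto simp: e0_def)
  have ev3: "\<forall>\<^sub>F n in sequentially. \<exists>x. tau n Z < x \<and> x < tau n (s' + d/2) \<and> Y n x \<le> e0"
    by (rule Y_small_between[OF mid(1,2) Z(3) e0(1)])
  have "(\<lambda>n. g1 (w n (tau n zl)) / gm n / (g1 (w n (tau n Z)) / gm n)) \<longlonglongrightarrow> E1 zl / E1 Z"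
    using E1_pos[OF Z(3)] by (intro tendsto_divide tau_lims zl Z) auto
  then have ev4: "\<forall>\<^sub>F n in sequentially. g1 (w n (tau n zl)) / gm n / (g1 (w n (tau n Z)) / gm n) < 1 + a' / 8"
    by (rule order_tendstoD) (use d in \<open>simp add: Z_def zl_def\<close>)
  have "(\<lambda>n. AQ * (ln (g1 (w n (tau n zl)) / gm n) - ln (g1 (w n (tau n Z)) / gm n))) \<longlonglongrightarrow> AQ * (ln (E1 zl) - ln (E1 Z))"
    using E1_pos[OF Z(3)] E1_pos[OF zl(4)] by (intro tendsto_intros tau_lims zl Z) auto
  then have ev5: "\<forall>\<^sub>F n in sequentially. AQ * (ln (g1 (w n (tau n zl)) / gm n) - ln (g1 (w n (tau n Z)) / gm n)) < a'\<^sup>2 / 64"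
    by (rule order_tendstoD) (use d in \<open>simp add: Z_def zl_def\<close>)
  have "(\<lambda>n. g (w n (tau n \<zeta>)) / G n - g (w n (T n)) / G n + 2 * (\<zeta> - zz n (T n)) / Sn n \<zeta>) \<longlonglongrightarrow> bet \<zeta>"
    unfolding bet_def using S_pos
    by (intro tendsto_intros tau_lims time_lims(1)[OF zT ks Tpos] zT S_lim \<zeta>) auto
  then have ev6: "\<forall>\<^sub>F n in sequentially. - k / 2 < g (w n (tau n \<zeta>)) / G n - g (w n (T n)) / G n + 2 * (\<zeta> - zz n (T n)) / Sn n \<zeta>"
    by (rule order_tendstoD) (rule \<zeta>(1))
  define L where "L = ln (a\<^sup>2 / 2) + (ln (E1 \<zeta>) - ln (E1 s)) - 1"
  have "(\<lambda>n. ln (Y n (T n)) + (ln (g1 (w n (tau n \<zeta>)) / gm n) - ln (g1 (w n (T n)) / gm n))) \<longlonglongrightarrow> ln (a\<^sup>2 / 2) + (ln (E1 \<zeta>) - ln (E1 s))"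
    using E1_pos[OF \<zeta>(6)] E1_pos[OF ks] a_pos
    by (intro tendsto_intros YT tau_lims time_lims(2)[OF zT ks Tpos] \<zeta>) auto
  then have ev7: "\<forall>\<^sub>F n in sequentially. L < ln (Y n (T n)) + (ln (g1 (w n (tau n \<zeta>)) / gm n) - ln (g1 (w n (T n)) / gm n))"
    by (rule order_tendstoD) (simp add: L_def)
  have k2: "0 < k/2" and a64: "0 < a'\<^sup>2 / 64" using k a2 by auto
  have ev8: "\<forall>\<^sub>F n in sequentially. 0 < Sn n \<zeta>" by (rule order_tendstoD(1)[OF S_lim[OF \<zeta>(4,3)] S_pos])
  have ev9: "\<forall>\<^sub>F n in sequentially. t0 < w n (T n)"
    using time_lims(3)[OF zT ks Tpos] by (simp add: filterlim_at_top_dense)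
  have ev10: "\<forall>\<^sub>F n in sequentially. (2 * CH + 1 - L) / G n < k/2" by (rule ev_const_div_G[OF k2])
  note evt = ev_tau[OF Z(1,3)] ev_tau[OF zl(1,4)] ev_tau[OF \<zeta>(5,6)] ev_tau[OF mid(1,3)]
  show ?thesis
    using ev1 ev2 ev3 ev4 ev5 ev6 ev7 ev8 ev9 ev10 Q_cont[OF Z(2,3) a64] C(2) evt ev_top
      tau_less_T[OF \<zeta>(4,6)] tau_less[OF \<zeta>(5,7) mid(3)] tau_less[OF zl(1) \<zeta>(2,6)]
  proof eventually_elim
    case (elim n)
    note P\<zeta> = elim(1) and Q\<zeta> = elim(2) and rat = elim(4) and lrat = elim(5) and gT = elim(6) and YTn = elim(7)
      and Sp = elim(8) and wT = elim(9) and big = elim(10) and Qc = elim(11) and pack = elim(12)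
      and tZ = elim(13) and tl = elim(14) and t\<zeta> = elim(15) and tm = elim(16) and mun = elim(17)
      and \<zeta>T = elim(18) and m\<zeta> = elim(19) and \<zeta>l = elim(20)
    show ?case
    proof (rule ccontr)
      assume no: "\<not> ?thesis"
      obtain x where x: "tau n Z < x" "x < tau n (s' + d/2)" "Y n x \<le> e0" using elim(3) by blast
      have x\<zeta>: "x < tau n \<zeta>" using x m\<zeta> by simp
      have rx: "0 < x" "t0 < w n x" "zz n x \<le> Z" "s' + d/2 \<le> zz n x"
        using x tZ tm mun region_up[of "tau n Z" x n] zz_antimono[of n "tau n Z" x] zz_antimono[of n x "tau n (s' + d/2)"] by auto
      have ne: "P n t \<noteq> 2" if "x \<le> t" "t \<le> tau n \<zeta>" for t
      proof
        assume P2: "P n t = 2"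
        have "zz n t \<le> Z" "\<zeta> \<le> zz n t" "0 < t"
          using that rx t\<zeta> mun zz_antimono[of n x t] zz_antimono[of n t "tau n \<zeta>"] by auto
        then have "\<bar>zz n t - s'\<bar> \<le> \<delta>" using d x0 by (auto simp: Z_def \<zeta>_def)
        then show False using no P2 \<open>0 < t\<close> by blast
      qed
      have Px2: "P n x < 2"
      proof (rule ccontr)
        assume "\<not> P n x < 2"
        then have "\<exists>t\<ge>x. t \<le> tau n \<zeta> \<and> P n t = 2"
          by (intro IVT2') (use x\<zeta> P\<zeta> continuous_on_P[OF rx(1,2)] in auto)
        then show False using ne by blast
      qed
      define g\<zeta> where "g\<zeta> = g1 (w n (tau n \<zeta>))"
      define gx where "gx = g1 (w n x)"
      have gp: "0 < g\<zeta>" "0 < gx" "0 < gm n" "0 < g1 (w n (tau n zl))" "0 < g1 (w n (tau n Z))" "0 < g1 (w n (T n))"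
        using g1_pos t\<zeta> rx tl tZ wT mun by (auto simp: g\<zeta>_def gx_def)
      have g\<zeta>l: "g\<zeta> \<le> g1 (w n (tau n zl))" unfolding g\<zeta>_def
        using t\<zeta> \<zeta>l w_mono[of "tau n \<zeta>" "tau n zl" n] by (intro g1_mono) auto
      have gxZ: "g1 (w n (tau n Z)) \<le> gx" unfolding gx_def
        using tZ x w_mono[of "tau n Z" x n] by (intro g1_mono) auto
      have "ln g\<zeta> - ln gx \<le> ln (g1 (w n (tau n zl))) - ln (g1 (w n (tau n Z)))"
        using g\<zeta>l gxZ gp by (intro diff_mono) auto
      also have "\<dots> = ln (g1 (w n (tau n zl)) / gm n) - ln (g1 (w n (tau n Z)) / gm n)"
        using gp by (simp add: ln_div)
      finally have "AQ * (ln g\<zeta> - ln gx) \<le> AQ * (ln (g1 (w n (tau n zl)) / gm n) - ln (g1 (w n (tau n Z)) / gm n))"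
        using P0_ge by (intro mult_left_mono) (auto simp: AQ_def)
      with lrat have lr: "AQ * (ln g\<zeta> - ln gx) < a'\<^sup>2 / 64" by linarith
      have "\<bar>Q n (tau n \<zeta>) - Q n x\<bar> \<le> AQ * (ln g\<zeta> - ln gx) + a'\<^sup>2 / 64"
        unfolding g\<zeta>_def gx_def using Qc rx x\<zeta> by auto
      \<comment> \<open>From \<open>18/64\<close> at \<zeta>, two errors of \<open>1/64\<close> are
        lost in the energy variation and a third one to \<open>Y\<close>. A remainder of
        \<open>8/64\<close> would suffice for the distance \<open>a' / 2\<close> of \<open>P\<close>
        from 2.\<close>
      then have "16/64 * a'\<^sup>2 < Q n x" using lr Q\<zeta> by linarith
      then have "15/64 * a'\<^sup>2 \<le> (P n x - 2)\<^sup>2 / 2" using x(3) e0 unfolding Q_def by linarith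
      then have "a'\<^sup>2 / 4 \<le> (P n x - 2)\<^sup>2" using a2 by linarith
      then have "(a' / 2)\<^sup>2 \<le> (2 - P n x)\<^sup>2"
        unfolding power2_commute[of 2 "P n x"] power_divide by simp
      then have "a' / 2 \<le> 2 - P n x" by (rule power2_le_imp_le) (use Px2 in simp)
      then have Px: "P n x \<le> 2 - a' / 2" by simp
      have Pxp: "0 < P n x" using P_pos rx by blast
      define \<Delta> where "\<Delta> = w n (tau n \<zeta>) - w n x"
      have \<Delta>: "d/2 * ym n \<le> \<Delta>"
      proof -
        have "\<Delta> = (zz n x - \<zeta>) * ym n" unfolding \<Delta>_def using t\<zeta> zz_level[of n x] mun by (simp add: algebra_simps)
        moreover have "d/2 \<le> zz n x - \<zeta>" using rx \<zeta> by linarith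
        ultimately show ?thesis using mun by (simp add: mult_right_mono)
      qed
      have \<Delta>0: "0 \<le> \<Delta>" using \<Delta> d mun by (smt (verit) divide_pos_pos mult_pos_pos)
      have rat2: "g\<zeta> \<le> (1 + a' / 8) * gx"
      proof -
        have "g1 (w n (tau n zl)) < (1 + a' / 8) * g1 (w n (tau n Z))" using rat gp by (simp add: field_simps)
        also have "\<dots> \<le> (1 + a' / 8) * gx" using gxZ a'_bounds by (intro mult_left_mono) auto
        finally show ?thesis using g\<zeta>l by simp
      qed
      have "ln g\<zeta> \<le> ln ((1 + a' / 8) * gx)" using rat2 gp by simp
      also have "\<dots> = ln (1 + a' / 8) + ln gx" using gp a'_bounds by (simp add: ln_mult)
      also have "ln (1 + a' / 8) \<le> a' / 8" using a'_bounds by (intro ln_add_one_self_le_self) auto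
      finally have l1: "- 1 \<le> ln gx - ln g\<zeta>" using a'_bounds by simp
      have "g (w n (tau n \<zeta>)) - g (w n x) \<le> g\<zeta> * \<Delta>" unfolding g\<zeta>_def \<Delta>_def
        using rx x\<zeta> w_mono[of x "tau n \<zeta>" n] by (intro g_tangent) auto
      also have "\<dots> \<le> (1 + a' / 8) * gx * \<Delta>" using rat2 \<Delta>0 by (intro mult_right_mono)
      finally have l2: "- ((1 + a' / 8) * gx * \<Delta>) \<le> g (w n x) - g (w n (tau n \<zeta>))" by simp
      \<comment> \<open>The small slope gives \<open>2 / P \<ge> 1 + a' / 4\<close>, while
        \<open>g1\<close> varies by a factor of at most \<open>1 + a' / 8\<close>; the difference is
        the surplus counted in \<open>k\<close>.\<close>
      have "(1 + a' / 4) * P n x \<le> (1 + a' / 4) * (2 - a' / 2)" using Px a'_bounds by (intro mult_left_mono) auto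
      also have "\<dots> \<le> 2" using a2 by (simp add: algebra_simps power2_eq_square)
      finally have "(1 + a' / 4) \<le> 2 / P n x" using Pxp by (simp add: field_simps)
      then have "(1 + a' / 4) * (\<Delta> * gx) \<le> 2 / P n x * (\<Delta> * gx)" using \<Delta>0 gp by (intro mult_right_mono) auto
      also have "\<dots> = 2 * (\<Delta> / v n x)" unfolding P_def gx_def[symmetric] using gp by simp
      finally have l3: "(1 + a' / 4) * (\<Delta> * gx) \<le> 2 * (\<Delta> / v n x)" .
      have l4: "k * G n \<le> (a' / 8) * (\<Delta> * gx)"
      proof -
        have gmx: "gm n / C \<le> gx" using pack rx C by (simp add: gx_def field_simps)
        have "k * G n = (a' / 8) * ((d/2 * ym n) * (gm n / C))"
          unfolding k_def using mun by (auto simp: field_simps)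
        also have "\<dots> \<le> (a' / 8) * (\<Delta> * gx)"
          using gmx \<Delta> \<Delta>0 gp C a'_bounds by (intro mult_left_mono mult_mono) auto
        finally show ?thesis .
      qed
      have up: "ln (Y n (tau n \<zeta>)) - CH + (ln gx - ln g\<zeta>) + (g (w n x) - g (w n (tau n \<zeta>))) + 2 * (\<Delta> / v n x) \<le> ln (Y n x)"
        unfolding gx_def g\<zeta>_def \<Delta>_def by (rule ln_Y_lower) (use rx x\<zeta> in auto)
      have "ln (Y n x) \<le> 0" using x(3) e0 Y_pos[OF rx(1,2)] by simp
      with up l1 l2 l3 l4 have A: "ln (Y n (tau n \<zeta>)) + k * G n \<le> CH + 1" by (simp add: algebra_simps)
      have "ln (Y n (T n)) - CH + (ln g\<zeta> - ln (g1 (w n (T n)))) + (g (w n (tau n \<zeta>)) - g (w n (T n)))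
         + 2 * ((w n (T n) - w n (tau n \<zeta>)) / v n (tau n \<zeta>)) \<le> ln (Y n (tau n \<zeta>))"
        unfolding g\<zeta>_def by (rule ln_Y_lower) (use t\<zeta> \<zeta>T in auto)
      moreover have "ln g\<zeta> - ln (g1 (w n (T n))) = ln (g\<zeta> / gm n) - ln (g1 (w n (T n)) / gm n)"
        using gp by (simp add: ln_div)
      moreover have "(g (w n (tau n \<zeta>)) - g (w n (T n))) + 2 * ((w n (T n) - w n (tau n \<zeta>)) / v n (tau n \<zeta>))
         = (g (w n (tau n \<zeta>)) / G n - g (w n (T n)) / G n + 2 * (\<zeta> - zz n (T n)) / Sn n \<zeta>) * G n"
      proof -
        have v\<zeta>: "0 < v n (tau n \<zeta>)" using v_pos t\<zeta> by blast
        have "w n (T n) - w n (tau n \<zeta>) = (\<zeta> - zz n (T n)) * ym n"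
          using t\<zeta> zz_level[of n "T n"] mun by (simp add: algebra_simps)
        moreover have "(\<zeta> - zz n (T n)) * ym n / v n (tau n \<zeta>) = (\<zeta> - zz n (T n)) * G n / Sn n \<zeta>"
          unfolding Sn_def by (rule ym_div) (use mun in auto)
        ultimately have "(w n (T n) - w n (tau n \<zeta>)) / v n (tau n \<zeta>) = (\<zeta> - zz n (T n)) * G n / Sn n \<zeta>" by metis
        then show ?thesis using mun by (simp add: algebra_simps)
      qed
      moreover have "- k / 2 * G n \<le> (g (w n (tau n \<zeta>)) / G n - g (w n (T n)) / G n + 2 * (\<zeta> - zz n (T n)) / Sn n \<zeta>) * G n"
        using gT mun by (intro mult_right_mono) auto
      ultimately have "L - CH - k / 2 * G n \<le> ln (Y n (tau n \<zeta>))" using YTn unfolding g\<zeta>_def by simp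
      with A have "k / 2 * G n \<le> 2 * CH + 1 - L" by simp
      moreover have "2 * CH + 1 - L < k/2 * G n" using big mun by (simp add: pos_divide_less_eq)
      ultimately show False by simp
    qed
  qed
qed

text \<open>Slightly above \<open>s'\<close> the limit of the energy is known from
  \<open>Q_lim_tau\<close>. It changes little up to the peak, where it equals
  \<open>Y\<close>.\<close>

lemma bubble_next: "bubble s' a'"
proof -
  obtain T' where T': "\<forall>\<^sub>F n in sequentially. 0 < T' n \<and> P n (T' n) = 2" "(\<lambda>n. \<bar>zz n (T' n) - s'\<bar>) \<longlonglongrightarrow> 0"
    by (rule choose_sequence[where R = "\<lambda>n t. 0 < t \<and> P n t = 2" and d = "\<lambda>n t. \<bar>zz n t - s'\<bar>", OF second_bubble_near]) auto
  have zT': "(\<lambda>n. zz n (T' n)) \<longlonglongrightarrow> s'" using T'(2) by (simp add: tendsto_rabs_zero_iff LIM_zero_iff)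
  have T'pos: "\<forall>\<^sub>F n in sequentially. 0 < T' n" using T'(1) by eventually_elim auto
  obtain Z where Z: "s' < Z" "kap * Z < 1" using kap_room[OF s(3)] .
  have Z0: "0 \<le> Z" using Z s by simp
  have "(\<lambda>n. Y n (T' n)) \<longlonglongrightarrow> a'\<^sup>2 / 2"
  proof (rule tendstoI)
    fix e :: real assume e: "0 < e"
    have "((\<lambda>d. (E1 (s' - d) * S - 2)\<^sup>2 / 2) \<longlongrightarrow> (E1 s' * S - 2)\<^sup>2 / 2) (at_right 0)"
      by (intro tendsto_intros E1_lims) auto
    moreover have "(E1 s' * S - 2)\<^sup>2 / 2 = a'\<^sup>2 / 2" by (simp add: a'_def power2_commute)
    ultimately have "\<forall>\<^sub>F d in at_right 0. dist ((E1 (s' - d) * S - 2)\<^sup>2 / 2) (a'\<^sup>2 / 2) < e/4"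
      using e by (intro tendstoD) auto
    moreover have "((\<lambda>d. AQ * (ln (E1 (s' - d)) - ln (E1 s'))) \<longlongrightarrow> AQ * (ln (E1 s') - ln (E1 s'))) (at_right 0)"
      using E1_pos[OF s(3)] by (intro tendsto_intros E1_lims) auto
    then have "\<forall>\<^sub>F d in at_right 0. AQ * (ln (E1 (s' - d)) - ln (E1 s')) < e/4"
      by (rule order_tendstoD) (use e in simp)
    moreover have "\<forall>\<^sub>F d in at_right 0. d < s' - s"
      by (rule order_tendstoD(2)[OF tendsto_ident_at]) (use s in simp)
    ultimately have "\<forall>\<^sub>F d in at_right 0. dist ((E1 (s' - d) * S - 2)\<^sup>2 / 2) (a'\<^sup>2 / 2) < e/4 \<and>
        AQ * (ln (E1 (s' - d)) - ln (E1 s')) < e/4 \<and> d < s' - s \<and> 0 < d"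
      using eventually_at_right_less[of 0] by eventually_elim auto
    then obtain d where d: "dist ((E1 (s' - d) * S - 2)\<^sup>2 / 2) (a'\<^sup>2 / 2) < e/4"
        "AQ * (ln (E1 (s' - d)) - ln (E1 s')) < e/4" "d < s' - s" "0 < d"
      using eventually_happens[of _ "at_right (0::real)"] by auto
    define z where "z = s' - d"
    have z: "s < z" "z < s'" "0 < z" "kap * z < 1" using d s kap_mult_less[of z s'] by (auto simp: z_def)
    have e4: "0 < e/4" using e by simp
    have ev1: "\<forall>\<^sub>F n in sequentially. dist (Q n (tau n z)) ((E1 z * S - 2)\<^sup>2 / 2) < e/4"
      by (rule tendstoD[OF Q_lim_tau[OF z(1,2)] e4])
    have "(\<lambda>n. AQ * (ln (g1 (w n (tau n z)) / gm n) - ln (g1 (w n (T' n)) / gm n))) \<longlonglongrightarrow> AQ * (ln (E1 z) - ln (E1 s'))"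
      using E1_pos[OF s(3)] E1_pos[OF z(4)] by (intro tendsto_intros tau_lims time_lims(2)[OF zT' s(3) T'pos] z) auto
    then have ev2: "\<forall>\<^sub>F n in sequentially. AQ * (ln (g1 (w n (tau n z)) / gm n) - ln (g1 (w n (T' n)) / gm n)) < e/4"
      by (rule order_tendstoD) (use d in \<open>simp add: z_def\<close>)
    have ev3: "\<forall>\<^sub>F n in sequentially. z < zz n (T' n)" by (rule order_tendstoD(1)[OF zT' z(2)])
    have ev4: "\<forall>\<^sub>F n in sequentially. zz n (T' n) < Z" by (rule order_tendstoD(2)[OF zT' Z(1)])
    have ev5: "\<forall>\<^sub>F n in sequentially. t0 < w n (T' n)"
      using time_lims(3)[OF zT' s(3) T'pos] by (simp add: filterlim_at_top_dense)
    show "\<forall>\<^sub>F n in sequentially. dist (Y n (T' n)) (a'\<^sup>2 / 2) < e"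
      using ev1 ev2 ev3 ev4 ev5 Q_cont[OF Z0 Z(2) e4] T'(1) ev_tau[OF z(3,4)] ev_top
    proof eventually_elim
      case (elim n)
      have lt: "T' n < tau n z" using zz_less_imp[of n "T' n" "tau n z"] elim by simp
      have gp: "0 < g1 (w n (T' n))" "0 < g1 (w n (tau n z))" "0 < gm n" using g1_pos elim by auto
      have "\<bar>Q n (tau n z) - Q n (T' n)\<bar> \<le> AQ * (ln (g1 (w n (tau n z))) - ln (g1 (w n (T' n)))) + e/4"
        using elim(6,7,4) lt by simp
      also have "ln (g1 (w n (tau n z))) - ln (g1 (w n (T' n))) = ln (g1 (w n (tau n z)) / gm n) - ln (g1 (w n (T' n)) / gm n)"
        using gp by (simp add: ln_div)
      finally have "\<bar>Q n (tau n z) - Q n (T' n)\<bar> < e/2" using elim(2) by linarith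
      moreover have "Q n (T' n) = Y n (T' n)" using Q_P2 elim by blast
      ultimately show ?case using elim(1) d(1) unfolding z_def dist_real_def by linarith
    qed
  qed
  then show ?thesis unfolding bubble_def using T'(1) zT' by (intro exI[of _ T']) auto
qed

end

context profiles begin

lemma bubble_step:
  assumes "bubble s a" "0 \<le> s" "s < s'" "kap * s' < 1" "0 < a" "S * E1 s = 2 + a" "E s' - E s + 2 * (s' - s) / S = 0"
  shows "bubble s' (2 - E1 s' * S)" "0 < 2 - E1 s' * S"
proof -
  obtain T where T: "\<forall>\<^sub>F n in sequentially. 0 < T n \<and> P n (T n) = 2" "(\<lambda>n. zz n (T n)) \<longlonglongrightarrow> s" "(\<lambda>n. Y n (T n)) \<longlonglongrightarrow> a\<^sup>2 / 2"
    using assms(1) unfolding bubble_def by blast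
  interpret b: bubble_step g g1 g2 t0 q ff hh H Hb hlo hhi lam mu w v T s a s' S
    by unfold_locales (use T assms in auto)
  show "bubble s' (2 - E1 s' * S)" "0 < 2 - E1 s' * S"
    using b.bubble_next b.a'_bounds by (auto simp: b.a'_def)
qed

end

section \<open>Consequences of infinitely many peaks\<close>

text \<open>What the final claims need from the peaks, independently of the recursion that produces
  them. \<open>ss_cofinal\<close> supplies levels at which \<open>E\<close> is arbitrarily
  small.\<close>

locale bubble_tower = profiles +
  fixes TT :: "nat \<Rightarrow> nat \<Rightarrow> real" and ss aa :: "nat \<Rightarrow> real"
  assumes TT: "\<forall>\<^sub>F n in sequentially. 0 < TT k n \<and> P n (TT k n) = 2"
    and zTT: "(\<lambda>n. zz n (TT k n)) \<longlonglongrightarrow> ss k"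
    and YTT: "(\<lambda>n. Y n (TT k n)) \<longlonglongrightarrow> (aa k)\<^sup>2 / 2"
    and kss: "kap * ss k < 1" and aa_pos: "0 < aa k"
    and ss_cofinal: "kap * z < 1 \<Longrightarrow> \<exists>k. z < ss k"
begin

lemma TT_pos: "\<forall>\<^sub>F n in sequentially. 0 < TT k n" using TT[of k] by eventually_elim auto

lemmas TT_lims = time_lims[OF zTT kss TT_pos]

lemma w_nonneg: assumes "0 < t" shows "0 \<le> w n t"
proof (rule tendsto_upperbound[OF w_zero])
  show "\<forall>\<^sub>F x in at_right 0. w n x \<le> w n t"
    using order_tendstoD(2)[OF tendsto_ident_at[of "0::real" "{0<..}"] assms] eventually_at_right_less[of 0]
    by eventually_elim (use w_mono in auto)
qed simp

text \<open>Concavity together with the boundary value 0 at \<open>t = 0\<close>, that is at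
  \<open>r = 1\<close>.\<close>

lemma w_ge_slope: assumes "0 < t" shows "v n t * t \<le> w n t"
proof (rule tendsto_upperbound)
  show "((\<lambda>x. v n t * (t - x)) \<longlongrightarrow> v n t * t) (at_right 0)"
    by (rule tendsto_eq_intros refl | simp)+
  show "\<forall>\<^sub>F x in at_right 0. v n t * (t - x) \<le> w n t"
    using order_tendstoD(2)[OF tendsto_ident_at[of "0::real" "{0<..}"] assms] eventually_at_right_less[of 0]
  proof eventually_elim
    case (elim x)
    then show ?case using w_diff(1)[of x t n] w_nonneg[of x n] by simp
  qed
qed simp

text \<open>The bound \<open>P \<ge> c\<close> is a slope bound at height \<open>M\<close>, and
  concavity from the boundary puts this height at a time of at most \<open>M / b\<close>. With the
  time bounded, \<open>Y \<le> Y0\<close> becomes a bound for \<open>lam\<close>.\<close>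

lemma bounds_at_fixed_height:
  obtains M c b L where "t0 < M" "0 < c" "0 < b" "0 < L"
    "\<forall>\<^sub>F n in sequentially. lam n \<le> L \<and> (\<exists>t. 0 < t \<and> t \<le> TT 0 n \<and> w n t = M \<and> t \<le> M / b \<and> b \<le> v n t) \<and>
       (\<forall>t. 0 < t \<longrightarrow> t \<le> TT 0 n \<longrightarrow> M \<le> w n t \<longrightarrow> c \<le> P n t)"
proof -
  obtain M c where Mc: "t0 < M" "0 < c" "c \<le> 2"
    and low: "\<forall>n t T. 0 < t \<longrightarrow> t \<le> T \<longrightarrow> M \<le> w n t \<longrightarrow> c \<le> P n T \<longrightarrow> c \<le> P n t"
    using P_lower .
  define b where "b = c / g1 M"
  have gM: "0 < g1 M" using g1_pos Mc by blast
  have b: "0 < b" using Mc gM by (simp add: b_def)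
  define L where "L = Y0 * exp (2 * (M / b)) / (g1 M * hlo * exp (g M))"
  have L: "0 < L" using Y0_ge_1 gM hlo_pos by (simp add: L_def)
  have M0: "0 < M" using Mc t0_nonneg by simp
  have ev1: "\<forall>\<^sub>F n in sequentially. M < w n (TT 0 n)"
    using TT_lims(3)[of 0] by (simp add: filterlim_at_top_dense)
  have "\<forall>\<^sub>F n in sequentially. lam n \<le> L \<and> (\<exists>t. 0 < t \<and> t \<le> TT 0 n \<and> w n t = M \<and> t \<le> M / b \<and> b \<le> v n t) \<and>
       (\<forall>t. 0 < t \<longrightarrow> t \<le> TT 0 n \<longrightarrow> M \<le> w n t \<longrightarrow> c \<le> P n t)"
    using ev1 TT[of 0]
  proof eventually_elim
    case (elim n)
    have all: "c \<le> P n t" if "0 < t" "t \<le> TT 0 n" "M \<le> w n t" for t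
    proof -
      have "c \<le> P n (TT 0 n)" using elim Mc by simp
      then show ?thesis using low that by blast
    qed
    have Mmu: "M < mu n" using elim w_le_mu[of "TT 0 n" n] by simp
    obtain t where t: "0 < t" "w n t = M" using level_exists[OF M0 Mmu] .
    have tT: "t \<le> TT 0 n" using w_less_imp[of t "TT 0 n" n] t elim by simp
    have "c \<le> P n t" using all[OF t(1) tT] t by simp
    then have bv: "b \<le> v n t" using gM t by (simp add: P_def b_def field_simps)
    have "b * t \<le> v n t * t" using bv t by (intro mult_right_mono) auto
    also have "\<dots> \<le> M" using w_ge_slope[OF t(1), of n] t by simp
    finally have tM: "t \<le> M / b" using b by (simp add: field_simps)
    have "g1 M * (lam n * exp (- 2 * t) * hh t * exp (g M)) \<le> Y0" using Y_le[OF t(1), of n] t Mc by (simp add: Y_def)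
    moreover have "g1 M * (lam n * exp (- 2 * (M / b)) * hlo * exp (g M)) \<le> g1 M * (lam n * exp (- 2 * t) * hh t * exp (g M))"
      by (intro mult_left_mono mult_right_mono mult_mono) (use tM hh_bounds(1)[OF t(1)] hlo_pos lam_pos[of n] gM in auto)
    ultimately have "lam n * (g1 M * hlo * exp (g M)) * exp (- 2 * (M / b)) \<le> Y0" by (simp add: mult_ac)
    then have "lam n * (g1 M * hlo * exp (g M)) * exp (- 2 * (M / b)) * exp (2 * (M / b)) \<le> Y0 * exp (2 * (M / b))" by simp
    then have "lam n * (g1 M * hlo * exp (g M)) \<le> Y0 * exp (2 * (M / b))"
      by (simp add: mult.assoc exp_add[symmetric])
    then have "lam n \<le> L" unfolding L_def using gM hlo_pos by (simp add: pos_le_divide_eq)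
    then show ?case using t tT tM bv all by blast
  qed
  then show ?thesis using that Mc b L by blast
qed

section \<open>Limits for solution values, parameters, radii and integrals\<close>

lemma filterlim_gm: "filterlim gm at_top sequentially"
  unfolding gm_def[abs_def] by (rule filterlim_compose[OF filterlim_g1 mu_lim])

text \<open>At a fixed time the profile stays above \<open>min M (b * t)\<close>: either height
  \<open>M\<close> has been reached, or the slope is still at least \<open>b\<close>.\<close>

lemma gm_times_w:
  assumes t: "0 < t" shows "filterlim (\<lambda>n. gm n * w n t) at_top sequentially"
proof -
  obtain M c b L where Mb: "t0 < M" "0 < c" "0 < b" "0 < L"
    and ev: "\<forall>\<^sub>F n in sequentially. lam n \<le> L \<and> (\<exists>t. 0 < t \<and> t \<le> TT 0 n \<and> w n t = M \<and> t \<le> M / b \<and> b \<le> v n t) \<and>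
       (\<forall>t. 0 < t \<longrightarrow> t \<le> TT 0 n \<longrightarrow> M \<le> w n t \<longrightarrow> c \<le> P n t)"
    using bounds_at_fixed_height .
  define m where "m = min M (b * t)"
  have m: "0 < m" using Mb t t0_nonneg by (simp add: m_def)
  have "filterlim (\<lambda>n. m * gm n) at_top sequentially"
    by (rule filterlim_tendsto_pos_mult_at_top[OF tendsto_const m filterlim_gm])
  then show ?thesis
  proof (rule filterlim_at_top_mono)
    show "\<forall>\<^sub>F n in sequentially. m * gm n \<le> gm n * w n t"
      using ev ev_top
    proof eventually_elim
      case (elim n)
      then obtain s where s: "0 < s" "w n s = M" "b \<le> v n s" by blast
      have "m \<le> w n t"
      proof (cases "s \<le> t")
        case True
        then show ?thesis using w_mono[OF s(1) True, of n] s by (simp add: m_def)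
      next
        case False
        then have "b \<le> v n t" using v_antimono[of t s n] s t by simp
        then have "b * t \<le> v n t * t" using t by (intro mult_right_mono) auto
        then show ?thesis using w_ge_slope[OF t, of n] by (simp add: m_def)
      qed
      then show ?case using elim by (simp add: mult.commute mult_left_mono)
    qed
  qed
qed

text \<open>This is \<open>ln_Y\<close> at a peak, solved for \<open>2 * t - ln lam\<close> and
  divided by \<open>G\<close>. Since \<open>Y\<close> has a positive limit there, only
  \<open>g w / G\<close> survives.\<close>

lemma time_lambda_lim:
  "(\<lambda>n. 2 * TT k n / G n - ln (lam n) / G n) \<longlonglongrightarrow> E (ss k)"
proof -
  let ?w = "\<lambda>n. w n (TT k n)"
  have Ginv: "(\<lambda>n. inverse (G n)) \<longlonglongrightarrow> 0"
    by (rule filterlim_compose[OF tendsto_inverse_0_at_top[OF filterlim_ident] filterlim_G])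
  have 1: "(\<lambda>n. ln (g1 (?w n)) / g (?w n) * (g (?w n) / G n)) \<longlonglongrightarrow> 0 * E (ss k)"
    by (intro tendsto_mult TT_lims filterlim_compose[OF ln_g1_over_g TT_lims(3)])
  have 2: "(\<lambda>n. ln (hh (TT k n)) * inverse (G n)) \<longlonglongrightarrow> 0"
  proof (rule Lim_null_comparison)
    show "\<forall>\<^sub>F n in sequentially. norm (ln (hh (TT k n)) * inverse (G n)) \<le> (\<bar>ln (hh 1)\<bar> + CH) * inverse (G n)"
      using TT_pos[of k] ev_top
    proof eventually_elim
      case (elim n)
      have "\<bar>ln (hh (TT k n))\<bar> \<le> \<bar>ln (hh 1)\<bar> + CH" using ln_hh_diff[OF elim(1), of 1] by linarith
      then show ?case using elim by (simp add: abs_mult mult_right_mono)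
    qed
    show "(\<lambda>n. (\<bar>ln (hh 1)\<bar> + CH) * inverse (G n)) \<longlonglongrightarrow> 0"
      using tendsto_mult[OF tendsto_const Ginv] by simp
  qed
  have 3: "(\<lambda>n. ln (Y n (TT k n)) * inverse (G n)) \<longlonglongrightarrow> ln ((aa k)\<^sup>2 / 2) * 0"
    using aa_pos[of k] by (intro tendsto_mult tendsto_ln YTT Ginv) simp
  have "(\<lambda>n. g (?w n) / G n + ln (g1 (?w n)) / g (?w n) * (g (?w n) / G n) + ln (hh (TT k n)) * inverse (G n)
     - ln (Y n (TT k n)) * inverse (G n)) \<longlonglongrightarrow> E (ss k) + 0 * E (ss k) + 0 - ln ((aa k)\<^sup>2 / 2) * 0"
    by (intro tendsto_intros TT_lims 1 2 3)
  then have "(\<lambda>n. g (?w n) / G n + ln (g1 (?w n)) / g (?w n) * (g (?w n) / G n) + ln (hh (TT k n)) * inverse (G n)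
     - ln (Y n (TT k n)) * inverse (G n)) \<longlonglongrightarrow> E (ss k)" by simp
  moreover have "\<forall>\<^sub>F n in sequentially. t0 < ?w n" "\<forall>\<^sub>F n in sequentially. 0 < g (?w n)"
    using TT_lims(3)[of k] filterlim_compose[OF filterlim_g TT_lims(3)[of k]] by (auto simp: filterlim_at_top_dense)
  then have "\<forall>\<^sub>F n in sequentially. g (?w n) / G n + ln (g1 (?w n)) / g (?w n) * (g (?w n) / G n) + ln (hh (TT k n)) * inverse (G n)
     - ln (Y n (TT k n)) * inverse (G n) = 2 * TT k n / G n - ln (lam n) / G n"
    using TT_pos[of k] ev_top
  proof eventually_elim
    case (elim n)
    have eq: "2 * TT k n - ln (lam n) = g (?w n) + ln (g1 (?w n)) + ln (hh (TT k n)) - ln (Y n (TT k n))"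
      using ln_Y[OF elim(3,1)] by simp
    have "2 * TT k n / G n - ln (lam n) / G n = (2 * TT k n - ln (lam n)) / G n" by (simp add: diff_divide_distrib)
    then show ?case unfolding eq using elim by (simp add: add_divide_distrib diff_divide_distrib divide_inverse[symmetric])
  qed
  ultimately show ?thesis by (simp add: tendsto_cong)
qed

lemma E_ss_small: assumes "0 < e" obtains k where "E (ss k) < e"
proof -
  obtain Z where Z: "0 \<le> Z" "kap * Z < 1" "E1 Z < e" using E1_small[OF assms, of 0] by auto
  obtain k where k: "Z < ss k" using ss_cofinal[OF Z(2)] by blast
  have "kap * ss k \<ge> 0" using k Z kap_nonneg by simp
  then have "E (ss k) \<le> E1 (ss k)" using kss[of k] E_pos[of "ss k"] by (simp add: E1_def pos_le_divide_eq mult_left_le)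
  also have "\<dots> < E1 Z" by (rule E1_strict_antimono[OF k kss])
  finally have "E (ss k) < e" using Z by simp
  then show ?thesis by (rule that)
qed

text \<open>\<open>lam\<close> is bounded above. For the lower bound, peak times are positive, so
  \<open>time_lambda_lim\<close> keeps \<open>- ln lam / G\<close> below nearly
  \<open>E (ss k)\<close>, which is small for a suitable level.\<close>

lemma ln_lam_lim: "(\<lambda>n. ln (lam n) / G n) \<longlonglongrightarrow> 0"
proof (rule tendstoI)
  fix e :: real assume e: "0 < e"
  obtain M c b L where Mb: "t0 < M" "0 < c" "0 < b" "0 < L"
    and ev: "\<forall>\<^sub>F n in sequentially. lam n \<le> L \<and> (\<exists>t. 0 < t \<and> t \<le> TT 0 n \<and> w n t = M \<and> t \<le> M / b \<and> b \<le> v n t) \<and>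
       (\<forall>t. 0 < t \<longrightarrow> t \<le> TT 0 n \<longrightarrow> M \<le> w n t \<longrightarrow> c \<le> P n t)"
    using bounds_at_fixed_height .
  obtain k where k: "E (ss k) < e" using E_ss_small[OF e] .
  have ev1: "\<forall>\<^sub>F n in sequentially. 2 * TT k n / G n - ln (lam n) / G n < e"
    by (rule order_tendstoD(2)[OF time_lambda_lim k])
  show "\<forall>\<^sub>F n in sequentially. dist (ln (lam n) / G n) 0 < e"
    using ev1 ev TT_pos[of k] ev_top ev_const_div_G[OF e, of "ln L"]
  proof eventually_elim
    case (elim n)
    have "0 < 2 * TT k n / G n" using elim by simp
    then have "- e < ln (lam n) / G n" using elim by linarith
    moreover have "ln (lam n) / G n \<le> ln L / G n" using elim lam_pos[of n] Mb by (intro divide_right_mono) auto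
    ultimately show ?case using elim by (simp add: dist_real_def)
  qed
qed

lemma time_lim: "(\<lambda>n. TT k n / G n) \<longlonglongrightarrow> E (ss k) / 2"
proof -
  have "(\<lambda>n. ((2 * TT k n / G n - ln (lam n) / G n) + ln (lam n) / G n) / 2) \<longlonglongrightarrow> (E (ss k) + 0) / 2"
    by (intro tendsto_intros time_lambda_lim ln_lam_lim) simp
  then show ?thesis by simp
qed

text \<open>\<open>N n t\<close> stands for the integral up to radius \<open>exp (- t)\<close>. Its
  derivative being \<open>- Y\<close>, the function \<open>P - N - c * ln (g1 w)\<close> has
  derivative \<open>eps * P * (P - c) \<ge> 0\<close>. Hence \<open>N\<close> is at least
  \<open>c\<close> times the drop of \<open>ln (g1 w)\<close> below the peak of index 0, minus the
  value 2 of \<open>P\<close> at that peak, and the drop is unbounded as the depth grows.\<close>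

lemma integral_diverges:
  fixes N :: "nat \<Rightarrow> real \<Rightarrow> real" and ff1 :: "real \<Rightarrow> real"
  assumes N: "\<And>n t. 0 < t \<Longrightarrow> (N n has_real_derivative - (lam n * exp (- 2 * t) * hh t * ff1 (w n t))) (at t)"
    and N0: "\<And>n. (N n \<longlongrightarrow> 0) at_top"
    and ff1: "\<And>x. t0 < x \<Longrightarrow> ff1 x = g1 x * exp (g x)" and bnd: "\<And>M. \<exists>B. \<forall>x\<in>{0..M}. \<bar>ff1 x\<bar> \<le> B"
    and tt: "\<And>n. 0 < tt n" and ztt: "\<And>z. kap * z < 1 \<Longrightarrow> \<forall>\<^sub>F n in sequentially. z < zz n (tt n)"
  shows "filterlim (\<lambda>n. N n (tt n)) at_top sequentially"
  unfolding filterlim_at_top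
proof
  fix R :: real
  obtain M c b L where Mb: "t0 < M" "0 < c" "0 < b" "0 < L"
    and ev: "\<forall>\<^sub>F n in sequentially. lam n \<le> L \<and> (\<exists>t. 0 < t \<and> t \<le> TT 0 n \<and> w n t = M \<and> t \<le> M / b \<and> b \<le> v n t) \<and>
       (\<forall>t. 0 < t \<longrightarrow> t \<le> TT 0 n \<longrightarrow> M \<le> w n t \<longrightarrow> c \<le> P n t)"
    using bounds_at_fixed_height .
  have M0: "0 < M" using Mb t0_nonneg by simp
  obtain B where "\<forall>x\<in>{0..M}. \<bar>ff1 x\<bar> \<le> B" using bnd[of M] by blast
  then have B: "\<And>x. 0 \<le> x \<Longrightarrow> x \<le> M \<Longrightarrow> \<bar>ff1 x\<bar> \<le> B" by simp
  define K where "K = L * hhi * B * (M / b)"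
  \<comment> \<open>The 2 is the value of \<open>P\<close> at the peak, and \<open>K\<close> pays
    for the heights below \<open>M\<close>.\<close>
  define R' where "R' = (\<bar>R\<bar> + 2 + \<bar>K\<bar>) / c + 1"
  obtain Z where Z: "0 < Z" "ss 0 < Z" "kap * Z < 1" "E1 Z < E1 (ss 0) * exp (- R')"
  proof -
    obtain Z0 where Z0: "max (ss 0) 0 < Z0" "kap * Z0 < 1"
    proof -
      have "kap * max (ss 0) 0 < 1" using kss[of 0] by (simp add: max_def)
      then show ?thesis using kap_room that by blast
    qed
    have "0 < E1 (ss 0) * exp (- R')" using E1_pos[OF kss[of 0]] by simp
    then obtain Z where "Z0 \<le> Z" "kap * Z < 1" "E1 Z < E1 (ss 0) * exp (- R')" using E1_small Z0(2) by blast
    then show ?thesis using that[of Z] Z0 by simp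
  qed
  have l: "(\<lambda>n. ln (g1 (w n (TT 0 n)) / gm n) - ln (g1 (w n (tau n Z)) / gm n)) \<longlonglongrightarrow> ln (E1 (ss 0)) - ln (E1 Z)"
    using E1_pos[OF kss[of 0]] E1_pos[OF Z(3)] by (intro tendsto_intros TT_lims tau_lims Z(1,3)) auto
  have "ln (E1 Z) < ln (E1 (ss 0) * exp (- R'))" using Z(4) E1_pos[OF Z(3)] by (simp del: ln_exp)
  also have "\<dots> = ln (E1 (ss 0)) - R'" using E1_pos[OF kss[of 0]] by (simp add: ln_mult)
  finally have "R' < ln (E1 (ss 0)) - ln (E1 Z)" by simp
  from order_tendstoD(1)[OF l this]
  have ev1: "\<forall>\<^sub>F n in sequentially. R' < ln (g1 (w n (TT 0 n)) / gm n) - ln (g1 (w n (tau n Z)) / gm n)" .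
  have ev2: "\<forall>\<^sub>F n in sequentially. M < w n (tau n Z)"
    using tau_lims(3)[OF Z(1,3)] by (simp add: filterlim_at_top_dense)
  have ev3: "\<forall>\<^sub>F n in sequentially. zz n (TT 0 n) < Z" by (rule order_tendstoD(2)[OF zTT Z(2)])
  have ev4: "\<forall>\<^sub>F n in sequentially. t0 < w n (TT 0 n)"
    using TT_lims(3)[of 0] by (simp add: filterlim_at_top_dense)
  show "\<forall>\<^sub>F n in sequentially. R \<le> N n (tt n)"
    using ev ev1 ev2 ev3 ev4 ztt[OF Z(3)] ev_tau[OF Z(1,3)] TT[of 0] ev_top
  proof eventually_elim
    case (elim n)
    note T0 = elim(8)
    have tZ: "tt n < tau n Z" using zz_less_imp[of n "tt n" "tau n Z"] tt elim by simp
    have ZT: "tau n Z < TT 0 n" using zz_less_imp[of n "tau n Z" "TT 0 n"] elim by simp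
    obtain tM where tM: "0 < tM" "tM \<le> TT 0 n" "w n tM = M" "tM \<le> M / b" using elim(1) by blast
    have low: "c \<le> P n t" if "0 < t" "t \<le> TT 0 n" "M \<le> w n t" for t using elim(1) that by blast
    have lamL: "lam n \<le> L" using elim(1) by blast
    have N': "(N n has_real_derivative - Y n t) (at t)" if "0 < t" "t0 < w n t" for t
      using N[OF that(1), of n] ff1[OF that(2)] by (simp add: Y_def mult_ac)
    have NT: "0 \<le> N n (TT 0 n)"
    proof -
      have "- N n (TT 0 n) \<le> - 0"
      proof (rule DERIV_nonneg_le_lim[where F = "\<lambda>t. - N n t"])
        show "((\<lambda>t. - N n t) \<longlongrightarrow> - 0) at_top" by (intro tendsto_minus N0)
        fix x assume "TT 0 n \<le> x"
        then have x: "0 < x" "t0 < w n x" using T0 elim region_up[of "TT 0 n" x n] by auto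
        show "\<exists>y. ((\<lambda>t. - N n t) has_real_derivative y) (at x) \<and> 0 \<le> y"
          by (rule DERIV_nonnegI[OF DERIV_minus[OF N'[OF x]]]) (use Y_pos[OF x] in simp)
      qed
      then show ?thesis by simp
    qed
    have gp: "0 < g1 (w n (TT 0 n))" "0 < g1 (w n (tau n Z))" "0 < gm n" using g1_pos elim by auto
    have big: "\<bar>R\<bar> + 2 + \<bar>K\<bar> \<le> c * (ln (g1 (w n (TT 0 n))) - ln (g1 (w n (tau n Z))))"
    proof -
      have "R' < ln (g1 (w n (TT 0 n))) - ln (g1 (w n (tau n Z)))" using elim(2) gp by (simp add: ln_div)
      then have "c * R' \<le> c * (ln (g1 (w n (TT 0 n))) - ln (g1 (w n (tau n Z))))" using Mb by (intro mult_left_mono) auto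
      moreover have "c * R' = (\<bar>R\<bar> + 2 + \<bar>K\<bar>) + c" using Mb(2) unfolding R'_def by (simp only: distrib_left) simp
      ultimately show ?thesis using Mb(2) by linarith
    qed
    have up: "\<bar>R\<bar> + \<bar>K\<bar> \<le> N n t" if t: "0 < t" "t \<le> tau n Z" "M \<le> w n t" for t
    proof -
      let ?F = "\<lambda>t. P n t - N n t - c * ln (g1 (w n t))"
      have rt: "t \<le> TT 0 n" "t0 < w n t" using t ZT Mb by auto
      have "?F t \<le> ?F (TT 0 n)"
      proof (rule DERIV_nonneg_imp_nondecreasing[where f = ?F, OF rt(1)])
        fix x assume x: "t \<le> x" "x \<le> TT 0 n"
        then have rx: "0 < x" "t0 < w n x" "M \<le> w n x" using t rt region_up[of t x n] w_mono[of t x n] by auto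
        have "(?F has_real_derivative (eps (w n x) * (P n x)\<^sup>2 - Y n x) - (- Y n x) - c * (eps (w n x) * P n x)) (at x)"
          by (intro DERIV_diff DERIV_cmult P_deriv N' ln_g1w_deriv rx)
        moreover have "(eps (w n x) * (P n x)\<^sup>2 - Y n x) - (- Y n x) - c * (eps (w n x) * P n x) = (eps (w n x) * P n x) * (P n x - c)"
          by (simp add: algebra_simps power2_eq_square)
        moreover have "0 \<le> (eps (w n x) * P n x) * (P n x - c)"
          using epsP_nonneg[OF rx(1,2)] low[OF rx(1) x(2) rx(3)] by simp
        ultimately show "\<exists>y. (?F has_real_derivative y) (at x) \<and> 0 \<le> y" by metis
      qed
      moreover have "g1 (w n t) \<le> g1 (w n (tau n Z))" using rt w_mono[OF t(1,2)] by (intro g1_mono) auto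
      then have "c * ln (g1 (w n t)) \<le> c * ln (g1 (w n (tau n Z)))" using Mb g1_pos[OF rt(2)] by (intro mult_left_mono) auto
      moreover have "0 < P n t" using P_pos t rt by blast
      ultimately show ?thesis using NT T0 big by (simp add: algebra_simps)
    qed
    show "R \<le> N n (tt n)"
    proof (cases "M \<le> w n (tt n)")
      case True
      then show ?thesis using up[of "tt n"] tt tZ by fastforce
    next
      case False
      then have tM1: "tt n \<le> tM" using w_less_imp[of "tt n" tM n] tt tM by simp
      have "tM < tau n Z" using w_less_imp[of tM "tau n Z" n] tM elim by simp
      then have NM: "\<bar>R\<bar> + \<bar>K\<bar> \<le> N n tM" using up[of tM] tM by simp
      \<comment> \<open>Below height \<open>M\<close> the sign of \<open>ff1\<close> is not
        controlled, but time, \<open>lam\<close> and \<open>ff1\<close> are bounded there, so the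
        integral loses at most \<open>K\<close>.\<close>
      let ?F = "\<lambda>t. L * hhi * B * t - N n t"
      have B0: "0 \<le> B" using B[of 0] M0 by force
      have hi0: "0 \<le> hhi" using hh_bounds(2)[of 1] hh_pos[of 1] by simp
      have "?F (tt n) \<le> ?F tM"
      proof (rule DERIV_nonneg_imp_nondecreasing[where f = ?F, OF tM1])
        fix x assume x: "tt n \<le> x" "x \<le> tM"
        then have rx: "0 < x" "0 \<le> w n x" "w n x \<le> M" using tt[of n] w_nonneg[of x n] w_mono[of x tM n] tM by auto
        have "(?F has_real_derivative L * hhi * B * 1 - - (lam n * exp (- 2 * x) * hh x * ff1 (w n x))) (at x)"
          by (intro DERIV_diff DERIV_cmult N rx DERIV_ident)
        moreover have "\<bar>lam n * exp (- 2 * x) * hh x * ff1 (w n x)\<bar> \<le> L * 1 * hhi * B"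
          unfolding abs_mult by (intro mult_mono B rx) (use lamL lam_pos[of n] hh_bounds(2)[OF rx(1)] hh_pos[OF rx(1)] hi0 Mb rx in auto)
        ultimately show "\<exists>y. (?F has_real_derivative y) (at x) \<and> 0 \<le> y"
          by (intro exI conjI) (assumption, simp add: abs_le_iff)
      qed
      moreover have "L * hhi * B * (tM - tt n) \<le> K" unfolding K_def
        using tM tt[of n] Mb hi0 B0 by (intro mult_left_mono) auto
      ultimately have "N n tM - K \<le> N n (tt n)" by (simp add: algebra_simps)
      then show ?thesis using NM by simp
    qed
  qed
qed

end

section \<open>The recursive sequences\<close>

text \<open>In \<open>x = d' / d\<close> the equation has the trivial root 1, where the derivative
  is \<open>p - c > 0\<close> for \<open>c = 2 * p / (2 + a)\<close>. So the function is negative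
  just left of 1, and at 0 it equals \<open>c - 1 > 0\<close>.\<close>

lemma ex_delta:
  fixes a d p :: real
  assumes "0 < a" "2 + a < 2 * p" "2 < p" "0 < d"
  shows "\<exists>d'. 0 < d' \<and> d' < d \<and> 2 * p / (2 + a) * (1 - d' / d) - 1 + (d' / d) powr p = 0"
proof -
  define c where "c = 2 * p / (2 + a)"
  have "2 * p < p * (2 + a)" using assms by (simp add: distrib_left)
  then have c: "1 < c" "c < p" using assms by (auto simp: c_def pos_less_divide_eq pos_divide_less_eq)
  define \<phi> where "\<phi> x = c * (1 - x) - 1 + x powr p" for x :: real
  have "(\<phi> has_real_derivative c * (0 - 1) - 0 + p * 1 powr (p - 1)) (at 1)"
    unfolding \<phi>_def[abs_def] by (intro DERIV_add DERIV_diff DERIV_cmult DERIV_const DERIV_ident has_real_derivative_powr) simp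
  moreover have "0 < c * (0 - 1) - 0 + p * 1 powr (p - 1)" using c by simp
  ultimately obtain e where e: "0 < e" "\<And>h. 0 < h \<Longrightarrow> h < e \<Longrightarrow> \<phi> (1 - h) < \<phi> 1"
    using DERIV_pos_inc_left by blast
  define x1 where "x1 = 1 - min (e/2) (1/2)"
  have x1: "0 < x1" "x1 < 1" using e by (auto simp: x1_def)
  have "\<phi> x1 < \<phi> 1" unfolding x1_def using e(1) by (intro e(2)) (auto simp: min_def)
  then have neg: "\<phi> x1 \<le> 0" by (simp add: \<phi>_def)
  have pos: "0 < \<phi> 0" using c by (simp add: \<phi>_def)
  have "continuous_on {0..x1} \<phi>"
    unfolding \<phi>_def[abs_def] using assms by (intro continuous_intros continuous_on_powr') auto
  then obtain x where x: "0 \<le> x" "x \<le> x1" "\<phi> x = 0"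
    using IVT2'[of \<phi> x1 0 0] neg pos x1 by auto
  then have x0: "0 < x" using pos by (cases "x = 0") auto
  show ?thesis
  proof (intro exI[of _ "x * d"] conjI)
    show "2 * p / (2 + a) * (1 - x * d / d) - 1 + (x * d / d) powr p = 0"
      using x(3) assms(4) by (simp add: \<phi>_def c_def)
  qed (use x x0 x1 assms in auto)
qed

text \<open>As for \<open>ex_delta\<close>, but the logarithm rules out 0 as the left end; at
  \<open>x0 = exp (- (1 / c))\<close> the function equals \<open>x0 > 0\<close>.\<close>

lemma ex_eta:
  fixes a d :: real
  assumes "0 < a" "0 < d"
  shows "\<exists>d'. 0 < d' \<and> d' < d \<and> 2 / (2 + a) * ln (d / d') - 1 + d' / d = 0"
proof -
  define c where "c = 2 / (2 + a)"
  have c: "0 < c" "c < 1" using assms by (auto simp: c_def)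
  define \<phi> where "\<phi> x = c * (- ln x) - 1 + x" for x :: real
  have "(\<phi> has_real_derivative c * (- (1 / 1)) - 0 + 1) (at 1)"
    unfolding \<phi>_def[abs_def] by (intro DERIV_add DERIV_diff DERIV_cmult DERIV_const DERIV_ident DERIV_minus DERIV_ln_divide) simp
  moreover have "0 < c * (- (1 / 1)) - 0 + 1" using c by simp
  ultimately obtain e where e: "0 < e" "\<And>h. 0 < h \<Longrightarrow> h < e \<Longrightarrow> \<phi> (1 - h) < \<phi> 1"
    using DERIV_pos_inc_left by blast
  define x0 where "x0 = exp (- (1 / c))"
  have x0: "0 < x0" "x0 < 1" using c by (auto simp: x0_def)
  have pos: "0 < \<phi> x0" using c by (simp add: \<phi>_def x0_def)
  define m where "m = min (e/2) ((1 - x0) / 2)"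
  have "m \<le> e/2" "m \<le> (1 - x0) / 2" unfolding m_def by (rule min.cobounded1 min.cobounded2)+
  moreover have "0 < m" using e(1) x0 by (simp add: m_def)
  ultimately have m: "0 < m" "m < e" "x0 \<le> 1 - m" using x0 by simp_all
  define x1 where "x1 = 1 - m"
  have x1: "x0 \<le> x1" "x1 < 1" using m by (simp_all add: x1_def)
  have "\<phi> x1 < \<phi> 1" unfolding x1_def by (rule e(2)[OF m(1,2)])
  then have neg: "\<phi> x1 \<le> 0" by (simp add: \<phi>_def)
  have "continuous_on {x0..x1} \<phi>"
    unfolding \<phi>_def[abs_def] using x0 by (intro continuous_intros) auto
  then obtain x where x: "x0 \<le> x" "x \<le> x1" "\<phi> x = 0"
    using IVT2'[of \<phi> x1 0 x0] neg pos x1 by auto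
  have xp: "0 < x" using x x0 by simp
  show ?thesis
  proof (intro exI[of _ "x * d"] conjI)
    have "ln (d / (x * d)) = - ln x" using xp assms by (simp add: ln_div)
    then show "2 / (2 + a) * ln (d / (x * d)) - 1 + x * d / d = 0"
      using x(3) assms by (simp add: \<phi>_def c_def)
  qed (use x xp x1 assms in auto)
qed

lemma sinh_mult_ge:
  fixes p L :: real
  assumes "1 \<le> p" "0 \<le> L"
  shows "p * sinh L \<le> sinh (p * L)"
proof -
  have "sinh (p * 0) - p * sinh 0 \<le> sinh (p * L) - p * sinh L"
  proof (rule DERIV_nonneg_imp_nondecreasing[where f = "\<lambda>L. sinh (p * L) - p * sinh L", OF assms(2)])
    fix x :: real assume x: "0 \<le> x" "x \<le> L"
    have "1 * x \<le> p * x" using assms x by (intro mult_right_mono)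
    then have "cosh x \<le> cosh (p * x)" using x assms by (subst cosh_real_nonneg_le_iff) auto
    moreover have "((\<lambda>L. sinh (p * L) - p * sinh L) has_real_derivative p * (cosh (p * x) - cosh x)) (at x)"
      by (auto intro!: derivative_eq_intros simp: algebra_simps)
    ultimately show "\<exists>y. ((\<lambda>L. sinh (p * L) - p * sinh L) has_real_derivative y) (at x) \<and> 0 \<le> y"
      using assms by (intro exI[of _ "p * (cosh (p * x) - cosh x)"]) auto
  qed
  then show ?thesis by simp
qed

lemma sinh_ge: "0 \<le> (L::real) \<Longrightarrow> L \<le> sinh L"
proof -
  assume L: "0 \<le> L"
  have "sinh 0 - 0 \<le> sinh L - L"
  proof (rule DERIV_nonneg_imp_nondecreasing[where f = "\<lambda>L. sinh L - L", OF L])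
    fix x :: real
    have "((\<lambda>L. sinh L - L) has_real_derivative cosh x - 1) (at x)"
      by (auto intro!: derivative_eq_intros)
    then show "\<exists>y. ((\<lambda>L. sinh L - L) has_real_derivative y) (at x) \<and> 0 \<le> y"
      using cosh_real_ge_1[of x] by (intro exI[of _ "cosh x - 1"]) auto
  qed
  then show ?thesis by simp
qed

text \<open>Both inequalities are \<open>sinh\<close>-estimates in \<open>L = - ln x\<close>.\<close>

lemma amplitude_ratio_powr:
  fixes x p :: real
  assumes x: "0 < x" "x < 1" and p: "1 \<le> p" and a: "0 < 2 + a" and root: "2 * p / (2 + a) * (1 - x) - 1 + x powr p = 0"
  shows "x powr p * a \<le> 2 - x powr (p - 1) * (2 + a)"
proof -
  define L where "L = - ln x"
  have L: "0 \<le> L" "x = exp (- L)" using x by (auto simp: L_def)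
  have xp: "x powr p = exp (- (p * L))" "x powr (p - 1) = exp (- (p * L)) * exp L"
    using x by (auto simp: powr_def L_def exp_add[symmetric] algebra_simps)
  have "p * (exp L - exp (- L)) \<le> exp (p * L) - exp (- (p * L))"
    using sinh_mult_ge[OF p L(1)] by (simp add: sinh_field_def field_simps)
  then have "exp (- (p * L)) * (p * (exp L - exp (- L))) \<le> exp (- (p * L)) * (exp (p * L) - exp (- (p * L)))"
    by (intro mult_left_mono) auto
  also have "\<dots> = 1 - (x powr p)\<^sup>2" unfolding xp
    by (simp add: algebra_simps power2_eq_square exp_add[symmetric])
  also have "exp (- (p * L)) * (p * (exp L - exp (- L))) = p * (1 - x) * (x powr (p - 1) * (1 + x))"
  proof -
    have xe: "exp L * x = 1" using L(2) by (simp add: exp_minus)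
    have "p * (1 - x) * (x powr (p - 1) * (1 + x)) = exp (- (p * L)) * (p * (exp L - (exp L * x) * x))"
      unfolding xp by (simp add: algebra_simps)
    then show ?thesis unfolding L(2)[symmetric] by (simp only: xe mult_1)
  qed
  finally have A: "p * (1 - x) * (x powr (p - 1) * (1 + x)) \<le> 1 - (x powr p)\<^sup>2" .
  have B: "2 * p * (1 - x) = (1 - x powr p) * (2 + a)" using root a by (simp add: field_simps)
  have x1: "x powr p < 1" using x p by (simp add: powr_def mult_pos_neg)
  have xm: "x powr (p - 1) * x = x powr p" using x by (simp add: powr_diff)
  \<comment> \<open>Both sides acquire the positive factor \<open>1 - x powr p\<close>, the left one
    through the root equation, the right one as a difference of squares.\<close>
  have "(1 - x powr p) * (2 + a) * (x powr (p - 1) * (1 + x)) \<le> 2 * (1 - (x powr p)\<^sup>2)"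
    unfolding B[symmetric] using A by (simp add: mult.assoc)
  also have "\<dots> = (1 - x powr p) * (2 * (1 + x powr p))" by (simp add: algebra_simps power2_eq_square)
  finally have "(2 + a) * (x powr (p - 1) * (1 + x)) \<le> 2 * (1 + x powr p)" using x1 by (simp add: mult.assoc)
  then have "(2 + a) * (x powr (p - 1) + x powr p) \<le> 2 * (1 + x powr p)" using xm by (simp add: distrib_left)
  then show ?thesis by (simp add: algebra_simps)
qed

lemma amplitude_ratio_ln:
  fixes x :: real
  assumes x: "0 < x" "x < 1" and a: "0 < 2 + a" and root: "2 / (2 + a) * (- ln x) - 1 + x = 0"
  shows "x * a \<le> 2 - x * (2 + a)"
proof -
  define L where "L = - ln x"
  have L: "0 \<le> L" "x = exp (- L)" using x by (auto simp: L_def)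
  have "exp (- L) * (2 * L) \<le> exp (- L) * (exp L - exp (- L))"
    using sinh_ge[OF L(1)] by (intro mult_left_mono) (auto simp: sinh_field_def)
  also have "\<dots> = 1 - x\<^sup>2" unfolding L(2) by (simp add: algebra_simps power2_eq_square exp_minus)
  finally have A: "x * (2 * L) \<le> 1 - x\<^sup>2" unfolding L(2) .
  have "2 * L = (1 - x) * (2 + a)" using root a unfolding L_def[symmetric] by (simp add: field_simps)
  then have "(1 - x) * (x * (2 + a)) = x * (2 * L)" by simp
  also have "\<dots> \<le> (1 - x) * (1 + x)" using A by (simp add: algebra_simps power2_eq_square)
  finally have "x * (2 + a) \<le> 1 + x" using x by simp
  then show ?thesis by (simp add: algebra_simps)
qed

section \<open>The levels exhaust the admissible depths\<close>

context nonlinearity begin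

lemma E_antimono: assumes "z \<le> z'" "kap * z' < 1" shows "E z' \<le> E z"
proof -
  have "- E z \<le> - E z'"
  proof (rule DERIV_nonneg_imp_nondecreasing[where f = "\<lambda>z. - E z", OF assms(1)])
    fix x assume "z \<le> x" "x \<le> z'"
    then have k: "kap * x < 1" using kap_mult_less assms by blast
    show "\<exists>y. ((\<lambda>z. - E z) has_real_derivative y) (at x) \<and> 0 \<le> y"
      by (rule DERIV_nonnegI[OF DERIV_minus[OF E_deriv[OF k]]]) (use E1_pos[OF k] in simp)
  qed
  then show ?thesis by simp
qed

text \<open>If no level exceeded \<open>Z\<close>, the amplitudes would be at least
  \<open>2 * E Z\<close>, and each step would shrink \<open>E1\<close> by a fixed factor less than
  1. But \<open>E1\<close> at the levels is bounded below by \<open>E1 Z > 0\<close>.\<close>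

lemma levels_cofinal:
  assumes ss: "\<And>k. kap * ss k < 1" "\<And>k. 2 * E (ss k) \<le> aa k" "\<And>k. 0 < aa k"
    "\<And>k. E1 (ss (Suc k)) * (2 + aa k) = (2 - aa (Suc k)) * E1 (ss k)" and Z: "kap * Z < 1"
  shows "\<exists>k. Z < ss k"
proof (rule ccontr)
  assume "\<not> ?thesis"
  then have le: "ss k \<le> Z" for k by (meson not_less)
  define e where "e = E Z"
  have e: "0 < e" by (simp add: e_def)
  define r where "r = 1 / (1 + e)"
  have r: "0 < r" "r < 1" using e by (auto simp: r_def)
  have step: "E1 (ss (Suc k)) \<le> r * E1 (ss k)" for k
  proof -
    have "2 * e \<le> aa k" using E_antimono[OF le[of k] Z] ss(2)[of k] by (simp add: e_def)
    then have "E1 (ss (Suc k)) * (2 + 2 * e) \<le> E1 (ss (Suc k)) * (2 + aa k)"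
      using E1_pos[OF ss(1)[of "Suc k"]] by (intro mult_left_mono) auto
    also have "\<dots> \<le> 2 * E1 (ss k)" unfolding ss(4)
      using ss(3)[of "Suc k"] E1_pos[OF ss(1)[of k]] by (intro mult_right_mono) auto
    finally have "E1 (ss (Suc k)) * (1 + e) \<le> E1 (ss k)" by (simp add: algebra_simps)
    then show ?thesis using e by (simp add: r_def pos_le_divide_eq)
  qed
  have "E1 (ss k) \<le> r ^ k * E1 (ss 0)" for k
  proof (induction k)
    case (Suc k)
    then have "r * E1 (ss k) \<le> r * (r ^ k * E1 (ss 0))" using r by (intro mult_left_mono) auto
    then show ?case using step[of k] by simp
  qed simp
  moreover have "E1 Z \<le> E1 (ss k)" for k using E1_antimono[OF le Z] .
  ultimately have "E1 Z \<le> r ^ k * E1 (ss 0)" for k by (meson order_trans)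
  moreover have "(\<lambda>k. r ^ k * E1 (ss 0)) \<longlonglongrightarrow> 0 * E1 (ss 0)"
    using r by (intro tendsto_mult LIMSEQ_realpow_zero tendsto_const) auto
  ultimately have "E1 Z \<le> 0 * E1 (ss 0)" by (intro LIMSEQ_le_const) auto
  then show False using E1_pos[OF Z] by simp
qed

text \<open>The dictionary between depths and the recursion: if \<open>d\<close> is \<delta>, the
  scaled depth is \<open>(1 - d) / kap\<close>, and \<open>E\<close> is \<eta>.\<close>

lemma E_powr:
  assumes "kap \<noteq> 0" "0 < d"
  shows "1 - kap * ((1 - d) / kap) = d" "E ((1 - d) / kap) = d powr (1 / kap)" "E1 ((1 - d) / kap) = d powr (1 / kap - 1)"
proof -
  show 1: "1 - kap * ((1 - d) / kap) = d" using assms by simp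
  show 2: "E ((1 - d) / kap) = d powr (1 / kap)" unfolding E_def LE_def 1 using assms by (simp add: powr_def)
  show "E1 ((1 - d) / kap) = d powr (1 / kap - 1)" unfolding E1_def 1 2 using assms by (simp add: powr_diff)
qed

lemma E_exp: assumes "kap = 0" "0 < d" shows "E (- ln d) = d" "E1 (- ln d) = d"
  using assms by (auto simp: E1_def E_def LE_def)

end

context profiles begin

text \<open>In the invariant, \<open>A \<le> 2\<close> gives \<open>2 + A < 2 * p\<close>, as
  \<open>ex_delta\<close> demands. The inequality \<open>2 * d powr p \<le> A\<close> starts as an
  equality and is inherited through \<open>amplitude_ratio_powr\<close>, since \<open>A\<close>
  falls at most by the factor by which \<open>d powr p\<close> falls.\<close>

lemma bubble_chain_powr:
  assumes k: "kap \<noteq> 0" and p: "p = 1 / kap"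
  defines "A \<equiv> \<lambda>k. fst (seqH p k)" and "d \<equiv> \<lambda>k. snd (seqH p k)"
  shows "bubble ((1 - d k) / kap) (A k) \<and> 0 < A k \<and> A k \<le> 2 \<and> 0 < d k \<and> d k \<le> 1 \<and> 2 * d k powr p \<le> A k"
    and "d (Suc k) powr (p - 1) * (2 + A k) = (2 - A (Suc k)) * d k powr (p - 1)"
proof -
  have kp: "0 < kap" using k kap_nonneg by simp
  have p2: "2 < p" using kp kap_less_half unfolding p by (simp add: field_simps)
  have step: "0 < d (Suc k) \<and> d (Suc k) < d k \<and> 2 * p / (2 + A k) * (1 - d (Suc k) / d k) - 1 + (d (Suc k) / d k) powr p = 0
     \<and> A (Suc k) = 2 - (d (Suc k) / d k) powr (p - 1) * (2 + A k)" if "0 < A k" "A k \<le> 2" "0 < d k" for k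
  proof -
    have "\<exists>d'. 0 < d' \<and> d' < d k \<and> 2 * p / (2 + A k) * (1 - d' / d k) - 1 + (d' / d k) powr p = 0"
      by (rule ex_delta) (use that p2 in auto)
    from someI_ex[OF this] show ?thesis unfolding A_def d_def by (simp add: Let_def)
  qed
  have inv: "bubble ((1 - d k) / kap) (A k) \<and> 0 < A k \<and> A k \<le> 2 \<and> 0 < d k \<and> d k \<le> 1 \<and> 2 * d k powr p \<le> A k" for k
  proof (induction k)
    case 0
    then show ?case using bubble_0 by (simp add: A_def d_def)
  next
    case (Suc k)
    define x where "x = d (Suc k) / d k"
    have IH: "bubble ((1 - d k) / kap) (A k)" "0 < A k" "A k \<le> 2" "0 < d k" "d k \<le> 1" "2 * d k powr p \<le> A k" using Suc by auto
    have st: "0 < d (Suc k)" "d (Suc k) < d k" "2 * p / (2 + A k) * (1 - x) - 1 + x powr p = 0"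
      "A (Suc k) = 2 - x powr (p - 1) * (2 + A k)" using step[OF IH(2-4)] by (auto simp: x_def)
    have x: "0 < x" "x < 1" "d (Suc k) = x * d k" using st IH by (auto simp: x_def)
    \<comment> \<open>The scaled slope with \<open>P = 2 + A k\<close> at the current level, where
      \<open>E1\<close> equals \<open>d k powr (p - 1)\<close>.\<close>
    define S where "S = (2 + A k) / d k powr (p - 1)"
    have dp: "0 < d k powr (p - 1)" using IH by simp
    have S: "S * E1 ((1 - d k) / kap) = 2 + A k"
      unfolding E_powr(3)[OF k IH(4)] p[symmetric] S_def using dp by simp
    have E1S: "E1 ((1 - d (Suc k)) / kap) * S = x powr (p - 1) * (2 + A k)"
      unfolding E_powr(3)[OF k st(1)] p[symmetric] S_def unfolding x(3) using IH x dp by (simp add: powr_mult)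
    \<comment> \<open>This is the equation of the recursion multiplied by
      \<open>d k powr p\<close>.\<close>
    have root: "E ((1 - d (Suc k)) / kap) - E ((1 - d k) / kap) + 2 * ((1 - d (Suc k)) / kap - (1 - d k) / kap) / S = 0"
    proof -
      have dk: "d k powr p = d k powr (p - 1) * d k" using IH by (simp add: powr_diff)
      have "(1 - d (Suc k)) / kap - (1 - d k) / kap = p * (d k * (1 - x))"
        unfolding p x(3) using kp by (simp add: field_simps)
      then have e: "2 * ((1 - d (Suc k)) / kap - (1 - d k) / kap) / S = d k powr p * (2 * p / (2 + A k) * (1 - x))"
        unfolding S_def dk using IH(2) by simp
      have "E ((1 - d (Suc k)) / kap) - E ((1 - d k) / kap) = d k powr p * (x powr p - 1)"
        unfolding E_powr(2)[OF k st(1)] E_powr(2)[OF k IH(4)] p[symmetric] unfolding x(3) using x IH by (simp add: powr_mult algebra_simps)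
      then have "E ((1 - d (Suc k)) / kap) - E ((1 - d k) / kap) + 2 * ((1 - d (Suc k)) / kap - (1 - d k) / kap) / S
         = d k powr p * (2 * p / (2 + A k) * (1 - x) - 1 + x powr p)" unfolding e by (simp add: algebra_simps)
      then show ?thesis unfolding st(3) by simp
    qed
    have b: "bubble ((1 - d (Suc k)) / kap) (2 - E1 ((1 - d (Suc k)) / kap) * S)" "0 < 2 - E1 ((1 - d (Suc k)) / kap) * S"
    proof -
      have l: "0 \<le> (1 - d k) / kap" "(1 - d k) / kap < (1 - d (Suc k)) / kap" "kap * ((1 - d (Suc k)) / kap) < 1"
        using IH st kp by (auto simp: divide_strict_right_mono)
      show "bubble ((1 - d (Suc k)) / kap) (2 - E1 ((1 - d (Suc k)) / kap) * S)" "0 < 2 - E1 ((1 - d (Suc k)) / kap) * S"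
        using bubble_step[OF IH(1) l IH(2) S root] .
    qed
    have "x powr p * A k \<le> A (Suc k)" unfolding st(4)
      by (rule amplitude_ratio_powr[OF x(1,2) _ _ st(3)]) (use p2 IH in auto)
    moreover have "x powr p * (2 * d k powr p) \<le> x powr p * A k" using IH by (intro mult_left_mono) auto
    moreover have "d (Suc k) powr p = x powr p * d k powr p" unfolding x(3) using x IH by (simp add: powr_mult)
    ultimately have "2 * d (Suc k) powr p \<le> A (Suc k)" by simp
    moreover have "A (Suc k) \<le> 2" unfolding st(4) using IH by simp
    ultimately show ?case using b IH st unfolding E1S st(4)[symmetric] by simp
  qed
  show "bubble ((1 - d k) / kap) (A k) \<and> 0 < A k \<and> A k \<le> 2 \<and> 0 < d k \<and> d k \<le> 1 \<and> 2 * d k powr p \<le> A k" by (rule inv)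
  show "d (Suc k) powr (p - 1) * (2 + A k) = (2 - A (Suc k)) * d k powr (p - 1)"
  proof -
    have i: "0 < A k" "A k \<le> 2" "0 < d k" using inv[of k] by auto
    then show ?thesis using step[OF i] by (simp add: powr_divide)
  qed
qed

text \<open>Here \<open>d\<close> is the sequence \<eta> itself, and the scaled depth is its
  negative logarithm.\<close>

lemma bubble_chain_exp:
  assumes k: "kap = 0"
  defines "A \<equiv> \<lambda>k. fst (seqL k)" and "d \<equiv> \<lambda>k. snd (seqL k)"
  shows "bubble (- ln (d k)) (A k) \<and> 0 < A k \<and> 0 < d k \<and> d k \<le> 1 \<and> 2 * d k \<le> A k"
    and "d (Suc k) * (2 + A k) = (2 - A (Suc k)) * d k"
proof -
  have step: "0 < d (Suc k) \<and> d (Suc k) < d k \<and> 2 / (2 + A k) * ln (d k / d (Suc k)) - 1 + d (Suc k) / d k = 0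
     \<and> A (Suc k) = 2 - d (Suc k) / d k * (2 + A k)" if "0 < A k" "0 < d k" for k
  proof -
    have "\<exists>d'. 0 < d' \<and> d' < d k \<and> 2 / (2 + A k) * ln (d k / d') - 1 + d' / d k = 0"
      by (rule ex_eta) (use that in auto)
    from someI_ex[OF this] show ?thesis unfolding A_def d_def by (simp add: Let_def)
  qed
  have inv: "bubble (- ln (d k)) (A k) \<and> 0 < A k \<and> 0 < d k \<and> d k \<le> 1 \<and> 2 * d k \<le> A k" for k
  proof (induction k)
    case 0
    then show ?case using bubble_0 by (simp add: A_def d_def)
  next
    case (Suc k)
    define x where "x = d (Suc k) / d k"
    have IH: "bubble (- ln (d k)) (A k)" "0 < A k" "0 < d k" "d k \<le> 1" "2 * d k \<le> A k" using Suc by auto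
    have st: "0 < d (Suc k)" "d (Suc k) < d k" "2 / (2 + A k) * ln (d k / d (Suc k)) - 1 + x = 0"
      "A (Suc k) = 2 - x * (2 + A k)" using step[OF IH(2,3)] by (auto simp: x_def)
    have x: "0 < x" "x < 1" "d (Suc k) = x * d k" using st IH by (auto simp: x_def)
    have lnx: "ln (d k / d (Suc k)) = - ln x" unfolding x(3) using x IH by (simp add: ln_div)
    define S where "S = (2 + A k) / d k"
    have S: "S * E1 (- ln (d k)) = 2 + A k"
      unfolding E_exp(2)[OF k IH(3)] S_def using IH by simp
    have E1S: "E1 (- ln (d (Suc k))) * S = x * (2 + A k)"
      unfolding E_exp(2)[OF k st(1)] S_def unfolding x(3) using IH by simp
    have root: "E (- ln (d (Suc k))) - E (- ln (d k)) + 2 * (- ln (d (Suc k)) - (- ln (d k))) / S = 0"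
    proof -
      have eq: "- ln (d (Suc k)) - (- ln (d k)) = - ln x" unfolding x(3) using x IH by (simp add: ln_mult)
      have "E (- ln (d (Suc k))) - E (- ln (d k)) + 2 * (- ln (d (Suc k)) - (- ln (d k))) / S
         = d k * (2 / (2 + A k) * (- ln x) - 1 + x)"
        unfolding eq E_exp(1)[OF k st(1)] E_exp(1)[OF k IH(3)] S_def using x(3) by (simp add: algebra_simps)
      then show ?thesis using st(3) unfolding lnx by simp
    qed
    have b: "bubble (- ln (d (Suc k))) (2 - E1 (- ln (d (Suc k))) * S)" "0 < 2 - E1 (- ln (d (Suc k))) * S"
    proof -
      have l: "0 \<le> - ln (d k)" "- ln (d k) < - ln (d (Suc k))" "kap * (- ln (d (Suc k))) < 1"
        using IH st k by auto
      show "bubble (- ln (d (Suc k))) (2 - E1 (- ln (d (Suc k))) * S)" "0 < 2 - E1 (- ln (d (Suc k))) * S"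
        using bubble_step[OF IH(1) l IH(2) S root] .
    qed
    have "x * A k \<le> A (Suc k)" unfolding st(4)
      by (rule amplitude_ratio_ln[OF x(1,2)]) (use st(3) lnx IH in auto)
    moreover have "x * (2 * d k) \<le> x * A k" using IH x by (intro mult_left_mono) auto
    ultimately have "2 * d (Suc k) \<le> A (Suc k)" unfolding x(3) by simp
    then show ?case using b IH st unfolding E1S st(4)[symmetric] by simp
  qed
  show "bubble (- ln (d k)) (A k) \<and> 0 < A k \<and> 0 < d k \<and> d k \<le> 1 \<and> 2 * d k \<le> A k" by (rule inv)
  show "d (Suc k) * (2 + A k) = (2 - A (Suc k)) * d k"
  proof -
    have i: "0 < A k" "0 < d k" using inv[of k] by auto
    then show ?thesis using step[OF i] by simp
  qed
qed

text \<open>The scaled depth \<open>z\<close> at which \<open>E z\<close> is the \<eta> of index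
  \<open>k\<close>, counted from 0.\<close>

definition sk :: "nat \<Rightarrow> real" where
  "sk k = (if kap = 0 then - ln (snd (seqL k)) else (1 - snd (seqH (1 / kap) k)) / kap)"
definition ak :: "nat \<Rightarrow> real" where
  "ak k = (if kap = 0 then fst (seqL k) else fst (seqH (1 / kap) k))"

lemma tower_exists:
  obtains TT where "bubble_tower g g1 g2 t0 q ff hh H Hb hlo hhi lam mu w v TT sk ak"
proof -
  have A: "bubble (sk k) (ak k) \<and> kap * sk k < 1 \<and> 0 < ak k \<and> 2 * E (sk k) \<le> ak k \<and>
     E1 (sk (Suc k)) * (2 + ak k) = (2 - ak (Suc k)) * E1 (sk k)" for k
  proof (cases "kap = 0")
    case True
    note c = bubble_chain_exp[OF True]
    have d: "0 < snd (seqL k)" "0 < snd (seqL (Suc k))" using c(1) by blast+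
    show ?thesis unfolding sk_def ak_def if_P[OF True] E_exp[OF True d(1)] E_exp[OF True d(2)]
      using c(1)[of k] c(2)[of k] True by simp
  next
    case False
    note c = bubble_chain_powr[OF False refl]
    have d: "0 < snd (seqH (1/kap) k)" "0 < snd (seqH (1/kap) (Suc k))" using c(1) by blast+
    show ?thesis unfolding sk_def ak_def if_not_P[OF False] E_powr[OF False d(1)] E_powr[OF False d(2)]
      using c(1)[of k] c(2)[of k] False d by simp
  qed
  then have "\<forall>k. \<exists>T. (\<forall>\<^sub>F n in sequentially. 0 < T n \<and> P n (T n) = 2) \<and>
     (\<lambda>n. zz n (T n)) \<longlonglongrightarrow> sk k \<and> (\<lambda>n. Y n (T n)) \<longlonglongrightarrow> (ak k)\<^sup>2 / 2"
    unfolding bubble_def by blast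
  from choice[OF this] obtain TT where TT: "\<forall>k. (\<forall>\<^sub>F n in sequentially. 0 < TT k n \<and> P n (TT k n) = 2) \<and>
     (\<lambda>n. zz n (TT k n)) \<longlonglongrightarrow> sk k \<and> (\<lambda>n. Y n (TT k n)) \<longlonglongrightarrow> (ak k)\<^sup>2 / 2" ..
  show ?thesis
  proof (rule that)
    show "bubble_tower g g1 g2 t0 q ff hh H Hb hlo hhi lam mu w v TT sk ak"
    proof unfold_locales
      fix z assume "kap * z < 1"
      then show "\<exists>k. z < sk k" using levels_cofinal[of sk ak z] A by blast
    qed (use TT A in auto)
  qed
qed

end

section \<open>Transfer to the radial equation\<close>

theorem theorem1p3:
  fixes h h1 :: "real \<Rightarrow> real"
    and f f1 f2 g g1 g2 :: "real \<Rightarrow> real"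
    and t0 q :: real and p :: ereal
    and lam mu :: "nat \<Rightarrow> real"
    and u u1 u2 :: "nat \<Rightarrow> real \<Rightarrow> real"
  assumes h_C1: "\<forall>r\<in>{0..1}. (h has_real_derivative h1 r) (at r within {0..1})"
      and h1_cont: "continuous_on {0..1} h1"
      and h_pos: "\<forall>r\<in>{0..1}. h r > 0"
      and f_C1: "\<forall>t\<in>{0..}. (f has_real_derivative f1 t) (at t within {0..})"
      and f1_cont: "continuous_on {0..} f1"
      and f_nonneg: "\<forall>t\<in>{0..}. f t \<ge> 0"
      and t0: "t0 \<ge> 0"
      and f_pos: "\<forall>t\<in>{t0..}. f t > 0"
      and f_C2: "\<forall>t\<in>{t0..}. (f1 has_real_derivative f2 t) (at t within {t0..})"
      and f2_cont: "continuous_on {t0..} f2"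
      and g_def: "\<forall>t\<in>{t0..}. g t = ln (f t)"
      and g_d1: "\<forall>t\<in>{t0..}. (g has_real_derivative g1 t) (at t within {t0..})"
      and g_d2: "\<forall>t\<in>{t0..}. (g1 has_real_derivative g2 t) (at t within {t0..})"
      \<comment> \<open>(H1)(i)\<close>
      and H1_pos: "\<forall>t\<in>{t0..}. g1 t > 0 \<and> g2 t > 0"
      and q_range: "1 \<le> q" "q < 2"
      and p_range: "0 < p" "q > 1 \<longrightarrow> p < \<infinity>"
      and H1_q: "((\<lambda>t. (g1 t)\<^sup>2 / (g t * g2 t)) \<longlongrightarrow> q) at_top"
      and H1_p: "((\<lambda>t. ereal (t * g1 t / g t)) \<longlongrightarrow> p) at_top"
      \<comment> \<open>(H1)(ii)\<close>
      and H1_ii: "q = 1 \<longrightarrow>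
          (mono_on {t0..} (\<lambda>t. t * g1 t / g t) \<and>
           (\<exists>k::nat. k \<ge> 1 \<and> (\<exists>gh gh1 gh2 :: real \<Rightarrow> real.
              (\<forall>t\<in>{t0..}. (gh has_real_derivative gh1 t) (at t within {t0..})) \<and>
              (\<forall>t\<in>{t0..}. (gh1 has_real_derivative gh2 t) (at t within {t0..})) \<and>
              continuous_on {t0..} gh2 \<and>
              (\<forall>t\<in>{t0..}. f t = (exp ^^ k) (gh t)) \<and>
              antimono_on {t0..} (\<lambda>t. gh1 t / gh t))))"
      \<comment> \<open>the solutions (lambda_n, mu_n, u_n), u_n in C^2([0,1])\<close>
      and lam_pos: "\<forall>n. lam n > 0"
      and mu_pos: "\<forall>n. mu n > 0"
      and u_d1: "\<forall>n. \<forall>r\<in>{0..1}. (u n has_real_derivative u1 n r) (at r within {0..1})"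
      and u_d2: "\<forall>n. \<forall>r\<in>{0..1}. (u1 n has_real_derivative u2 n r) (at r within {0..1})"
      and u2_cont: "\<forall>n. continuous_on {0..1} (u2 n)"
      and u_eq: "\<forall>n. \<forall>r\<in>{0<..<1}. - u2 n r - u1 n r / r = lam n * h r * f (u n r)"
      and u_pos: "\<forall>n. \<forall>r\<in>{0<..<1}. u n r > 0"
      and u_0: "\<forall>n. u n 0 = mu n"
      and u1_0: "\<forall>n. u1 n 0 = 0"
      and u_1: "\<forall>n. u n 1 = 0"
      and mu_lim: "filterlim mu at_top sequentially"
  shows "\<exists>s :: nat \<Rightarrow> nat. \<exists>rk :: nat \<Rightarrow> nat \<Rightarrow> real. strict_mono s \<and>
     (\<forall>k\<ge>1. \<forall>n. rk k n \<in> {0<..<1}) \<and>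
     (\<forall>k\<ge>1. (\<lambda>n. u (s n) (rk k n) / mu (s n)) \<longlonglongrightarrow> delta_seq q (real_of_ereal p) k) \<and>
     (\<forall>k\<ge>1. (\<lambda>n. lam (s n) * (rk k n)\<^sup>2 * h (rk k n) * f1 (u (s n) (rk k n)))
                \<longlonglongrightarrow> (a_seq q (real_of_ereal p) k)\<^sup>2 / 2) \<and>
     (q = 1 \<longrightarrow> (\<forall>k\<ge>1. \<exists>e :: nat \<Rightarrow> real. e \<longlonglongrightarrow> 0 \<and>
          (\<forall>\<^sub>F n in sequentially. u (s n) (rk k n) =
              mu (s n) - (ln (1 / eta_seq q (real_of_ereal p) k) + e n) * g (mu (s n)) / g1 (mu (s n))))) \<and>
     \<comment> \<open>(1)\<close>
     (\<forall>rr :: nat \<Rightarrow> real. (\<forall>n. rr n \<in> {0<..<1}) \<and>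
        (if q > 1 then (\<lambda>n. u (s n) (rr n) / mu (s n)) \<longlonglongrightarrow> 0
         else filterlim (\<lambda>n. (mu (s n) - u (s n) (rr n)) * g1 (mu (s n)) / g (mu (s n)))
                at_top sequentially)
        \<longrightarrow> filterlim (\<lambda>n. integral {0..rr n} (\<lambda>r. lam (s n) * h r * f1 (u (s n) r) * r))
                at_top sequentially) \<and>
     \<comment> \<open>(2)\<close>
     (\<forall>r\<in>{0..<1}. filterlim (\<lambda>n. g1 (mu (s n)) * u (s n) r) at_top sequentially) \<and>
     \<comment> \<open>(3)\<close>
     ((q = 1 \<longrightarrow> (INF t\<in>{0<..}. f t / t) > 0) \<longrightarrow>
        ((\<lambda>n. ln (1 / lam (s n)) / g (mu (s n))) \<longlonglongrightarrow> 0) \<and>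
        (\<forall>k\<ge>1. (\<lambda>n. ln (1 / rk k n) / g (mu (s n)))
                   \<longlonglongrightarrow> eta_seq q (real_of_ereal p) k / 2))"
proof -
  have at_top_deriv: "at t within {t0..} = at t" if "t0 < t" for t :: real
    using that by (intro at_within_interior) simp
  interpret N: nonlinearity g g1 g2 t0 q
  proof
    show "(g has_real_derivative g1 t) (at t)" "(g1 has_real_derivative g2 t) (at t)" "0 < g1 t" "0 < g2 t" if "t0 < t" for t
    proof -
      have t: "t \<in> {t0..}" using that by simp
      show "(g has_real_derivative g1 t) (at t)" "(g1 has_real_derivative g2 t) (at t)" "0 < g1 t" "0 < g2 t"
        using g_d1[rule_format, OF t] g_d2[rule_format, OF t] H1_pos[rule_format, OF t]
        unfolding at_top_deriv[OF that] by simp_all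
    qed
  qed (use t0 q_range H1_q in auto)
  have f_exp: "f x = exp (g x)" if "t0 < x" for x
    using g_def f_pos that by simp
  have f1_eq: "f1 x = g1 x * exp (g x)" if x: "t0 < x" for x
  proof -
    have atx: "at x within {0..} = at x" using x t0 by (intro at_within_interior) simp
    have "x \<in> {0..}" using x t0 by simp
    from f_C1[rule_format, OF this] have "(f has_real_derivative f1 x) (at x)" unfolding atx .
    moreover have "((\<lambda>x. exp (g x)) has_real_derivative exp (g x) * g1 x) (at x)"
      by (rule DERIV_chain2[where f = exp, OF DERIV_exp N.g_deriv[OF x]])
    then have "(f has_real_derivative exp (g x) * g1 x) (at x)"
      by (rule has_field_derivative_transform_within_open[where S = "{t0<..}"]) (use f_exp x in auto)
    ultimately show ?thesis using DERIV_unique by (metis mult.commute)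
  qed
  have cont_h: "continuous_on {0..1} h"
    using h_C1 by (auto intro!: DERIV_continuous_on)
  have cont_u: "continuous_on {0..1} (u n)" and cont_u1: "continuous_on {0..1} (u1 n)" for n
    using u_d1 u_d2 by (auto intro!: DERIV_continuous_on)
  have u_nonneg: "0 \<le> u n r" if r: "r \<in> {0..1}" for n r
  proof -
    have "r = 0 \<or> r = 1 \<or> r \<in> {0<..<1}" using r by auto
    then consider "r = 0" | "r = 1" | "r \<in> {0<..<1}" by blast
    then show ?thesis using u_0 u_1 u_pos mu_pos by cases (auto intro: less_imp_le)
  qed
  obtain r0 where r0: "r0 \<in> {0..1}" "\<And>r. r \<in> {0..1} \<Longrightarrow> h r0 \<le> h r"
    using continuous_attains_inf[OF _ _ cont_h] by auto
  obtain r1 where r1: "r1 \<in> {0..1}" "\<And>r. r \<in> {0..1} \<Longrightarrow> h r \<le> h r1"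
    using continuous_attains_sup[OF _ _ cont_h] by auto
  define hlo where "hlo = h r0"
  define hhi where "hhi = h r1"
  have hlo: "0 < hlo" using h_pos r0 by (simp add: hlo_def)
  have "compact ((\<lambda>r. h1 r / h r) ` {0..1})"
    using h_pos by (intro compact_continuous_image continuous_on_divide h1_cont cont_h) force+
  then obtain Hb where Hb: "0 < Hb" "\<And>r. r \<in> {0..1} \<Longrightarrow> \<bar>h1 r / h r\<bar> \<le> Hb"
    using compact_imp_bounded[of "(\<lambda>r. h1 r / h r) ` {0..1}"] unfolding bounded_pos by auto
  define hh where "hh t = h (exp (- t))" for t
  define H where "H t = - exp (- t) * h1 (exp (- t)) / h (exp (- t))" for t
  define w where "w n t = u n (exp (- t))" for n t
  define v where "v n t = - exp (- t) * u1 n (exp (- t))" for n t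
  have ex: "exp (- t) \<in> {0<..<1}" "exp (- t) \<in> {0..1}" if "0 < t" for t :: real using that by auto
  have at01: "at r within {0..1} = at r" if "r \<in> {0<..<1}" for r :: real
    using that by (intro at_within_interior) auto
  have dexp: "((\<lambda>t. exp (- t)) has_real_derivative - exp (- t)) (at t)" for t :: real
    by (auto intro!: derivative_eq_intros)
  have chain: "((\<lambda>t. F (exp (- t))) has_real_derivative F' * - exp (- t)) (at t)"
    if "(F has_real_derivative F') (at (exp (- t)) within {0..1})" "0 < t" for F F' t
    using that(1) unfolding at01[OF ex(1)[OF that(2)]] by (rule DERIV_chain2[OF _ dexp])
  have lim0: "((\<lambda>t. F (exp (- t))) \<longlongrightarrow> F 0) at_top" if "continuous_on {0..1} F" for F :: "real \<Rightarrow> real"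
  proof (rule continuous_on_tendsto_compose[OF that])
    show "((\<lambda>t::real. exp (- t)) \<longlongrightarrow> 0) at_top"
      by (intro filterlim_compose[OF exp_at_bot]) (simp add: filterlim_uminus_at_bot filterlim_ident)
    show "\<forall>\<^sub>F t in at_top. exp (- t) \<in> {0..(1::real)}"
      using eventually_gt_at_top[of 0] by eventually_elim (rule ex)
  qed simp
  \<comment> \<open>The algebra of \<open>r = exp (- t)\<close>, which turns
    \<open>r\<^sup>2 * (u'' + u' / r)\<close> into \<open>w''\<close>.\<close>
  have polar: "(- (- R)) * b + (a * - R) * (- R) = - (R * R * c)" if "R \<noteq> 0" "- a - b / R = c" for R a b c :: real
  proof -
    have "b + R * a = - (R * c)" using that by (simp add: field_simps)
    then have "R * (b + R * a) = R * (- (R * c))" by simp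
    then show ?thesis by (simp add: algebra_simps)
  qed
  interpret PR: profiles g g1 g2 t0 q f hh H Hb hlo hhi lam mu w v
  proof
    show "0 < lam n" for n using lam_pos by simp
    show "(w n has_real_derivative v n t) (at t)" if t: "0 < t" for n t
      unfolding w_def[abs_def] v_def using chain[of "u n" "u1 n (exp (- t))" t] u_d1 ex(2)[OF t] t by (simp add: mult.commute)
    show "(v n has_real_derivative - (lam n * exp (- 2 * t) * hh t * f (w n t))) (at t)" if t: "0 < t" for n t
    proof -
      let ?r = "exp (- t)"
      have "((\<lambda>t. u1 n (exp (- t))) has_real_derivative u2 n ?r * - ?r) (at t)"
        by (rule chain) (use u_d2 ex(2)[OF t] t in auto)
      then have "((\<lambda>t. - exp (- t) * u1 n (exp (- t))) has_real_derivative (- (- ?r)) * u1 n ?r + (u2 n ?r * - ?r) * (- ?r)) (at t)"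
        by (intro DERIV_mult DERIV_minus dexp)
      moreover have "- u2 n ?r - u1 n ?r / ?r = lam n * h ?r * f (u n ?r)"
        using u_eq ex(1)[OF t] by blast
      then have "(- (- ?r)) * u1 n ?r + (u2 n ?r * - ?r) * (- ?r) = - (?r * ?r * (lam n * h ?r * f (u n ?r)))"
        by (intro polar) simp_all
      moreover have "?r * ?r = exp (- 2 * t)" by (simp add: exp_add[symmetric])
      ultimately show ?thesis unfolding v_def[abs_def] hh_def w_def by (simp add: mult_ac)
    qed
    show "0 \<le> f (w n t)" if "0 < t" for n t
      unfolding w_def using f_nonneg u_nonneg ex(2)[OF that] by simp
    show "f x = exp (g x)" if "t0 < x" for x by (rule f_exp[OF that])
    show "(hh has_real_derivative hh t * H t) (at t)" if t: "0 < t" for t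
    proof -
      have "h (exp (- t)) \<noteq> 0" using h_pos[rule_format, OF ex(2)[OF t]] by simp
      then show ?thesis using chain[of h "h1 (exp (- t))" t] h_C1 ex(2)[OF t] t
        unfolding hh_def[abs_def] H_def by (simp add: mult.commute)
    qed
    show "\<bar>H t\<bar> \<le> Hb * exp (- t)" if t: "0 < t" for t
    proof -
      have "\<bar>H t\<bar> = \<bar>h1 (exp (- t)) / h (exp (- t))\<bar> * exp (- t)" by (simp add: H_def abs_mult)
      also have "\<dots> \<le> Hb * exp (- t)" by (intro mult_right_mono Hb(2) ex(2) t) simp
      finally show ?thesis .
    qed
    show "hlo \<le> hh t" "hh t \<le> hhi" if "0 < t" for t
      unfolding hh_def hlo_def hhi_def using r0(2) r1(2) ex(2)[OF that] by auto
    show "(w n \<longlongrightarrow> mu n) at_top" for n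
      using lim0[OF cont_u] u_0 unfolding w_def[abs_def] by metis
    have "continuous_on {0..1} (\<lambda>r. - r * u1 n r)" for n by (intro continuous_intros cont_u1)
    from lim0[OF this] show "(v n \<longlongrightarrow> 0) at_top" for n
      unfolding v_def[abs_def] by simp
    show "(w n \<longlongrightarrow> 0) (at_right 0)" for n
    proof -
      have "((\<lambda>t. u n (exp (- t))) \<longlongrightarrow> u n 1) (at_right 0)"
      proof (rule continuous_on_tendsto_compose[OF cont_u])
        have "((\<lambda>t::real. exp (- t)) \<longlongrightarrow> exp (- 0)) (at_right 0)" by (intro tendsto_intros)
        then show "((\<lambda>t::real. exp (- t)) \<longlongrightarrow> 1) (at_right 0)" by simp
        show "\<forall>\<^sub>F t in at_right 0. exp (- t) \<in> {0..(1::real)}"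
          using eventually_at_right_less[of 0] by eventually_elim (rule ex)
      qed simp
      then show ?thesis using u_1 unfolding w_def[abs_def] by simp
    qed
    show "filterlim mu at_top sequentially" by (rule mu_lim)
  qed (use Hb hlo in auto)
  obtain TT where "bubble_tower g g1 g2 t0 q f hh H Hb hlo hhi lam mu w v TT PR.sk PR.ak"
    using PR.tower_exists .
  then interpret BT: bubble_tower g g1 g2 t0 q f hh H Hb hlo hhi lam mu w v TT PR.sk PR.ak .
  let ?p = "real_of_ereal p"
  have kap1: "N.kap = 0" if "q = 1" unfolding N.kap_def using that by simp
  \<comment> \<open>\<open>t * g1 t / g t\<close> is the reciprocal of \<open>y t / t\<close>, so
    its given limit \<open>p\<close> can only be \<open>1 / kap\<close>.\<close>
  have kapq: "N.kap \<noteq> 0" "?p = 1 / N.kap" if q: "q \<noteq> 1"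
  proof -
    show k: "N.kap \<noteq> 0" using q q_range by (auto simp: N.kap_def)
    have "((\<lambda>t. inverse (N.y t / t)) \<longlongrightarrow> inverse N.kap) at_top" by (rule tendsto_inverse[OF N.y_over_t k])
    then have "((\<lambda>t. t * g1 t / g t) \<longlongrightarrow> 1 / N.kap) at_top" by (simp add: N.y_def inverse_eq_divide mult.commute)
    then have lim: "((\<lambda>t. ereal (t * g1 t / g t)) \<longlongrightarrow> ereal (1 / N.kap)) at_top" by simp
    have "p = ereal (1 / N.kap)" by (rule tendsto_unique[OF trivial_limit_at_top_linorder H1_p lim])
    then show "?p = 1 / N.kap" by simp
  qed
  have id1: "a_seq q ?p k = PR.ak (k - 1)" "delta_seq q ?p k = 1 - N.kap * PR.sk (k - 1)"
      "eta_seq q ?p k = N.E (PR.sk (k - 1))" if q1: "q = 1" for k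
  proof -
    note k0 = kap1[OF q1]
    have d: "0 < snd (seqL (k - 1))" using PR.bubble_chain_exp(1)[OF k0] by blast
    show "a_seq q ?p k = PR.ak (k - 1)" unfolding a_seq_def PR.ak_def if_P[OF q1] if_P[OF k0] ..
    show "delta_seq q ?p k = 1 - N.kap * PR.sk (k - 1)" unfolding delta_seq_def if_P[OF q1] k0 by simp
    show "eta_seq q ?p k = N.E (PR.sk (k - 1))"
      unfolding eta_seq_def PR.sk_def if_P[OF q1] if_P[OF k0] N.E_exp(1)[OF k0 d] ..
  qed
  have id2: "a_seq q ?p k = PR.ak (k - 1)" "delta_seq q ?p k = 1 - N.kap * PR.sk (k - 1)"
      "eta_seq q ?p k = N.E (PR.sk (k - 1))" if q1: "q \<noteq> 1" for k
  proof -
    note kq = kapq[OF q1]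
    have d: "0 < snd (seqH (1 / N.kap) (k - 1))" using PR.bubble_chain_powr(1)[OF kq(1) refl] by blast
    show "a_seq q ?p k = PR.ak (k - 1)"
      unfolding a_seq_def PR.ak_def if_not_P[OF q1] if_not_P[OF kq(1)] kq(2) ..
    show "delta_seq q ?p k = 1 - N.kap * PR.sk (k - 1)"
      unfolding delta_seq_def PR.sk_def if_not_P[OF q1] if_not_P[OF kq(1)] N.E_powr(1)[OF kq(1) d] kq(2) ..
    show "eta_seq q ?p k = N.E (PR.sk (k - 1))"
      unfolding eta_seq_def PR.sk_def if_not_P[OF q1] if_not_P[OF kq(1)] N.E_powr(2)[OF kq(1) d] kq(2) ..
  qed
  have a_id: "a_seq q ?p k = PR.ak (k - 1)" and delta_id: "delta_seq q ?p k = 1 - N.kap * PR.sk (k - 1)"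
      and eta_id: "eta_seq q ?p k = N.E (PR.sk (k - 1))" for k
    using id1 id2 by blast+
  have ln_eta: "ln (1 / eta_seq q ?p k) = PR.sk (k - 1)" if "q = 1" for k
  proof -
    have "N.E (PR.sk (k - 1)) = exp (- PR.sk (k - 1))" using kap1[OF that] by (simp add: N.E_def N.LE_def)
    then show ?thesis unfolding eta_id by (simp add: ln_div)
  qed
  have ym_mu: "(\<lambda>n. PR.ym n / mu n) \<longlonglongrightarrow> N.kap"
    unfolding PR.ym_def by (rule filterlim_compose[OF N.y_over_t mu_lim])
  \<comment> \<open>\<open>1/2\<close> is a default for the indices \<open>n\<close> at which the
    peak time is not yet positive, since radii have to lie in the open unit interval for every
    \<open>n\<close>. The shift \<open>k - 1\<close> reconciles indices from 1 with levels counted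
    from 0.\<close>
  define rk where "rk k n = (if 0 < TT (k - 1) n then exp (- TT (k - 1) n) else 1/2)" for k n
  have rk_T: "\<forall>\<^sub>F n in sequentially. rk k n = exp (- TT (k - 1) n) \<and> 0 < TT (k - 1) n" for k
    using BT.TT_pos[of "k - 1"] by eventually_elim (simp add: rk_def)
  have rk01: "rk k n \<in> {0<..<1}" for k n by (simp add: rk_def)
  have c_delta: "(\<lambda>n. u n (rk k n) / mu n) \<longlonglongrightarrow> delta_seq q ?p k" for k
  proof -
    have "(\<lambda>n. 1 - PR.ym n / mu n * PR.zz n (TT (k - 1) n)) \<longlonglongrightarrow> 1 - N.kap * PR.sk (k - 1)"
      by (intro tendsto_intros ym_mu BT.zTT)
    moreover have "\<forall>\<^sub>F n in sequentially. 1 - PR.ym n / mu n * PR.zz n (TT (k - 1) n) = u n (rk k n) / mu n"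
      using rk_T[of k] PR.ev_top
    proof eventually_elim
      case (elim n)
      have "u n (rk k n) = mu n - PR.zz n (TT (k - 1) n) * PR.ym n" using elim PR.zz_level[of n "TT (k - 1) n"] by (simp add: w_def)
      then show ?case using mu_pos by (simp add: diff_divide_distrib mult.commute less_imp_neq[symmetric])
    qed
    ultimately show ?thesis unfolding delta_id by (simp add: tendsto_cong)
  qed
  have c_a: "(\<lambda>n. lam n * (rk k n)\<^sup>2 * h (rk k n) * f1 (u n (rk k n))) \<longlonglongrightarrow> (a_seq q ?p k)\<^sup>2 / 2" for k
  proof -
    have "\<forall>\<^sub>F n in sequentially. t0 < w n (TT (k - 1) n)"
      using BT.TT_lims(3)[of "k - 1"] by (simp add: filterlim_at_top_dense)
    then have "\<forall>\<^sub>F n in sequentially. PR.Y n (TT (k - 1) n) = lam n * (rk k n)\<^sup>2 * h (rk k n) * f1 (u n (rk k n))"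
      using rk_T[of k]
    proof eventually_elim
      case (elim n)
      have "(rk k n)\<^sup>2 = exp (- 2 * TT (k - 1) n)" using elim by (simp add: power2_eq_square exp_add[symmetric])
      then show ?case using elim f1_eq[of "w n (TT (k - 1) n)"] by (simp add: PR.Y_def w_def hh_def)
    qed
    from tendsto_cong[OF this] BT.YTT[of "k - 1"] show ?thesis unfolding a_id by simp
  qed
  have c_eta: "\<exists>e :: nat \<Rightarrow> real. e \<longlonglongrightarrow> 0 \<and> (\<forall>\<^sub>F n in sequentially. u n (rk k n) =
      mu n - (ln (1 / eta_seq q ?p k) + e n) * g (mu n) / g1 (mu n))" if q1: "q = 1" for k
  proof (intro exI conjI)
    show "(\<lambda>n. PR.zz n (TT (k - 1) n) - PR.sk (k - 1)) \<longlonglongrightarrow> 0"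
      using BT.zTT[of "k - 1"] by (simp add: LIM_zero_iff)
    show "\<forall>\<^sub>F n in sequentially. u n (rk k n) =
      mu n - (ln (1 / eta_seq q ?p k) + (PR.zz n (TT (k - 1) n) - PR.sk (k - 1))) * g (mu n) / g1 (mu n)"
      using rk_T[of k] PR.ev_top
    proof eventually_elim
      case (elim n)
      have "u n (rk k n) = mu n - PR.zz n (TT (k - 1) n) * PR.ym n" using elim PR.zz_level[of n "TT (k - 1) n"] by (simp add: w_def)
      then show ?case unfolding ln_eta[OF q1] by (simp add: PR.ym_def N.y_def)
    qed
  qed
  have c_1: "filterlim (\<lambda>n. integral {0..rr n} (\<lambda>r. lam n * h r * f1 (u n r) * r)) at_top sequentially"
    if rr: "\<forall>n. rr n \<in> {0<..<1}" and
      lim: "if q > 1 then (\<lambda>n. u n (rr n) / mu n) \<longlonglongrightarrow> 0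
         else filterlim (\<lambda>n. (mu n - u n (rr n)) * g1 (mu n) / g (mu n)) at_top sequentially" for rr
  proof -
    define \<phi> where "\<phi> n r = lam n * h r * f1 (u n r) * r" for n r
    define I where "I n t = integral {0..exp (- t)} (\<phi> n)" for n t
    define tt where "tt n = - ln (rr n)" for n
    have tt: "0 < tt n" "exp (- tt n) = rr n" for n using rr[rule_format, of n] by (auto simp: tt_def)
    have cont: "continuous_on {0..1} (\<phi> n)" for n
    proof -
      have "continuous_on {0..1} (\<lambda>r. f1 (u n r))"
        by (rule continuous_on_compose2[OF f1_cont cont_u]) (use u_nonneg in auto)
      then show ?thesis unfolding \<phi>_def[abs_def] by (intro continuous_intros cont_h)
    qed
    have "filterlim (\<lambda>n. I n (tt n)) at_top sequentially"
    proof (rule BT.integral_diverges[where N = I and ?ff1.0 = f1 and tt = tt])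
      show "(I n has_real_derivative - (lam n * exp (- 2 * t) * hh t * f1 (w n t))) (at t)" if t: "0 < t" for n t
      proof -
        have "((\<lambda>t. integral {0..exp (- t)} (\<phi> n)) has_real_derivative \<phi> n (exp (- t)) * - exp (- t)) (at t)"
          by (rule chain[where F = "\<lambda>x. integral {0..x} (\<phi> n)", OF integral_has_real_derivative[OF cont ex(2)[OF t]] t])
        moreover have e: "exp (- 2 * t) = exp (- t) * exp (- t)" by (simp add: exp_add[symmetric])
        have "\<phi> n (exp (- t)) * - exp (- t) = - (lam n * exp (- 2 * t) * hh t * f1 (w n t))"
          unfolding \<phi>_def w_def hh_def e by (simp only: mult_ac mult_minus_right)
        ultimately show ?thesis unfolding I_def[abs_def] by metis
      qed
      show "(I n \<longlongrightarrow> 0) at_top" for n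
        using lim0[OF indefinite_integral_continuous_1[OF integrable_continuous_interval[OF cont[of n]]]]
        unfolding I_def[abs_def] by simp
      show "\<exists>B. \<forall>x\<in>{0..M}. \<bar>f1 x\<bar> \<le> B" for M
      proof -
        have "compact (f1 ` {0..M})" by (intro compact_continuous_image continuous_on_subset[OF f1_cont]) auto
        from compact_imp_bounded[OF this] obtain B where "\<forall>z\<in>f1 ` {0..M}. norm z \<le> B"
          unfolding bounded_iff ..
        then have "\<forall>x\<in>{0..M}. \<bar>f1 x\<bar> \<le> B" by simp
        then show ?thesis ..
      qed
      show "\<forall>\<^sub>F n in sequentially. z < PR.zz n (tt n)" if z: "N.kap * z < 1" for z
      proof (cases "q > 1")
        case True
        then have k: "0 < N.kap" using kapq(1) N.kap_nonneg by force
        \<comment> \<open>The scaled depth is \<open>1 - u / mu\<close> divided by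
          \<open>ym / mu\<close>; it tends to \<open>1 / kap\<close>, the end of the admissible
          range.\<close>
        have "(\<lambda>n. (1 - u n (rr n) / mu n) * inverse (PR.ym n / mu n)) \<longlonglongrightarrow> (1 - 0) * inverse N.kap"
          using lim True k by (intro tendsto_intros tendsto_inverse ym_mu) auto
        moreover have "\<forall>\<^sub>F n in sequentially. (1 - u n (rr n) / mu n) * inverse (PR.ym n / mu n) = PR.zz n (tt n)"
          using PR.ev_top
        proof eventually_elim
          case (elim n)
          have "0 < mu n" using mu_pos by simp
          then show ?case using elim by (simp add: PR.zz_def w_def tt field_simps)
        qed
        ultimately have "(\<lambda>n. PR.zz n (tt n)) \<longlonglongrightarrow> inverse N.kap" by (simp add: tendsto_cong)
        then show ?thesis by (rule order_tendstoD) (use z k in \<open>simp add: field_simps\<close>)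
      next
        \<comment> \<open>For \<open>q = 1\<close> the quantity assumed to diverge is the scaled
          depth itself.\<close>
        case False
        then have "filterlim (\<lambda>n. (mu n - u n (rr n)) * g1 (mu n) / g (mu n)) at_top sequentially" using lim by simp
        moreover have "(mu n - u n (rr n)) * g1 (mu n) / g (mu n) = PR.zz n (tt n)" for n
          by (simp add: PR.zz_def w_def tt PR.ym_def N.y_def)
        ultimately show ?thesis by (simp add: filterlim_at_top_dense)
      qed
    qed (use f1_eq tt in auto)
    then show ?thesis by (simp add: I_def tt \<phi>_def[abs_def])
  qed
  have c_2: "filterlim (\<lambda>n. g1 (mu n) * u n r) at_top sequentially" if r: "r \<in> {0..<1}" for r
  proof (cases "r = 0")
    case True
    have "filterlim (\<lambda>n. g1 (mu n) * mu n) at_top sequentially"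
      by (intro filterlim_at_top_mult_at_top mu_lim BT.filterlim_gm[unfolded PR.gm_def[abs_def]])
    then show ?thesis using u_0 True by simp
  next
    case False
    then have "0 < - ln r" "exp (- (- ln r)) = r" using r by auto
    then show ?thesis using BT.gm_times_w[of "- ln r"] by (simp add: w_def PR.gm_def)
  qed
  have c_3: "(\<lambda>n. ln (1 / lam n) / g (mu n)) \<longlonglongrightarrow> 0"
  proof -
    have "ln (1 / lam n) = - ln (lam n)" for n using lam_pos[rule_format, of n] by (simp add: ln_div)
    then show ?thesis using tendsto_minus[OF BT.ln_lam_lim] by (simp add: PR.G_def)
  qed
  have c_4: "(\<lambda>n. ln (1 / rk k n) / g (mu n)) \<longlonglongrightarrow> eta_seq q ?p k / 2" for k
  proof -
    have "\<forall>\<^sub>F n in sequentially. TT (k - 1) n / PR.G n = ln (1 / rk k n) / g (mu n)"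
      using rk_T[of k] by eventually_elim (simp add: PR.G_def ln_div)
    from tendsto_cong[OF this] BT.time_lim[of "k - 1"] show ?thesis unfolding eta_id by simp
  qed
  show ?thesis
    \<comment> \<open>The identity serves as the subsequence, every limit having been obtained along
      the full sequence.\<close>
    by (intro exI[of _ "\<lambda>n. n"] exI[of _ rk] conjI allI ballI impI)
       (use rk01 c_delta c_a c_eta c_1 c_2 c_3 c_4 in \<open>auto simp: strict_mono_def\<close>)
qed

end
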